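(* Let $(X,T^{1,0}X)$ be a compact orientable strongly pseudoconvex CR manifold of real dimension $2n+1$, $n\ge1$, with a fixed global real non-vanishing one-form $\omega_0$ such that $\omega_0$ annihilates $T^{1,0}X\oplus T^{0,1}X$ and $-\frac{1}{2i}d\omega_0|_{T^{1,0}X}$ is positive definite, endowed with the Levi metric, and suppose that $\overline\partial_b:\mathrm{Dom}\,\overline\partial_b\subset L^2(X)\to L^2_{(0,1)}(X)$ has closed range. Let $D\subset X$ be any open coordinate patch with local coordinates $x=(x_1,\ldots,x_{2n+1})$, and let $\phi\in\mathscr{C}^\infty(D\times D)$ be a Boutet de Monvel--Sj\"ostrand phase function for the Szeg\H{o} kernel on $D$ (as defined in the context). Let $\phi_1,\phi_2\in\mathscr{C}^\infty(D\times D)$ be such that for $k=1,2$: (i) $\mathrm{Im}\,\phi_k\ge0$; $\phi_k(x,y)=0$ if and only if $x=y$; $d_x\phi_k(x,x)=-d_y\phi_k(x,x)=-\omega_0(x)$ for every $x\in D$; (ii) $(T^2\phi_k)(x,x)=0$ for every $x\in D$; (iii) $\phi_k$ and $\phi$ are equivalent in the sense of Melin--Sj\"ostrand. Suppose that $$\int_0^{+\infty}e^{i\phi_2(x,y)t}\alpha(x,y,t)\,dt\equiv\int_0^{+\infty}e^{i\phi_1(x,y)t}\beta(x,y,t)\,dt\mod\mathscr{C}^\infty(D\times D),$$ where $\alpha,\beta\in S^n_{\mathrm{cl}}(D\times D\times\mathbb{R}_+)$ satisfy $$\alpha_0(x,x)=\beta_0(x,x)\quad\text{and}\quad(T\alpha_0)(x,x)=(T\beta_0)(x,x)=0\quad\text{for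 all }x\in D.$$ Then $$\alpha_1(x,x)=\beta_1(x,x)\quad\text{for every }x\in D.$$
   Context: CR manifold: a smooth manifold $X$ of real dimension $2n+1$ with a complex subbundle $T^{1,0}X\subset\mathbb{C}TX$ of complex rank $n$ with $T^{1,0}X\cap T^{0,1}X=\{0\}$, $T^{0,1}X:=\overline{T^{1,0}X}$, whose smooth sections are closed under the Lie bracket. Levi form and vector field $T$: $\mathcal{L}_x(u,\overline v)=-\frac{1}{2i}\langle d\omega_0(x),u\wedge\overline v\rangle$ for $u,v\in T^{1,0}_xX$ (equivalently $\frac{1}{2i}\langle\omega_0,[\mathring u,\overline{\mathring v}]\rangle(x)$ for sections $\mathring u,\mathring v$ of $T^{1,0}X$ extending $u,v$). $T$ is the global real vector field with $\omega_0(T)\equiv-1$, $d\omega_0(T,\cdot)\equiv0$. For functions on $D\times D$, $T$ acts on the first variable $x$, and $(T\psi)(x,x)$, $(T^2\psi)(x,x)$ mean apply $T$ once, respectively twice, in the first variable and then restrict to the diagonal. Levi metric: the Hermitian metric on $\mathbb{C}TX$ with $\langle u|v\rangle=\mathcal{L}_x(u,\overline v)$ for $u,v\in T^{1,0}_xX$, $\langle\overline u|\overline v\rangle=\overline{\langle u|v\rangle}$, $T^{1,0}X\perp T^{0,1}X$, $T\perp(T^{1,0}X\oplus T^{0,1}X)$, $\langle T|T\rangle=1$. It induces metrics on $\mathbb{C}T^*X$ and the volume form $dV_X=\sqrt{\det(\langle\partial_{x_j}|\partial_{x_k}\rangle)_{j,k=1}^{2n+1}}\,dx_1\wedge\cdots\wedge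 dx_{2n+1}$. Let $T^{*0,1}X\subset\mathbb{C}T^*X$ be the annihilator of $T^{1,0}X\oplus\mathbb{C}T$. $L^2(X)$ and $L^2_{(0,1)}(X)$ are the $L^2$-completions of the smooth functions and of the smooth sections of $T^{*0,1}X$ with respect to the induced inner products. $\overline\partial_b f$ is the orthogonal projection of $df$ onto $T^{*0,1}X$, extended in the distribution sense to $\mathrm{Dom}\,\overline\partial_b=\{u\in L^2(X):\overline\partial_bu\in L^2_{(0,1)}(X)\}$. $\Pi:L^2(X)\to\mathrm{Ker}\,\overline\partial_b$ is the orthogonal projection (Szeg\H{o} projection) and $\Pi(x,y)$ its distribution kernel (Szeg\H{o} kernel). Symbols: $S^m_{1,0}(D\times D\times\mathbb{R}_+)$ is the set of $a\in\mathscr{C}^\infty(D\times D\times\mathbb{R}_+)$ such that for every compact $K\Subset D\times D$ and all multi-indices $\alpha,\beta$ and $\gamma\in\mathbb{N}_0$ there is $C>0$ with $|\partial_x^\alpha\partial_y^\beta\partial_t^\gamma a(x,y,t)|\le C(1+|t|)^{m-|\gamma|}$ for $(x,y)\in K$, $t\ge1$. $S^m_{\mathrm{cl}}$ consists of those $a\in S^m_{1,0}$ with $a\sim\sum_{j\ge0}a_j(x,y)t^{m-j}$, $a_j\in\mathscr{C}^\infty(D\times D)$, meaning $a-\sum_{j<k}a_jt^{m-j}\in S^{m-k}_{1,0}$ for all $k\geq 1$. $b_0,b_1$ denote the first two coefficients of $b\in S^n_{\mathrm{cl}}$. Integrals $\int_0^\infty e^{it\psi(x,y)}b(x,y,t)\,dt$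 are oscillatory integrals, i.e. the distribution limits as $\varepsilon\to0^+$ of $\int_0^\infty e^{it(\psi+i\varepsilon)}b\,dt$ (a cutoff equal to $1$ for large $t$ and $0$ near $t=0$ may be inserted; it only changes the result by a smooth function). "$\equiv$ mod $\mathscr{C}^\infty(D\times D)$" means the difference is a smooth function on $D\times D$. Boutet de Monvel--Sj\"ostrand phase function on $D$: $\phi\in\mathscr{C}^\infty(D\times D)$ satisfying $\mathrm{Im}\,\phi\ge0$, $\phi(x,y)=0$ iff $x=y$, $d_x\phi(x,x)=-d_y\phi(x,x)=-\omega_0(x)$ for all $x\in D$, and such that $\Pi(x,y)\equiv\int_0^\infty e^{it\phi(x,y)}a(x,y,t)\,dt$ mod $\mathscr{C}^\infty(D\times D)$ for some $a\in S^n_{\mathrm{cl}}(D\times D\times\mathbb{R}_+)$ with $a_0(x,x)\ne0$ for all $x\in D$. (Such $\phi$ exist by the theorem of Boutet de Monvel and Sj\"ostrand.) Equivalence in the sense of Melin--Sj\"ostrand for such phase functions: $\psi_1,\psi_2$ are equivalent if there is $f\in\mathscr{C}^\infty(D\times D)$ such that $\psi_2-f\psi_1$ vanishes to infinite order on the diagonal $x=y$. *)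

theory Defs
  imports "HOL-Analysis.Analysis"
begin

section \<open>Smooth functions on open subsets of Euclidean spaces\<close>

primrec Ck_on :: "nat \<Rightarrow> 'a::euclidean_space set \<Rightarrow> ('a \<Rightarrow> 'b::real_normed_vector) \<Rightarrow> bool" where
  "Ck_on 0 S f \<longleftrightarrow> continuous_on S f"
| "Ck_on (Suc k) S f \<longleftrightarrow> (\<forall>x\<in>S. f differentiable (at x)) \<and>
     (\<forall>v. Ck_on k S (\<lambda>x. frechet_derivative f (at x) v))"

definition smooth_on :: "'a::euclidean_space set \<Rightarrow> ('a \<Rightarrow> 'b::real_normed_vector) \<Rightarrow> bool" where
  "smooth_on S f \<longleftrightarrow> open S \<and> (\<forall>k. Ck_on k S f)"

text \<open>Iterated directional derivatives. A multi-index derivative of a smooth function is the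
  case in which the list consists of standard basis vectors.\<close>

primrec iter_deriv :: "'a::euclidean_space list \<Rightarrow> ('a \<Rightarrow> complex) \<Rightarrow> 'a \<Rightarrow> complex" where
  "iter_deriv [] f = f"
| "iter_deriv (v # vs) f = (\<lambda>x. frechet_derivative (iter_deriv vs f) (at x) v)"


section \<open>Smooth manifolds\<close>

text \<open>The manifold is the whole type \<open>'x\<close>, of real dimension \<open>CARD('m)\<close>. A chart
  is an open set together with a coordinate map, whose values outside that set are irrelevant.\<close>

type_synonym ('x, 'm) chart = "'x set \<times> ('x \<Rightarrow> real ^ 'm)"

abbreviation cdom :: "('x, 'm) chart \<Rightarrow> 'x set" where "cdom c \<equiv> fst c"
abbreviation cmap :: "('x, 'm) chart \<Rightarrow> 'x \<Rightarrow> real ^ 'm" where "cmap c \<equiv> snd c"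
abbreviation cinv :: "('x, 'm) chart \<Rightarrow> real ^ 'm \<Rightarrow> 'x" where "cinv c \<equiv> inv_into (cdom c) (cmap c)"

definition is_chart :: "('x::topological_space, 'm::finite) chart \<Rightarrow> bool" where
  "is_chart c \<longleftrightarrow> open (cdom c) \<and> open (cmap c ` cdom c) \<and>
     homeomorphism (cdom c) (cmap c ` cdom c) (cmap c) (cinv c)"

definition smooth_transition :: "('x::topological_space, 'm::finite) chart \<Rightarrow> ('x, 'm) chart \<Rightarrow> bool" where
  "smooth_transition c d \<longleftrightarrow> smooth_on (cmap c ` (cdom c \<inter> cdom d)) (cmap d \<circ> cinv c)"

text \<open>All charts of the smooth structure generated by an atlas, i.e. the maximal atlas.\<close>

definition charts :: "('x::topological_space, 'm::finite) chart set \<Rightarrow> ('x, 'm) chart set" where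
  "charts A = {c. is_chart c \<and> (\<forall>d\<in>A. smooth_transition c d \<and> smooth_transition d c)}"

definition smooth_atlas :: "('x::topological_space, 'm::finite) chart set \<Rightarrow> bool" where
  "smooth_atlas A \<longleftrightarrow> A \<subseteq> charts A \<and> (\<Union>c\<in>A. cdom c) = UNIV"

definition orientable :: "('x::topological_space, 'm::finite) chart set \<Rightarrow> bool" where
  "orientable A \<longleftrightarrow> (\<exists>B\<subseteq>charts A. (\<Union>c\<in>B. cdom c) = UNIV \<and>
     (\<forall>c\<in>B. \<forall>d\<in>B. \<forall>z\<in>cmap c ` (cdom c \<inter> cdom d).
        0 < det (matrix (frechet_derivative (cmap d \<circ> cinv c) (at z)))))"

definition smooth_fun :: "('x::topological_space, 'm::finite) chart set \<Rightarrow> 'x set \<Rightarrow> ('x \<Rightarrow> complex) \<Rightarrow> bool" where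
  "smooth_fun A U f \<longleftrightarrow> open U \<and> (\<forall>c\<in>charts A. smooth_on (cmap c ` (cdom c \<inter> U)) (f \<circ> cinv c))"

definition smooth_near :: "('x::topological_space, 'm::finite) chart set \<Rightarrow> 'x \<Rightarrow> ('x \<Rightarrow> complex) \<Rightarrow> bool" where
  "smooth_near A p f \<longleftrightarrow> (\<exists>U. p \<in> U \<and> smooth_fun A U f)"


section \<open>Complexified tangent vectors, vector fields and one-forms\<close>

text \<open>A complex tangent vector at \<open>p\<close> is the derivation
  \<open>f \<mapsto> \<Sum>j. a\<^sub>j \<partial>f/\<partial>x\<^sub>j(p)\<close> on germs of smooth functions at \<open>p\<close>. It is given the value 0
  on functions that are not smooth near \<open>p\<close>, so that equality of tangent vectors is equality of
  functionals and does not depend on the chart.\<close>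

type_synonym 'x tvec = "('x \<Rightarrow> complex) \<Rightarrow> complex"
type_synonym 'x vfield = "'x \<Rightarrow> 'x tvec"
type_synonym 'x covec = "'x tvec \<Rightarrow> complex"
type_synonym 'x oneform = "'x \<Rightarrow> 'x covec"
type_synonym 'x metric = "'x \<Rightarrow> 'x tvec \<Rightarrow> 'x tvec \<Rightarrow> complex"

definition coord_vec ::
  "('x::topological_space, 'm::finite) chart set \<Rightarrow> ('x, 'm) chart \<Rightarrow> 'x \<Rightarrow> complex ^ 'm \<Rightarrow> 'x tvec" where
  "coord_vec A c p a = (\<lambda>f. if smooth_near A p f
     then \<Sum>j\<in>UNIV. a $ j * frechet_derivative (f \<circ> cinv c) (at (cmap c p)) (axis j 1) else 0)"

definition CT :: "('x::topological_space, 'm::finite) chart set \<Rightarrow> 'x \<Rightarrow> 'x tvec set" where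
  "CT A p = {coord_vec A c p a | c a. c \<in> charts A \<and> p \<in> cdom c}"

definition vconj :: "'x tvec \<Rightarrow> 'x tvec" where
  "vconj v = (\<lambda>f. cnj (v (\<lambda>q. cnj (f q))))"

definition vcomb :: "complex \<Rightarrow> 'x tvec \<Rightarrow> complex \<Rightarrow> 'x tvec \<Rightarrow> 'x tvec" where
  "vcomb a u b v = (\<lambda>f. a * u f + b * v f)"

definition vsum :: "nat \<Rightarrow> (nat \<Rightarrow> complex) \<Rightarrow> (nat \<Rightarrow> 'x tvec) \<Rightarrow> 'x tvec" where
  "vsum n a Z = (\<lambda>f. \<Sum>i<n. a i * Z i f)"

definition smooth_vfield :: "('x::topological_space, 'm::finite) chart set \<Rightarrow> 'x set \<Rightarrow> 'x vfield \<Rightarrow> bool" where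
  "smooth_vfield A U V \<longleftrightarrow> open U \<and> (\<forall>p\<in>U. V p \<in> CT A p) \<and>
     (\<forall>W f. W \<subseteq> U \<longrightarrow> smooth_fun A W f \<longrightarrow> smooth_fun A W (\<lambda>p. V p f))"

definition lie_bracket ::
  "('x::topological_space, 'm::finite) chart set \<Rightarrow> 'x vfield \<Rightarrow> 'x vfield \<Rightarrow> 'x vfield" where
  "lie_bracket A U V p = (\<lambda>f. if smooth_near A p f
     then U p (\<lambda>q. V q f) - V p (\<lambda>q. U q f) else 0)"

definition CTdual :: "('x::topological_space, 'm::finite) chart set \<Rightarrow> 'x \<Rightarrow> 'x covec set" where
  "CTdual A p = {\<eta>. (\<forall>u\<in>CT A p. \<forall>v\<in>CT A p. \<forall>a b. \<eta> (vcomb a u b v) = a * \<eta> u + b * \<eta> v) \<and>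
     (\<forall>v. v \<notin> CT A p \<longrightarrow> \<eta> v = 0)}"

definition smooth_oneform :: "('x::topological_space, 'm::finite) chart set \<Rightarrow> 'x oneform \<Rightarrow> bool" where
  "smooth_oneform A \<eta> \<longleftrightarrow> (\<forall>p. \<eta> p \<in> CTdual A p) \<and>
     (\<forall>U V. smooth_vfield A U V \<longrightarrow> smooth_fun A U (\<lambda>p. \<eta> p (V p)))"

definition real_oneform :: "('x::topological_space, 'm::finite) chart set \<Rightarrow> 'x oneform \<Rightarrow> bool" where
  "real_oneform A \<eta> \<longleftrightarrow> (\<forall>p. \<forall>v\<in>CT A p. \<eta> p (vconj v) = cnj (\<eta> p v))"

definition differential :: "('x::topological_space, 'm::finite) chart set \<Rightarrow> ('x \<Rightarrow> complex) \<Rightarrow> 'x oneform" where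
  "differential A f p = (\<lambda>v. if v \<in> CT A p then v f else 0)"

text \<open>Exterior derivative by
  \<open>d\<eta>(U, V) = U(\<eta>(V)) - V(\<eta>(U)) - \<eta>([U, V])\<close>; the right-hand side at \<open>p\<close> depends only on
  the values \<open>u\<close>, \<open>v\<close> of the fields at \<open>p\<close>.\<close>

definition ext_deriv ::
  "('x::topological_space, 'm::finite) chart set \<Rightarrow> 'x oneform \<Rightarrow> 'x \<Rightarrow> 'x tvec \<Rightarrow> 'x tvec \<Rightarrow> complex" where
  "ext_deriv A \<eta> p u v = (THE z. \<forall>W U V.
     p \<in> W \<longrightarrow> smooth_vfield A W U \<longrightarrow> smooth_vfield A W V \<longrightarrow> U p = u \<longrightarrow> V p = v \<longrightarrow>
     z = U p (\<lambda>q. \<eta> q (V q)) - V p (\<lambda>q. \<eta> q (U q)) - \<eta> p (lie_bracket A U V p))"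


section \<open>CR structures, Levi form and Levi metric\<close>

definition cr_structure ::
  "('x::topological_space, 'm::finite) chart set \<Rightarrow> nat \<Rightarrow> ('x \<Rightarrow> 'x tvec set) \<Rightarrow> bool" where
  "cr_structure A n T10 \<longleftrightarrow>
     (\<forall>p. \<exists>U Z. p \<in> U \<and> (\<forall>i<n. smooth_vfield A U (\<lambda>q. Z q i)) \<and>
        (\<forall>q\<in>U. T10 q = {vsum n a (Z q) | a. True} \<and>
           (\<forall>a. vsum n a (Z q) = (\<lambda>f. 0) \<longrightarrow> (\<forall>i<n. a i = 0)))) \<and>
     (\<forall>p. T10 p \<inter> vconj ` T10 p = {\<lambda>f. 0}) \<and>
     (\<forall>W U V. smooth_vfield A W U \<longrightarrow> smooth_vfield A W V \<longrightarrow>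
        (\<forall>p\<in>W. U p \<in> T10 p \<and> V p \<in> T10 p) \<longrightarrow> (\<forall>p\<in>W. lie_bracket A U V p \<in> T10 p))"

definition levi_form ::
  "('x::topological_space, 'm::finite) chart set \<Rightarrow> 'x oneform \<Rightarrow> 'x \<Rightarrow> 'x tvec \<Rightarrow> 'x tvec \<Rightarrow> complex" where
  "levi_form A \<omega> p u v = - (1 / (2 * \<i>)) * ext_deriv A \<omega> p u (vconj v)"

text \<open>The second argument \<open>v\<close> of \<open>levi_form\<close> is the (1,0)-vector itself, its conjugate being
  taken in the definition.\<close>

definition contact_form ::
  "('x::topological_space, 'm::finite) chart set \<Rightarrow> ('x \<Rightarrow> 'x tvec set) \<Rightarrow> 'x oneform \<Rightarrow> bool" where
  "contact_form A T10 \<omega> \<longleftrightarrow> smooth_oneform A \<omega> \<and> real_oneform A \<omega> \<and>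
     (\<forall>p. \<exists>v\<in>CT A p. \<omega> p v \<noteq> 0) \<and>
     (\<forall>p. \<forall>v\<in>T10 p. \<omega> p v = 0 \<and> \<omega> p (vconj v) = 0) \<and>
     (\<forall>p. \<forall>u\<in>T10 p. u \<noteq> (\<lambda>f. 0) \<longrightarrow>
        Im (levi_form A \<omega> p u u) = 0 \<and> 0 < Re (levi_form A \<omega> p u u))"

definition reeb_field ::
  "('x::topological_space, 'm::finite) chart set \<Rightarrow> 'x oneform \<Rightarrow> 'x vfield \<Rightarrow> bool" where
  "reeb_field A \<omega> T \<longleftrightarrow> smooth_vfield A UNIV T \<and> (\<forall>p. vconj (T p) = T p) \<and>
     (\<forall>p. \<omega> p (T p) = -1) \<and> (\<forall>p. \<forall>v\<in>CT A p. ext_deriv A \<omega> p (T p) v = 0)"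

definition hermitian_metric ::
  "('x::topological_space, 'm::finite) chart set \<Rightarrow> 'x metric \<Rightarrow> bool" where
  "hermitian_metric A h \<longleftrightarrow> (\<forall>p.
     (\<forall>u\<in>CT A p. \<forall>v\<in>CT A p. \<forall>w\<in>CT A p. \<forall>a b.
        h p (vcomb a u b v) w = a * h p u w + b * h p v w) \<and>
     (\<forall>u\<in>CT A p. \<forall>v\<in>CT A p. h p v u = cnj (h p u v)) \<and>
     (\<forall>u\<in>CT A p. u \<noteq> (\<lambda>f. 0) \<longrightarrow> 0 < Re (h p u u)))"

definition levi_metric ::
  "('x::topological_space, 'm::finite) chart set \<Rightarrow> ('x \<Rightarrow> 'x tvec set) \<Rightarrow> 'x oneform \<Rightarrow> 'x vfield \<Rightarrow>
   'x metric \<Rightarrow> bool" where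
  "levi_metric A T10 \<omega> T h \<longleftrightarrow> hermitian_metric A h \<and> (\<forall>p.
     (\<forall>u\<in>T10 p. \<forall>v\<in>T10 p. h p u v = levi_form A \<omega> p u v \<and>
        h p (vconj u) (vconj v) = cnj (h p u v) \<and> h p u (vconj v) = 0) \<and>
     (\<forall>u\<in>T10 p. h p (T p) u = 0 \<and> h p (T p) (vconj u) = 0) \<and>
     h p (T p) (T p) = 1)"

definition gram_det ::
  "('x::topological_space, 'm::finite) chart set \<Rightarrow> 'x metric \<Rightarrow> ('x, 'm) chart \<Rightarrow> 'x \<Rightarrow> complex" where
  "gram_det A h c p =
     det (\<chi> j k. h p (coord_vec A c p (axis j 1)) (coord_vec A c p (axis k 1)))"

text \<open>The measure on Borel sets whose density in every chart is \<open>\<surd>det \<langle>\<partial>\<^sub>j|\<partial>\<^sub>k\<rangle>\<close>;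
  the determinant is real and positive since the metric is real.\<close>

definition volume_measure ::
  "('x::topological_space, 'm::finite) chart set \<Rightarrow> 'x metric \<Rightarrow> 'x measure \<Rightarrow> bool" where
  "volume_measure A h \<mu> \<longleftrightarrow> sets \<mu> = sets borel \<and>
     (\<forall>c\<in>charts A. \<forall>B\<in>sets borel. B \<subseteq> cdom c \<longrightarrow>
        emeasure \<mu> B = (\<integral>\<^sup>+ z\<in>cmap c ` B. ennreal (sqrt (Re (gram_det A h c (cinv c z)))) \<partial>lborel))"


section \<open>The tangential Cauchy--Riemann operator and the Szego projection\<close>

text \<open>The induced metric on covectors, \<open>\<langle>\<eta>|\<zeta>\<rangle> = \<langle>w|u\<rangle>\<close> where \<open>\<eta> = \<langle>\<cdot>|u\<rangle>\<close> and
  \<open>\<zeta> = \<langle>\<cdot>|w\<rangle>\<close> (the representing vector depends antilinearly on the covector).\<close>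

definition riesz :: "('x::topological_space, 'm::finite) chart set \<Rightarrow> 'x metric \<Rightarrow> 'x \<Rightarrow> 'x covec \<Rightarrow> 'x tvec" where
  "riesz A h p \<eta> = (THE u. u \<in> CT A p \<and> (\<forall>v\<in>CT A p. \<eta> v = h p v u))"

definition dual_metric ::
  "('x::topological_space, 'm::finite) chart set \<Rightarrow> 'x metric \<Rightarrow> 'x \<Rightarrow> 'x covec \<Rightarrow> 'x covec \<Rightarrow> complex" where
  "dual_metric A h p \<eta> \<zeta> = h p (riesz A h p \<zeta>) (riesz A h p \<eta>)"

definition T01dual ::
  "('x::topological_space, 'm::finite) chart set \<Rightarrow> ('x \<Rightarrow> 'x tvec set) \<Rightarrow> 'x vfield \<Rightarrow> 'x \<Rightarrow> 'x covec set" where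
  "T01dual A T10 T p = {\<eta> \<in> CTdual A p. (\<forall>v\<in>T10 p. \<eta> v = 0) \<and> \<eta> (T p) = 0}"

definition dbar_b ::
  "('x::topological_space, 'm::finite) chart set \<Rightarrow> ('x \<Rightarrow> 'x tvec set) \<Rightarrow> 'x vfield \<Rightarrow> 'x metric \<Rightarrow>
   ('x \<Rightarrow> complex) \<Rightarrow> 'x oneform" where
  "dbar_b A T10 T h f p = (THE \<eta>. \<eta> \<in> T01dual A T10 T p \<and>
     (\<forall>\<zeta>\<in>T01dual A T10 T p. dual_metric A h p (\<lambda>v. differential A f p v - \<eta> v) \<zeta> = 0))"

text \<open>Elements of the \<open>L\<^sup>2\<close> spaces are represented by measurable, square integrable functions
  and sections; all notions below are invariant under changes on null sets.\<close>

definition L2 :: "'x measure \<Rightarrow> ('x \<Rightarrow> complex) \<Rightarrow> bool" where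
  "L2 \<mu> u \<longleftrightarrow> u \<in> borel_measurable \<mu> \<and> integrable \<mu> (\<lambda>x. (norm (u x))\<^sup>2)"

definition L2_inner :: "'x measure \<Rightarrow> ('x \<Rightarrow> complex) \<Rightarrow> ('x \<Rightarrow> complex) \<Rightarrow> complex" where
  "L2_inner \<mu> u v = (LINT x|\<mu>. u x * cnj (v x))"

definition L2_01 ::
  "('x::topological_space, 'm::finite) chart set \<Rightarrow> ('x \<Rightarrow> 'x tvec set) \<Rightarrow> 'x vfield \<Rightarrow> 'x metric \<Rightarrow>
   'x measure \<Rightarrow> 'x oneform \<Rightarrow> bool" where
  "L2_01 A T10 T h \<mu> g \<longleftrightarrow> (\<forall>p. g p \<in> T01dual A T10 T p) \<and>
     (\<forall>W V. smooth_vfield A W V \<longrightarrow> (\<lambda>p. g p (V p)) \<in> borel_measurable (restrict_space \<mu> W)) \<and>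
     integrable \<mu> (\<lambda>p. Re (dual_metric A h p (g p) (g p)))"

definition L2_01_inner ::
  "('x::topological_space, 'm::finite) chart set \<Rightarrow> 'x metric \<Rightarrow> 'x measure \<Rightarrow>
   'x oneform \<Rightarrow> 'x oneform \<Rightarrow> complex" where
  "L2_01_inner A h \<mu> g s = (LINT p|\<mu>. dual_metric A h p (g p) (s p))"

text \<open>\<open>r\<close> is the image of the smooth (0,1)-form \<open>s\<close> under the formal adjoint of \<open>dbar_b\<close>.\<close>

definition dbar_b_formal_adjoint ::
  "('x::topological_space, 'm::finite) chart set \<Rightarrow> ('x \<Rightarrow> 'x tvec set) \<Rightarrow> 'x vfield \<Rightarrow> 'x metric \<Rightarrow>
   'x measure \<Rightarrow> 'x oneform \<Rightarrow> ('x \<Rightarrow> complex) \<Rightarrow> bool" where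
  "dbar_b_formal_adjoint A T10 T h \<mu> s r \<longleftrightarrow>
     smooth_oneform A s \<and> (\<forall>p. s p \<in> T01dual A T10 T p) \<and> smooth_fun A UNIV r \<and>
     (\<forall>f. smooth_fun A UNIV f \<longrightarrow>
        L2_01_inner A h \<mu> (dbar_b A T10 T h f) s = L2_inner \<mu> f r)"

text \<open>\<open>u \<in> Dom dbar_b\<close> with \<open>dbar_b u = g\<close> in the distribution sense (the manifold is compact,
  so every smooth form is a test form).\<close>

definition has_dbar_b ::
  "('x::topological_space, 'm::finite) chart set \<Rightarrow> ('x \<Rightarrow> 'x tvec set) \<Rightarrow> 'x vfield \<Rightarrow> 'x metric \<Rightarrow>
   'x measure \<Rightarrow> ('x \<Rightarrow> complex) \<Rightarrow> 'x oneform \<Rightarrow> bool" where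
  "has_dbar_b A T10 T h \<mu> u g \<longleftrightarrow> L2 \<mu> u \<and> L2_01 A T10 T h \<mu> g \<and>
     (\<forall>s r. dbar_b_formal_adjoint A T10 T h \<mu> s r \<longrightarrow>
        L2_01_inner A h \<mu> g s = L2_inner \<mu> u r)"

definition dbar_b_closed_range ::
  "('x::topological_space, 'm::finite) chart set \<Rightarrow> ('x \<Rightarrow> 'x tvec set) \<Rightarrow> 'x vfield \<Rightarrow> 'x metric \<Rightarrow>
   'x measure \<Rightarrow> bool" where
  "dbar_b_closed_range A T10 T h \<mu> \<longleftrightarrow> (\<forall>gs g.
     (\<forall>k::nat. \<exists>u. has_dbar_b A T10 T h \<mu> u (gs k)) \<longrightarrow> L2_01 A T10 T h \<mu> g \<longrightarrow>
     (\<lambda>k. LINT p|\<mu>. Re (dual_metric A h p (\<lambda>v. gs k p v - g p v) (\<lambda>v. gs k p v - g p v)))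
        \<longlonglongrightarrow> 0 \<longrightarrow>
     (\<exists>u. has_dbar_b A T10 T h \<mu> u g))"

definition dbar_b_kernel ::
  "('x::topological_space, 'm::finite) chart set \<Rightarrow> ('x \<Rightarrow> 'x tvec set) \<Rightarrow> 'x vfield \<Rightarrow> 'x metric \<Rightarrow>
   'x measure \<Rightarrow> ('x \<Rightarrow> complex) set" where
  "dbar_b_kernel A T10 T h \<mu> = {u. has_dbar_b A T10 T h \<mu> u (\<lambda>p v. 0)}"

text \<open>\<open>w\<close> represents the orthogonal projection of \<open>u\<close> onto the kernel.\<close>

definition szego_projection ::
  "('x::topological_space, 'm::finite) chart set \<Rightarrow> ('x \<Rightarrow> 'x tvec set) \<Rightarrow> 'x vfield \<Rightarrow> 'x metric \<Rightarrow>
   'x measure \<Rightarrow> ('x \<Rightarrow> complex) \<Rightarrow> ('x \<Rightarrow> complex) \<Rightarrow> bool" where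
  "szego_projection A T10 T h \<mu> u w \<longleftrightarrow> L2 \<mu> u \<and> w \<in> dbar_b_kernel A T10 T h \<mu> \<and>
     (\<forall>v\<in>dbar_b_kernel A T10 T h \<mu>. L2_inner \<mu> (\<lambda>x. u x - w x) v = 0)"


section \<open>Distributions on \<open>D \<times> D\<close> for a coordinate patch \<open>D\<close>\<close>

text \<open>Throughout, \<open>c\<close> is the coordinate patch and \<open>D = cdom c\<close>. Functions on \<open>D \<times> D\<close> are
  functions on the whole type whose values outside \<open>D \<times> D\<close> are irrelevant.\<close>

definition cimg :: "('x, 'm::finite) chart \<Rightarrow> (real ^ 'm) set" where
  "cimg c = cmap c ` cdom c"

definition rep2 :: "('x, 'm::finite) chart \<Rightarrow> ('x \<Rightarrow> 'x \<Rightarrow> complex) \<Rightarrow> (real ^ 'm) \<times> (real ^ 'm) \<Rightarrow> complex" where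
  "rep2 c \<psi> = (\<lambda>(z, w). \<psi> (cinv c z) (cinv c w))"

definition smooth2 :: "('x, 'm::finite) chart \<Rightarrow> ('x \<Rightarrow> 'x \<Rightarrow> complex) \<Rightarrow> bool" where
  "smooth2 c \<psi> \<longleftrightarrow> smooth_on (cimg c \<times> cimg c) (rep2 c \<psi>)"

definition test_fun :: "('x::topological_space, 'm::finite) chart \<Rightarrow> ('x \<Rightarrow> complex) \<Rightarrow> bool" where
  "test_fun c u \<longleftrightarrow> smooth_on (cimg c) (u \<circ> cinv c) \<and>
     compact (closure {x. u x \<noteq> 0}) \<and> closure {x. u x \<noteq> 0} \<subseteq> cdom c"

definition test_fun2 :: "('x::topological_space, 'm::finite) chart \<Rightarrow> ('x \<Rightarrow> 'x \<Rightarrow> complex) \<Rightarrow> bool" where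
  "test_fun2 c \<theta> \<longleftrightarrow> smooth2 c \<theta> \<and>
     compact (closure {(x, y). \<theta> x y \<noteq> 0}) \<and> closure {(x, y). \<theta> x y \<noteq> 0} \<subseteq> cdom c \<times> cdom c"

text \<open>Functions are identified with distributions by means of the volume \<open>\<mu> \<otimes> \<mu>\<close>.\<close>

definition pairing :: "'x measure \<Rightarrow> ('x \<Rightarrow> 'x \<Rightarrow> complex) \<Rightarrow> ('x \<Rightarrow> 'x \<Rightarrow> complex) \<Rightarrow> complex" where
  "pairing \<mu> F \<theta> = (LINT z|(\<mu> \<Otimes>\<^sub>M \<mu>). F (fst z) (snd z) * \<theta> (fst z) (snd z))"

definition distribution2 ::
  "('x::topological_space, 'm::finite) chart \<Rightarrow> (('x \<Rightarrow> 'x \<Rightarrow> complex) \<Rightarrow> complex) \<Rightarrow> bool" where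
  "distribution2 c K \<longleftrightarrow>
     (\<forall>\<theta> \<xi> a b. test_fun2 c \<theta> \<longrightarrow> test_fun2 c \<xi> \<longrightarrow>
        K (\<lambda>x y. a * \<theta> x y + b * \<xi> x y) = a * K \<theta> + b * K \<xi>) \<and>
     (\<forall>L. compact L \<longrightarrow> L \<subseteq> cdom c \<times> cdom c \<longrightarrow> (\<exists>C N. \<forall>\<theta> M.
        test_fun2 c \<theta> \<longrightarrow> {(x, y). \<theta> x y \<noteq> 0} \<subseteq> L \<longrightarrow>
        (\<forall>vs. set vs \<subseteq> Basis \<longrightarrow> length vs \<le> N \<longrightarrow>
           (\<forall>z\<in>cimg c \<times> cimg c. norm (iter_deriv vs (rep2 c \<theta>) z) \<le> M)) \<longrightarrow>
        norm (K \<theta>) \<le> C * M))"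

definition equiv_mod_smooth ::
  "('x::topological_space, 'm::finite) chart \<Rightarrow> 'x measure \<Rightarrow> (('x \<Rightarrow> 'x \<Rightarrow> complex) \<Rightarrow> complex) \<Rightarrow>
   (('x \<Rightarrow> 'x \<Rightarrow> complex) \<Rightarrow> complex) \<Rightarrow> bool" where
  "equiv_mod_smooth c \<mu> K1 K2 \<longleftrightarrow>
     (\<exists>F. smooth2 c F \<and> (\<forall>\<theta>. test_fun2 c \<theta> \<longrightarrow> K1 \<theta> - K2 \<theta> = pairing \<mu> F \<theta>))"

text \<open>The Szego kernel on \<open>D \<times> D\<close>: formally \<open>(\<Pi>u)(x) = \<integral> K(x, y) u(y) d\<mu>(y)\<close>.\<close>

definition szego_kernel ::
  "('x::topological_space, 'm::finite) chart set \<Rightarrow> ('x \<Rightarrow> 'x tvec set) \<Rightarrow> 'x vfield \<Rightarrow> 'x metric \<Rightarrow>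
   'x measure \<Rightarrow> ('x, 'm) chart \<Rightarrow> (('x \<Rightarrow> 'x \<Rightarrow> complex) \<Rightarrow> complex) \<Rightarrow> bool" where
  "szego_kernel A T10 T h \<mu> c K \<longleftrightarrow> distribution2 c K \<and>
     (\<forall>u v w. test_fun c u \<longrightarrow> test_fun c v \<longrightarrow> szego_projection A T10 T h \<mu> u w \<longrightarrow>
        K (\<lambda>x y. v x * u y) = (LINT x|\<mu>. w x * v x))"


section \<open>Symbols, oscillatory integrals and phase functions\<close>

definition rep3 :: "('x, 'm::finite) chart \<Rightarrow> ('x \<Rightarrow> 'x \<Rightarrow> real \<Rightarrow> complex) \<Rightarrow>
    (real ^ 'm) \<times> (real ^ 'm) \<times> real \<Rightarrow> complex" where
  "rep3 c a = (\<lambda>(z, w, t). a (cinv c z) (cinv c w) t)"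

definition symbol :: "('x, 'm::finite) chart \<Rightarrow> real \<Rightarrow> ('x \<Rightarrow> 'x \<Rightarrow> real \<Rightarrow> complex) \<Rightarrow> bool" where
  "symbol c m a \<longleftrightarrow> smooth_on (cimg c \<times> cimg c \<times> {0<..}) (rep3 c a) \<and>
     (\<forall>K vs \<gamma>. compact K \<longrightarrow> K \<subseteq> cimg c \<times> cimg c \<longrightarrow>
        set vs \<subseteq> {(b, 0, 0) | b. b \<in> Basis} \<union> {(0, b, 0) | b. b \<in> Basis} \<longrightarrow>
        (\<exists>C>0. \<forall>(z, w)\<in>K. \<forall>t\<ge>1.
           norm (iter_deriv (vs @ replicate \<gamma> (0, 0, 1)) (rep3 c a) (z, w, t))
             \<le> C * (1 + \<bar>t\<bar>) powr (m - real \<gamma>)))"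

text \<open>\<open>a\<close> is a classical symbol of order \<open>m\<close> with coefficients \<open>as 0, as 1, \<dots>\<close>, which
  are uniquely determined on \<open>D \<times> D\<close>.\<close>

definition classical_symbol ::
  "('x, 'm::finite) chart \<Rightarrow> real \<Rightarrow> ('x \<Rightarrow> 'x \<Rightarrow> real \<Rightarrow> complex) \<Rightarrow> (nat \<Rightarrow> 'x \<Rightarrow> 'x \<Rightarrow> complex) \<Rightarrow> bool" where
  "classical_symbol c m a as \<longleftrightarrow> symbol c m a \<and> (\<forall>j. smooth2 c (as j)) \<and>
     (\<forall>k\<ge>1. symbol c (m - real k)
        (\<lambda>x y t. a x y t - (\<Sum>j<k. as j x y * of_real (t powr (m - real j)))))"

text \<open>\<open>K\<close> is the distribution \<open>\<integral>\<^sub>0\<^sup>\<infinity> e\<^sup>i\<^sup>t\<^sup>\<psi> b dt\<close>. Symbols being arbitrary near \<open>t = 0\<close>, a cutoff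
  \<open>\<tau>\<close> is always inserted; different cutoffs give distributions differing by a smooth function.\<close>

definition cutoff :: "(real \<Rightarrow> real) \<Rightarrow> bool" where
  "cutoff \<tau> \<longleftrightarrow> smooth_on UNIV \<tau> \<and> (\<exists>t0>0. \<forall>t\<le>t0. \<tau> t = 0) \<and> (\<exists>t1. \<forall>t\<ge>t1. \<tau> t = 1)"

definition osc_integral ::
  "('x::topological_space, 'm::finite) chart \<Rightarrow> 'x measure \<Rightarrow> ('x \<Rightarrow> 'x \<Rightarrow> complex) \<Rightarrow>
   ('x \<Rightarrow> 'x \<Rightarrow> real \<Rightarrow> complex) \<Rightarrow> (('x \<Rightarrow> 'x \<Rightarrow> complex) \<Rightarrow> complex) \<Rightarrow> bool" where
  "osc_integral c \<mu> \<psi> b K \<longleftrightarrow> (\<exists>\<tau>. cutoff \<tau> \<and> (\<forall>\<theta>. test_fun2 c \<theta> \<longrightarrow>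
     ((\<lambda>\<epsilon>. pairing \<mu> (\<lambda>x y. LINT t:{0<..}|lborel.
        of_real (\<tau> t) * exp (\<i> * of_real t * (\<psi> x y + \<i> * of_real \<epsilon>)) * b x y t) \<theta>)
      \<longlongrightarrow> K \<theta>) (at_right 0)))"

definition phase_function ::
  "('x::topological_space, 'm::finite) chart set \<Rightarrow> 'x oneform \<Rightarrow> ('x, 'm) chart \<Rightarrow>
   ('x \<Rightarrow> 'x \<Rightarrow> complex) \<Rightarrow> bool" where
  "phase_function A \<omega> c \<psi> \<longleftrightarrow> smooth2 c \<psi> \<and>
     (\<forall>x\<in>cdom c. \<forall>y\<in>cdom c. 0 \<le> Im (\<psi> x y) \<and> (\<psi> x y = 0 \<longleftrightarrow> x = y)) \<and>
     (\<forall>x\<in>cdom c. \<forall>v\<in>CT A x.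
        differential A (\<lambda>x'. \<psi> x' x) x v = - \<omega> x v \<and>
        differential A (\<lambda>y'. \<psi> x y') x v = \<omega> x v)"

definition bms_phase_function ::
  "('x::topological_space, 'm::finite) chart set \<Rightarrow> nat \<Rightarrow> ('x \<Rightarrow> 'x tvec set) \<Rightarrow> 'x oneform \<Rightarrow>
   'x vfield \<Rightarrow> 'x metric \<Rightarrow> 'x measure \<Rightarrow> ('x, 'm) chart \<Rightarrow> ('x \<Rightarrow> 'x \<Rightarrow> complex) \<Rightarrow> bool" where
  "bms_phase_function A n T10 \<omega> T h \<mu> c \<phi> \<longleftrightarrow> phase_function A \<omega> c \<phi> \<and>
     (\<exists>a as K I. classical_symbol c (real n) a as \<and> (\<forall>x\<in>cdom c. as 0 x x \<noteq> 0) \<and>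
        szego_kernel A T10 T h \<mu> c K \<and> osc_integral c \<mu> \<phi> a I \<and> equiv_mod_smooth c \<mu> K I)"

definition ms_equivalent ::
  "('x, 'm::finite) chart \<Rightarrow> ('x \<Rightarrow> 'x \<Rightarrow> complex) \<Rightarrow> ('x \<Rightarrow> 'x \<Rightarrow> complex) \<Rightarrow> bool" where
  "ms_equivalent c \<psi>1 \<psi>2 \<longleftrightarrow> (\<exists>f. smooth2 c f \<and>
     (\<forall>vs. set vs \<subseteq> Basis \<longrightarrow> (\<forall>z\<in>cimg c.
        iter_deriv vs (rep2 c (\<lambda>x y. \<psi>2 x y - f x y * \<psi>1 x y)) (z, z) = 0)))"

text \<open>A vector field acting on the first variable of a function of two variables.\<close>

definition act1 :: "'x vfield \<Rightarrow> ('x \<Rightarrow> 'x \<Rightarrow> complex) \<Rightarrow> 'x \<Rightarrow> 'x \<Rightarrow> complex" where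
  "act1 V \<psi> = (\<lambda>x y. V x (\<lambda>x'. \<psi> x' y))"

end

theory Submission
  imports Defs
begin

text \<open>
  Away from the diagonal an oscillatory integral with phase \<open>\<psi>\<close> and symbol
  \<open>b \<sim> b\<^sub>0 t\<^sup>n + b\<^sub>1 t\<^sup>n\<^sup>-\<^sup>1 + \<dots>\<close> is a continuous function, because \<open>\<psi>\<close> does not vanish there.
  Integrating by parts \<open>n\<close> times in the frequency \<open>t\<close> identifies it as
  \<open>(\<i>/\<psi>)\<^sup>n\<^sup>+\<^sup>1 n! b\<^sub>0 + (\<i>/\<psi>)\<^sup>n G\<close>, where \<open>G\<close> is the integral of \<open>exp (\<i> t \<psi>) g\<close> over \<open>t > 0\<close> and
  \<open>g = \<partial>\<^sub>t\<^sup>n (\<tau> b) - n! b\<^sub>0\<close> (with the cutoff \<open>\<tau>\<close>) decays like \<open>t\<^sup>-\<^sup>2\<close>. The function \<open>G\<close> is continuous up to the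
  diagonal, where \<open>\<psi> = 0\<close> and the fundamental theorem of calculus gives \<open>G(x,x) = (n-1)! b\<^sub>1(x,x)\<close>.
  The lemmas that carry this part are \<open>half_line_expansion\<close>, \<open>classical_symbol_expansion\<close> and
  \<open>osc_integral_off_diagonal\<close>.

  If two such distributions differ by a smooth function \<open>F\<close>, their kernels differ by \<open>F\<close> at every
  point off the diagonal, because the volume is finite and charges open sets
  (\<open>pairing_eq_0_imp\<close>). Evaluate this identity at \<open>(x\<^sub>t, x)\<close>, where \<open>x\<^sub>t\<close> has the coordinates of \<open>x\<close>
  shifted by \<open>t T(x)\<close>, multiply by \<open>t\<^sup>n\<close>, and let \<open>t\<close> tend to \<open>0\<close> from the right. By
  \<open>T\<phi>\<^sub>k = -\<omega>\<^sub>0(T) = 1\<close> on the diagonal, both phases are \<open>t + o(t)\<close>. Their first derivatives agree on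
  the diagonal, so the conditions on \<open>T\<^sup>2\<phi>\<^sub>k\<close> give \<open>\<phi>\<^sub>2 - \<phi>\<^sub>1 = o(t\<^sup>2)\<close>; the conditions on the leading coefficients give
  \<open>\<alpha>\<^sub>0 - \<beta>\<^sub>0 = o(t)\<close>. Hence the leading terms, each of size \<open>t\<^sup>-\<^sup>n\<^sup>-\<^sup>1\<close>, cancel up to \<open>o(t\<^sup>-\<^sup>n)\<close>, the
  smooth function \<open>F\<close> disappears because \<open>n \<ge> 1\<close>, and \<open>\<alpha>\<^sub>1(x,x) = \<beta>\<^sub>1(x,x)\<close> is what remains
  (\<open>second_order_line_quotient\<close>, \<open>subleading_coefficients_agree\<close>).

  The geometry enters through the vector field \<open>T\<close> and through the volume, whose density in a
  chart is the square root of the Gram determinant of the coordinate fields. It has to be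
  positive and continuous (\<open>gram_det_pos\<close>, \<open>continuous_gram_det\<close>), and continuity rests on the
  coordinate formula for the exterior derivative, \<open>ext_deriv_coord\<close>, since the metric is given by
  the Levi form.
\<close>


section \<open>Calculus of smooth functions\<close>

abbreviation fd :: "('a::real_normed_vector \<Rightarrow> 'b::real_normed_vector) \<Rightarrow> 'a \<Rightarrow> 'a \<Rightarrow> 'b" where
  "fd f x \<equiv> frechet_derivative f (at x)"

text \<open>Congruence of \<open>Ck_on k\<close> on an open set is a hypothesis here because this
  rule is the step of the induction that proves that congruence; \<open>Ck_on_derivI\<close> is the
  rule for later use.\<close>

lemma Ck_on_SucI:
  assumes "open S" "\<And>x. x \<in> S \<Longrightarrow> (f has_derivative f' x) (at x)"
    and "\<And>v. Ck_on k S (\<lambda>x. f' x v)"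
    and cong: "\<And>g h :: 'a::euclidean_space \<Rightarrow> 'b::real_normed_vector. (\<And>x. x \<in> S \<Longrightarrow> g x = h x) \<Longrightarrow> Ck_on k S g \<Longrightarrow> Ck_on k S h"
  shows "Ck_on (Suc k) S (f :: 'a \<Rightarrow> 'b)"
proof -
  have "fd f x = f' x" if "x \<in> S" for x
    using frechet_derivative_at[OF assms(2)[OF that]] by simp
  then have "Ck_on k S (\<lambda>x. fd f x v)" for v
    by (intro cong[OF _ assms(3)[of v]]) auto
  moreover have "\<forall>x\<in>S. f differentiable (at x)"
    using assms(2) by (auto simp: differentiable_def)
  ultimately show ?thesis by simp
qed

lemma Ck_on_cong:
  fixes f g :: "'a::euclidean_space \<Rightarrow> 'b::real_normed_vector"
  assumes "open S" "\<And>x. x \<in> S \<Longrightarrow> f x = g x" "Ck_on k S f"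
  shows "Ck_on k S g"
  using assms(2,3)
proof (induction k arbitrary: f g)
  case 0
  then show ?case using continuous_on_cong[of S S f g] by auto
next
  case (Suc k)
  show ?case
  proof (rule Ck_on_SucI[OF assms(1)])
    fix x assume x: "x \<in> S"
    have "(f has_derivative fd f x) (at x)"
      using Suc.prems(2) x by (simp add: frechet_derivative_works)
    then show "(g has_derivative fd f x) (at x)"
      using has_derivative_transform_within_open[OF _ assms(1) x] Suc.prems(1) by blast
  next
    fix v show "Ck_on k S (\<lambda>x. fd f x v)" using Suc.prems by simp
  next
    fix g h :: "'a \<Rightarrow> 'b" assume "\<And>x. x \<in> S \<Longrightarrow> g x = h x" "Ck_on k S g"
    then show "Ck_on k S h" by (rule Suc.IH)
  qed
qed

lemma Ck_on_derivI:
  assumes "open S" "\<And>x. x \<in> S \<Longrightarrow> (f has_derivative f' x) (at x)"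
    and "\<And>v. Ck_on k S (\<lambda>x. f' x v)"
  shows "Ck_on (Suc k) S f"
  by (rule Ck_on_SucI[OF assms]) (auto intro: Ck_on_cong[OF assms(1)])

lemma Ck_on_has_derivative:
  assumes "Ck_on (Suc k) S f" "x \<in> S"
  shows "(f has_derivative fd f x) (at x)"
  using assms by (simp add: frechet_derivative_works)

lemma Ck_on_imp_continuous: "Ck_on k S f \<Longrightarrow> continuous_on S f"
  by (cases k) (auto intro!: continuous_at_imp_continuous_on differentiable_imp_continuous_within)

lemma Ck_on_Suc_imp: "Ck_on (Suc k) S f \<Longrightarrow> Ck_on k S f"
proof (induction k arbitrary: f)
  case 0
  then show ?case using Ck_on_imp_continuous by fastforce
next
  case (Suc k)
  then have "\<forall>v. Ck_on (Suc k) S (\<lambda>x. fd f x v)" by simp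
  then show ?case using Suc by simp
qed

lemma Ck_on_subset: "Ck_on k S f \<Longrightarrow> S' \<subseteq> S \<Longrightarrow> Ck_on k S' f"
  by (induction k arbitrary: f) (auto intro: continuous_on_subset)

lemma Ck_on_local:
  assumes "\<And>x. x \<in> S \<Longrightarrow> \<exists>N. open N \<and> x \<in> N \<and> Ck_on k N f"
  shows "Ck_on k S f"
  using assms
proof (induction k arbitrary: f)
  case 0
  have "isCont f x" if "x \<in> S" for x
    using 0[OF that] by (auto simp: continuous_on_eq_continuous_at)
  then show ?case by (simp add: continuous_at_imp_continuous_on)
next
  case (Suc k)
  have "f differentiable (at x)" if "x \<in> S" for x using Suc.prems[OF that] by auto
  moreover have "Ck_on k S (\<lambda>x. fd f x v)" for v
    using Suc.prems by (intro Suc.IH) fastforce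
  ultimately show ?case by simp
qed

lemma Ck_on_const: "open S \<Longrightarrow> Ck_on k S (\<lambda>x. c)"
  by (induction k arbitrary: c) auto

lemma Ck_on_bounded_linear:
  assumes "open S" "bounded_linear L" "Ck_on k S f"
  shows "Ck_on k S (\<lambda>x. L (f x))"
  using assms(3)
proof (induction k arbitrary: f)
  case 0
  then show ?case using bounded_linear.continuous_on[OF assms(2)] by auto
next
  case (Suc k)
  show ?case
    by (rule Ck_on_derivI[OF assms(1) bounded_linear.has_derivative[OF assms(2) Ck_on_has_derivative[OF Suc.prems]]])
      (use Suc in auto)
qed

lemma Ck_on_add:
  assumes "open S" "Ck_on k S f" "Ck_on k S g"
  shows "Ck_on k S (\<lambda>x. f x + g x)"
  using assms(2,3)
proof (induction k arbitrary: f g)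
  case 0
  then show ?case by (auto intro: continuous_intros)
next
  case (Suc k)
  show ?case
    by (rule Ck_on_derivI[OF assms(1) has_derivative_add[OF Ck_on_has_derivative[OF Suc.prems(1)] Ck_on_has_derivative[OF Suc.prems(2)]]])
      (use Suc in auto)
qed

lemma Ck_on_bilinear:
  assumes "open S" "bounded_bilinear B" "Ck_on k S f" "Ck_on k S g"
  shows "Ck_on k S (\<lambda>x. B (f x) (g x))"
  using assms(3,4)
proof (induction k arbitrary: f g)
  case 0
  then show ?case using bounded_bilinear.continuous_on[OF assms(2)] by auto
next
  case (Suc k)
  show ?case
  proof (rule Ck_on_derivI[OF assms(1) bounded_bilinear.FDERIV[OF assms(2) Ck_on_has_derivative[OF Suc.prems(1)] Ck_on_has_derivative[OF Suc.prems(2)]]])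
    fix v
    have "Ck_on k S f" "Ck_on k S g" using Suc.prems Ck_on_Suc_imp by auto
    then show "Ck_on k S (\<lambda>x. B (f x) (fd g x v) + B (fd f x v) (g x))"
      using Suc by (intro Ck_on_add[OF assms(1)] Suc.IH) auto
  qed
qed

lemma Ck_on_sum:
  assumes "open S" "\<And>i. i \<in> I \<Longrightarrow> Ck_on k S (f i)"
  shows "Ck_on k S (\<lambda>x. \<Sum>i\<in>I. f i x)"
  using assms(2) by (induction I rule: infinite_finite_induct) (auto intro: Ck_on_const Ck_on_add assms(1))

text \<open>Reduces an arbitrary direction to the basis directions, which is what makes the chain
  rule an identity between sums of products.\<close>

lemma frechet_linear_sum:
  assumes "f differentiable (at x)"
  shows "fd f x v = (\<Sum>b\<in>Basis. (v \<bullet> b) *\<^sub>R fd f x b)"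
proof -
  interpret linear "fd f x" using linear_frechet_derivative[OF assms] .
  have "fd f x v = fd f x (\<Sum>b\<in>Basis. (v \<bullet> b) *\<^sub>R b)"
    by (simp add: euclidean_representation)
  then show ?thesis by (simp add: sum scale)
qed

lemma Ck_on_compose:
  fixes g :: "'a::euclidean_space \<Rightarrow> 'b::euclidean_space"
  assumes "open S" "open U" "g ` S \<subseteq> U" "Ck_on k S g" "Ck_on k U f"
  shows "Ck_on k S (\<lambda>x. f (g x))"
  using assms(4,5)
proof (induction k arbitrary: f)
  case 0
  then show ?case using continuous_on_compose2[OF _ _ assms(3)] by auto
next
  case (Suc k)
  have g: "Ck_on k S g" using Suc.prems Ck_on_Suc_imp by auto
  show ?case
  proof (rule Ck_on_derivI[OF assms(1)])
    fix x assume x: "x \<in> S"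
    then have gx: "g x \<in> U" using assms(3) by auto
    have "(f \<circ> g has_derivative fd f (g x) \<circ> fd g x) (at x)"
      by (rule diff_chain_at[OF Ck_on_has_derivative[OF Suc.prems(1) x] Ck_on_has_derivative[OF Suc.prems(2) gx]])
    then show "((\<lambda>x. f (g x)) has_derivative (\<lambda>v. \<Sum>b\<in>Basis. (fd g x v \<bullet> b) *\<^sub>R fd f (g x) b)) (at x)"
      unfolding o_def
      by (rule has_derivative_eq_rhs) (rule ext, rule frechet_linear_sum, use Suc.prems(2) gx in simp)
  next
    fix v
    have "Ck_on k S (\<lambda>x. fd g x v \<bullet> b)" for b
      by (rule Ck_on_bounded_linear[OF assms(1) bounded_linear_inner_left]) (use Suc in auto)
    moreover have "Ck_on k S (\<lambda>x. fd f (g x) b)" for b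
      by (rule Suc.IH[OF g]) (use Suc.prems in auto)
    ultimately show "Ck_on k S (\<lambda>x. \<Sum>b\<in>Basis. (fd g x v \<bullet> b) *\<^sub>R fd f (g x) b)"
      by (intro Ck_on_sum Ck_on_bilinear[OF _ bounded_bilinear_scaleR] assms(1))
  qed
qed

lemma smooth_on_open: "smooth_on S f \<Longrightarrow> open S" by (simp add: smooth_on_def)
lemma smooth_on_Ck: "smooth_on S f \<Longrightarrow> Ck_on k S f" by (simp add: smooth_on_def)

lemma smooth_on_cong: "smooth_on S f \<Longrightarrow> (\<And>x. x \<in> S \<Longrightarrow> f x = g x) \<Longrightarrow> smooth_on S g"
  unfolding smooth_on_def using Ck_on_cong by blast

lemma smooth_on_subset: "smooth_on S f \<Longrightarrow> open S' \<Longrightarrow> S' \<subseteq> S \<Longrightarrow> smooth_on S' f"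
  unfolding smooth_on_def using Ck_on_subset by blast

lemma smooth_on_local:
  assumes "\<And>x. x \<in> S \<Longrightarrow> \<exists>N. x \<in> N \<and> smooth_on N f" "open S"
  shows "smooth_on S f"
  unfolding smooth_on_def using assms by (auto intro!: Ck_on_local simp: smooth_on_def) 

lemma smooth_on_continuous: "smooth_on S f \<Longrightarrow> continuous_on S f"
  using Ck_on_imp_continuous smooth_on_Ck by blast

lemma smooth_on_has_derivative:
  "smooth_on S f \<Longrightarrow> x \<in> S \<Longrightarrow> (f has_derivative fd f x) (at x)"
  using Ck_on_has_derivative smooth_on_Ck by blast

lemma smooth_on_differentiable: "smooth_on S f \<Longrightarrow> x \<in> S \<Longrightarrow> f differentiable (at x)"
  using smooth_on_has_derivative differentiable_def by blast

lemma smooth_on_deriv: "smooth_on S f \<Longrightarrow> smooth_on S (\<lambda>x. fd f x v)"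
  unfolding smooth_on_def using Ck_on.simps(2) by blast

lemma smooth_on_iter_deriv: "smooth_on S f \<Longrightarrow> smooth_on S (iter_deriv vs f)"
  by (induction vs) (auto intro: smooth_on_deriv)

lemma smooth_on_const: "open S \<Longrightarrow> smooth_on S (\<lambda>x. c)"
  by (simp add: smooth_on_def Ck_on_const)

lemma smooth_on_bounded_linear: "bounded_linear L \<Longrightarrow> smooth_on S f \<Longrightarrow> smooth_on S (\<lambda>x. L (f x))"
  by (simp add: smooth_on_def Ck_on_bounded_linear)

lemma smooth_on_add: "smooth_on S f \<Longrightarrow> smooth_on S g \<Longrightarrow> smooth_on S (\<lambda>x. f x + g x)"
  by (simp add: smooth_on_def Ck_on_add)

lemma smooth_on_minus: "smooth_on S f \<Longrightarrow> smooth_on S (\<lambda>x. - f x)"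
  by (rule smooth_on_bounded_linear[OF bounded_linear_minus[OF bounded_linear_ident]])

lemma smooth_on_diff: "smooth_on S f \<Longrightarrow> smooth_on S g \<Longrightarrow> smooth_on S (\<lambda>x. f x - g x)"
  using smooth_on_add[OF _ smooth_on_minus, of S f g] by simp

lemma smooth_on_mult:
  fixes f g :: "'a::euclidean_space \<Rightarrow> 'b::real_normed_algebra"
  shows "smooth_on S f \<Longrightarrow> smooth_on S g \<Longrightarrow> smooth_on S (\<lambda>x. f x * g x)"
  by (simp add: smooth_on_def Ck_on_bilinear[OF _ bounded_bilinear_mult])

lemma smooth_on_sum: "open S \<Longrightarrow> (\<And>i. i \<in> I \<Longrightarrow> smooth_on S (f i)) \<Longrightarrow> smooth_on S (\<lambda>x. \<Sum>i\<in>I. f i x)"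
  by (simp add: smooth_on_def Ck_on_sum)

lemma smooth_on_compose:
  fixes g :: "'a::euclidean_space \<Rightarrow> 'b::euclidean_space"
  shows "smooth_on S g \<Longrightarrow> smooth_on U f \<Longrightarrow> g ` S \<subseteq> U \<Longrightarrow> smooth_on S (\<lambda>x. f (g x))"
  unfolding smooth_on_def using Ck_on_compose by blast

lemma smooth_on_id: "open S \<Longrightarrow> smooth_on S (\<lambda>x. x)"
proof -
  assume S: "open S"
  have "Ck_on k S (\<lambda>x. x)" for k
  proof (cases k)
    case (Suc j)
    then show ?thesis using S by (auto intro!: Ck_on_const)
  qed auto
  then show ?thesis using S by (simp add: smooth_on_def)
qed

lemma smooth_on_linear: "bounded_linear L \<Longrightarrow> open S \<Longrightarrow> smooth_on S L"
  using smooth_on_bounded_linear[OF _ smooth_on_id] by blast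

lemma smooth_on_of_real:
  "smooth_on S f \<Longrightarrow> smooth_on S (\<lambda>x. of_real (f x) :: 'b::real_normed_algebra_1)"
  by (rule smooth_on_bounded_linear[OF bounded_linear_of_real])

lemma frechet_derivative_cong_open:
  assumes "open S" "x \<in> S" "\<And>y. y \<in> S \<Longrightarrow> f y = g y" "f differentiable (at x)"
  shows "fd f x = fd g x"
  using frechet_derivative_transform_within_open[OF assms(4,1,2)] assms(3) by blast

lemma iter_deriv_cong_open:
  assumes "smooth_on S f" "x \<in> S" "\<And>y. y \<in> S \<Longrightarrow> f y = g y"
  shows "iter_deriv vs f x = iter_deriv vs g x"
  using assms(2)
proof (induction vs arbitrary: x)
  case Nil
  then show ?case using assms by simp
next
  case (Cons v vs)
  have "fd (iter_deriv vs f) x = fd (iter_deriv vs g) x"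
    by (rule frechet_derivative_cong_open[OF smooth_on_open[OF assms(1)] Cons.prems Cons.IH])
     (use smooth_on_differentiable[OF smooth_on_iter_deriv[OF assms(1)]] Cons.prems in auto)
  then show ?case by simp
qed

lemma frechet_derivative_line:
  assumes "f differentiable (at (x + t *\<^sub>R v))"
  shows "((\<lambda>t. f (x + t *\<^sub>R v)) has_vector_derivative fd f (x + t *\<^sub>R v) v) (at t)"
proof -
  have "((\<lambda>t. x + t *\<^sub>R v) has_vector_derivative v) (at t)"
    by (auto intro!: derivative_eq_intros simp: has_vector_derivative_def)
  then have "((\<lambda>t. x + t *\<^sub>R v) has_derivative (\<lambda>h. h *\<^sub>R v)) (at t)"
    by (simp add: has_vector_derivative_def)
  from has_derivative_compose[OF this] assms
  have "((\<lambda>t. f (x + t *\<^sub>R v)) has_derivative (\<lambda>h. fd f (x + t *\<^sub>R v) (h *\<^sub>R v))) (at t)"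
    by (auto simp: frechet_derivative_works)
  then show ?thesis
    using linear_frechet_derivative[OF assms] by (simp add: has_vector_derivative_def linear_scale)
qed


lemma frechet_derivative_eqI:
  "(f has_derivative f') (at x) \<Longrightarrow> fd f x v = f' v"
  using frechet_derivative_at by metis

lemma frechet_derivative_plus:
  assumes "f differentiable (at x)" "g differentiable (at x)"
  shows "fd (\<lambda>x. f x + g x) x v = fd f x v + fd g x v"
  by (rule frechet_derivative_eqI[OF has_derivative_add]) (use assms in \<open>simp_all add: frechet_derivative_works\<close>)

lemma frechet_derivative_minus:
  assumes "f differentiable (at x)" "g differentiable (at x)"
  shows "fd (\<lambda>x. f x - g x) x v = fd f x v - fd g x v"
  by (rule frechet_derivative_eqI[OF has_derivative_diff]) (use assms in \<open>simp_all add: frechet_derivative_works\<close>)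

lemma frechet_derivative_bounded_linear:
  assumes "bounded_linear L" "f differentiable (at x)"
  shows "fd (\<lambda>y. L (f y)) x v = L (fd f x v)"
  using frechet_derivative_at[OF bounded_linear.has_derivative[OF assms(1)], of f "fd f x" x] assms(2)
  by (metis frechet_derivative_works)

subsection \<open>Symmetry of second derivatives\<close>

text \<open>The mean value theorem applied first in the direction \<open>u\<close>, then in the
  direction \<open>v\<close>. The second difference is symmetric in \<open>u\<close> and
  \<open>v\<close>; comparing the two orders gives the symmetry of second derivatives.\<close>

lemma second_difference_mvt:
  fixes f :: "'a::euclidean_space \<Rightarrow> real"
  assumes f: "smooth_on S f" and h: "0 < h"
    and S: "\<And>s t. 0 \<le> s \<Longrightarrow> s \<le> h \<Longrightarrow> 0 \<le> t \<Longrightarrow> t \<le> h \<Longrightarrow> x + s *\<^sub>R u + t *\<^sub>R v \<in> S"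
  obtains s t where "0 < s" "s < h" "0 < t" "t < h"
    and "f (x + h *\<^sub>R u + h *\<^sub>R v) - f (x + h *\<^sub>R u) - f (x + h *\<^sub>R v) + f x
       = h * h * fd (\<lambda>y. fd f y u) (x + s *\<^sub>R u + t *\<^sub>R v) v"
proof -
  define Du where "Du y = fd f y u" for y
  have Du: "smooth_on S Du" unfolding Du_def by (rule smooth_on_deriv[OF f])
  have d1: "((\<lambda>s. f (y + s *\<^sub>R u)) has_real_derivative Du (y + s *\<^sub>R u)) (at s)" if "y + s *\<^sub>R u \<in> S" for y s
    using frechet_derivative_line[OF smooth_on_differentiable[OF f that]]
    by (simp add: Du_def has_real_derivative_iff_has_vector_derivative)
  have d2: "((\<lambda>s. Du (y + s *\<^sub>R v)) has_real_derivative fd Du (y + s *\<^sub>R v) v) (at s)" if "y + s *\<^sub>R v \<in> S" for y s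
    using frechet_derivative_line[OF smooth_on_differentiable[OF Du that]]
    by (simp add: has_real_derivative_iff_has_vector_derivative)
  define p where "p s = f (x + h *\<^sub>R v + s *\<^sub>R u) - f (x + s *\<^sub>R u)" for s
  have "\<exists>s>0. s < h \<and> p h - p 0 = (h - 0) * (Du (x + h *\<^sub>R v + s *\<^sub>R u) - Du (x + s *\<^sub>R u))"
    using h S[of _ h] S[of _ 0] unfolding p_def
    by (intro MVT2 DERIV_diff d1) (auto simp: add_ac)
  then obtain s where s: "0 < s" "s < h" "p h - p 0 = h * (Du (x + h *\<^sub>R v + s *\<^sub>R u) - Du (x + s *\<^sub>R u))" by auto
  define q where "q t = Du (x + s *\<^sub>R u + t *\<^sub>R v)" for t
  have "\<exists>t>0. t < h \<and> q h - q 0 = (h - 0) * fd Du (x + s *\<^sub>R u + t *\<^sub>R v) v"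
    using h S[of s] s unfolding q_def by (intro MVT2 d2) auto
  then obtain t where t: "0 < t" "t < h" "q h - q 0 = h * fd Du (x + s *\<^sub>R u + t *\<^sub>R v) v" by auto
  have "p h - p 0 = h * (q h - q 0)" using s by (simp add: q_def add_ac)
  then have "p h - p 0 = h * h * fd Du (x + s *\<^sub>R u + t *\<^sub>R v) v" using t by simp
  moreover have "f (x + h *\<^sub>R u + h *\<^sub>R v) - f (x + h *\<^sub>R u) - f (x + h *\<^sub>R v) + f x = p h - p 0"
    by (simp add: p_def add_ac)
  ultimately show ?thesis using that[OF s(1,2) t(1,2)] by (simp add: Du_def[abs_def])
qed

lemma second_derivative_symmetric_real:
  fixes f :: "'a::euclidean_space \<Rightarrow> real"
  assumes f: "smooth_on S f" and x: "x \<in> S"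
  shows "fd (\<lambda>y. fd f y u) x v
       = fd (\<lambda>y. fd f y v) x u"
    (is "?A x = ?B x")
proof (rule ccontr)
  assume "?A x \<noteq> ?B x"
  define e where "e = dist (?A x) (?B x) / 2"
  have e: "e > 0" using \<open>?A x \<noteq> ?B x\<close> by (simp add: e_def)
  have cont: "isCont ?A x" "isCont ?B x"
    using smooth_on_continuous[OF smooth_on_deriv[OF smooth_on_deriv[OF f]]] x smooth_on_open[OF f]
    by (simp_all add: continuous_on_eq_continuous_at)
  obtain d1 where d1: "d1 > 0" "\<And>y. dist y x < d1 \<Longrightarrow> dist (?A y) (?A x) < e"
    using cont(1) e unfolding continuous_at_eps_delta by blast
  obtain d2 where d2: "d2 > 0" "\<And>y. dist y x < d2 \<Longrightarrow> dist (?B y) (?B x) < e"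
    using cont(2) e unfolding continuous_at_eps_delta by blast
  obtain d3 where d3: "d3 > 0" "ball x d3 \<subseteq> S" using smooth_on_open[OF f] x open_contains_ball by blast
  define d where "d = min d1 (min d2 d3)"
  define h where "h = d / (2 * (norm u + norm v + 1))"
  have d: "d > 0" using d1 d2 d3 by (simp add: d_def)
  have pos: "norm u + norm v + 1 > 0" by (simp add: add_nonneg_pos)
  then have h: "h > 0" using d by (simp add: h_def)
  have hN: "h * (norm u + norm v + 1) = d / 2"
  proof -
    have "d / (2 * N) * N = d / 2" if "N > 0" for N :: real using that by simp
    from this[OF pos] show ?thesis by (simp only: h_def)
  qed
  have near: "dist (x + s *\<^sub>R u + t *\<^sub>R v) x < d" if "0 \<le> s" "s \<le> h" "0 \<le> t" "t \<le> h" for s t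
  proof -
    have "norm (s *\<^sub>R u + t *\<^sub>R v) \<le> norm (s *\<^sub>R u) + norm (t *\<^sub>R v)" by (rule norm_triangle_ineq)
    also have "\<dots> \<le> h * norm u + h * norm v" using that by (intro add_mono) (auto intro: mult_right_mono)
    also have "\<dots> \<le> h * (norm u + norm v + 1)" using h by (simp add: algebra_simps)
    also have "\<dots> = d / 2" by (rule hN)
    also have "\<dots> < d" using d by simp
    finally show ?thesis by (simp add: dist_norm add.assoc)
  qed
  have S: "x + s *\<^sub>R u + t *\<^sub>R v \<in> S" if "0 \<le> s" "s \<le> h" "0 \<le> t" "t \<le> h" for s t
    using near[OF that] d3(2) by (auto simp: d_def dist_commute)
  have S': "x + s *\<^sub>R v + t *\<^sub>R u \<in> S" if "0 \<le> s" "s \<le> h" "0 \<le> t" "t \<le> h" for s t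
    using S[of t s] that by (simp add: add_ac)
  obtain s t where 1: "0 < s" "s < h" "0 < t" "t < h" 
    and 2: "f (x + h *\<^sub>R u + h *\<^sub>R v) - f (x + h *\<^sub>R u) - f (x + h *\<^sub>R v) + f x = h * h * ?A (x + s *\<^sub>R u + t *\<^sub>R v)"
    by (rule second_difference_mvt[OF f h, of x u v, OF S])
  obtain s' t' where 3: "0 < s'" "s' < h" "0 < t'" "t' < h"
    and 4: "f (x + h *\<^sub>R v + h *\<^sub>R u) - f (x + h *\<^sub>R v) - f (x + h *\<^sub>R u) + f x = h * h * ?B (x + s' *\<^sub>R v + t' *\<^sub>R u)"
    by (rule second_difference_mvt[OF f h, of x v u, OF S'])
  have "h * h * ?A (x + s *\<^sub>R u + t *\<^sub>R v) = h * h * ?B (x + s' *\<^sub>R v + t' *\<^sub>R u)"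
    using 2 4 by (simp add: algebra_simps)
  then have eq: "?A (x + s *\<^sub>R u + t *\<^sub>R v) = ?B (x + s' *\<^sub>R v + t' *\<^sub>R u)" using h by simp
  have "dist (?A (x + s *\<^sub>R u + t *\<^sub>R v)) (?A x) < e"
    by (rule d1(2)) (use near[of s t] 1 in \<open>auto simp: d_def\<close>)
  moreover have "dist (?B (x + s' *\<^sub>R v + t' *\<^sub>R u)) (?B x) < e"
    by (rule d2(2)) (use near[of t' s'] 3 in \<open>auto simp: d_def add_ac\<close>)
  ultimately have "dist (?A x) (?B x) < e + e"
    using dist_triangle3[of "?A x" "?B x" "?A (x + s *\<^sub>R u + t *\<^sub>R v)"] unfolding eq by linarith
  then show False by (simp add: e_def)
qed

lemma second_derivative_symmetric:
  fixes f :: "'a::euclidean_space \<Rightarrow> complex"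
  assumes f: "smooth_on S f" and x: "x \<in> S"
  shows "fd (\<lambda>y. fd f y u) x v
       = fd (\<lambda>y. fd f y v) x u"
proof -
  have L: "L (fd (\<lambda>y. fd f y u) x v)
      = fd (\<lambda>y. fd (\<lambda>z. L (f z)) y u) x v"
    if "bounded_linear L" for L :: "complex \<Rightarrow> real" and u v
  proof -
    have "L (fd (\<lambda>y. fd f y u) x v)
      = fd (\<lambda>y. L (fd f y u)) x v"
      using frechet_derivative_bounded_linear[OF that] smooth_on_differentiable[OF smooth_on_deriv[OF f] x] by metis
    also have "fd (\<lambda>y. L (fd f y u)) x
       = fd (\<lambda>y. fd (\<lambda>z. L (f z)) y u) x"
      by (rule frechet_derivative_cong_open[OF smooth_on_open[OF f] x])
        (auto simp: frechet_derivative_bounded_linear[OF that] smooth_on_differentiable[OF f] x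
          intro!: smooth_on_differentiable[OF smooth_on_bounded_linear[OF that smooth_on_deriv[OF f]]])
    finally show ?thesis .
  qed
  show ?thesis
    by (rule complex_eqI)
      (simp_all add: L bounded_linear_Re bounded_linear_Im
        second_derivative_symmetric_real[OF smooth_on_bounded_linear[OF bounded_linear_Re f] x, of u v]
        second_derivative_symmetric_real[OF smooth_on_bounded_linear[OF bounded_linear_Im f] x, of u v])
qed

subsection \<open>Bump functions\<close>

text \<open>The functions \<open>x\<^sup>-\<^sup>m exp (-1/x)\<close> for \<open>x > 0\<close>. The
  family is closed under differentiation up to linear combinations, so that smoothness of all of
  them follows by one induction.\<close>

definition flat_exp :: "nat \<Rightarrow> real \<Rightarrow> real" where
  "flat_exp m x = (if x > 0 then exp (- 1 / x) / x ^ m else 0)"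

lemma flat_exp_tendsto_0: "(flat_exp m \<longlongrightarrow> 0) (at 0)"
proof -
  have r: "((\<lambda>x::real. exp (- 1 / x) / x ^ m) \<longlongrightarrow> 0) (at_right 0)"
  proof -
    have "((\<lambda>x::real. x ^ m / exp x) \<longlongrightarrow> 0) at_top" by (rule tendsto_power_div_exp_0)
    then have "((\<lambda>x::real. (inverse x) ^ m / exp (inverse x)) \<longlongrightarrow> 0) (at_right 0)"
      by (rule filterlim_compose[OF _ filterlim_inverse_at_top_right])
    then show ?thesis by (simp add: exp_minus field_simps)
  qed
  have "(flat_exp m \<longlongrightarrow> 0) (at_right 0)"
    by (rule Lim_transform_eventually[OF r]) (auto simp: flat_exp_def eventually_at_right_less eventually_at_filter)
  moreover have "(flat_exp m \<longlongrightarrow> 0) (at_left 0)"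
    by (rule tendsto_eventually) (auto simp: flat_exp_def eventually_at_filter)
  ultimately show ?thesis by (simp add: filterlim_split_at)
qed

lemma flat_exp_deriv:
  "(flat_exp m has_real_derivative flat_exp (m + 2) x - of_nat m * flat_exp (m + 1) x) (at x)"
proof -
  consider "x > 0" | "x < 0" | "x = 0" by linarith
  then show ?thesis
  proof cases
    case 1
    have "((\<lambda>x. exp (- 1 / x) * (1 / x) ^ m) has_real_derivative
        exp (- 1 / x) * (1 / x\<^sup>2) * (1 / x) ^ m + exp (- 1 / x) * (of_nat m * (1 / x) ^ (m - 1) * (- (1 / x\<^sup>2)))) (at x)"
      using 1 by (auto intro!: derivative_eq_intros simp: power2_eq_square)
    also have "exp (- 1 / x) * (1 / x\<^sup>2) * (1 / x) ^ m + exp (- 1 / x) * (of_nat m * (1 / x) ^ (m - 1) * (- (1 / x\<^sup>2)))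
        = flat_exp (m + 2) x - of_nat m * flat_exp (m + 1) x"
      using 1 by (cases m) (simp_all add: flat_exp_def power_divide power2_eq_square mult_ac)
    finally have "((\<lambda>x. exp (- 1 / x) / x ^ m) has_real_derivative flat_exp (m + 2) x - of_nat m * flat_exp (m + 1) x) (at x)"
      by (simp add: power_divide)
    then show ?thesis
      by (rule DERIV_cong_ev[THEN iffD1, rotated -1]) (use 1 in \<open>auto simp: flat_exp_def eventually_nhds intro!: exI[of _ "{0<..}"]\<close>)
  next
    case 2
    have "((\<lambda>x. 0) has_real_derivative 0) (at x)" by simp
    then have "(flat_exp m has_real_derivative 0) (at x)"
      by (rule DERIV_cong_ev[THEN iffD1, rotated -1]) (use 2 in \<open>auto simp: flat_exp_def eventually_nhds intro!: exI[of _ "{..<0}"]\<close>)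
    then show ?thesis using 2 by (simp add: flat_exp_def)
  next
    case 3
    have "(flat_exp (m + 1) \<longlongrightarrow> 0) (at 0)" by (rule flat_exp_tendsto_0)
    then have "((\<lambda>h. (flat_exp m h - flat_exp m 0) / h) \<longlongrightarrow> 0) (at 0)"
      by (rule Lim_transform_eventually) (auto simp: flat_exp_def eventually_at_filter field_simps)
    then show ?thesis using 3 by (simp add: has_field_derivative_iff flat_exp_def)
  qed
qed

lemma smooth_on_flat_exp: "smooth_on UNIV (flat_exp m)"
proof -
  have "Ck_on k UNIV (flat_exp m)" for k
  proof (induction k arbitrary: m)
    case 0
    have "isCont (flat_exp m) x" for x using DERIV_isCont[OF flat_exp_deriv] .
    then show ?case by (simp add: continuous_at_imp_continuous_on)
  next
    case (Suc k)
    show ?case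
    proof (rule Ck_on_derivI)
      fix x show "(flat_exp m has_derivative (\<lambda>v. (flat_exp (m + 2) x + (- of_nat m) * flat_exp (m + 1) x) * v)) (at x)"
        using flat_exp_deriv[of m x] by (simp add: has_field_derivative_def)
    next
      fix v show "Ck_on k UNIV (\<lambda>x. (flat_exp (m + 2) x + (- of_nat m) * flat_exp (m + 1) x) * v)"
        by (intro Ck_on_bilinear[OF _ bounded_bilinear_mult] Ck_on_add Ck_on_const Suc) auto
    qed auto
  qed
  then show ?thesis by (simp add: smooth_on_def)
qed

lemma bump_function_exists:
  fixes p :: "'a::euclidean_space"
  assumes "r > 0"
  obtains f :: "'a \<Rightarrow> real" where "smooth_on UNIV f" "\<And>x. 0 \<le> f x" "\<And>x. f x \<noteq> 0 \<longleftrightarrow> x \<in> ball p r"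
proof
  let ?f = "\<lambda>x. flat_exp 0 (r\<^sup>2 - (x - p) \<bullet> (x - p))"
  have "smooth_on UNIV (\<lambda>x. r\<^sup>2 - (x - p) \<bullet> (x - p))"
  proof -
    have "smooth_on UNIV (\<lambda>x. x - p)" by (intro smooth_on_diff smooth_on_id smooth_on_const) auto
    then have "smooth_on UNIV (\<lambda>x. (x - p) \<bullet> (x - p))"
      by (simp add: smooth_on_def Ck_on_bilinear[OF _ bounded_bilinear_inner])
    then show ?thesis by (intro smooth_on_diff smooth_on_const) auto
  qed
  from smooth_on_compose[OF this smooth_on_flat_exp[of 0]] show "smooth_on UNIV ?f" by simp
  show "0 \<le> ?f x" for x by (simp add: flat_exp_def)
  have "(x - p) \<bullet> (x - p) < r\<^sup>2 \<longleftrightarrow> dist p x < r" for x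
  proof -
    have "r\<^sup>2 \<le> (norm (x - p))\<^sup>2 \<longleftrightarrow> r \<le> norm (x - p)" using assms by (intro power_mono_iff) auto
    then show ?thesis
      by (simp add: power2_norm_eq_inner[symmetric] dist_norm norm_minus_commute[of p x] not_le[symmetric])
  qed
  then show "?f x \<noteq> 0 \<longleftrightarrow> x \<in> ball p r" for x by (simp add: flat_exp_def)
qed

section \<open>Oscillatory integrals over the half-line\<close>

abbreviation wave :: "complex \<Rightarrow> real \<Rightarrow> complex" where
  "wave \<zeta> t \<equiv> exp (\<i> * of_real t * \<zeta>)"

lemma set_integrable_inverse_square: "set_integrable lborel {0<..} (\<lambda>t::real. 1 / (1 + t)\<^sup>2)"
proof -
  have "set_integrable lborel (einterval 0 \<infinity>) (\<lambda>t::real. 1 / (1 + t)\<^sup>2)"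
  proof (rule interval_integral_FTC_nonneg(1)[where F = "\<lambda>t. - (1 / (1 + t))" and A = "-1" and B = 0])
    fix x :: real assume "0 < ereal x"
    then have x: "x > 0" by simp
    show "((\<lambda>t. - (1 / (1 + t))) has_real_derivative 1 / (1 + x)\<^sup>2) (at x)"
      using x by (auto intro!: derivative_eq_intros simp: power2_eq_square)
    show "isCont (\<lambda>t. 1 / (1 + t)\<^sup>2) x" using x by (intro continuous_intros) auto
  next
    have "((\<lambda>t::real. - (1 / (1 + t))) \<longlongrightarrow> - (1 / (1 + 0))) (at_right 0)" by (intro tendsto_intros) auto
    then show "(((\<lambda>t. - (1 / (1 + t))) \<circ> real_of_ereal) \<longlongrightarrow> - 1) (at_right 0)"
      by (simp add: ereal_tendsto_simps zero_ereal_def)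
    have "((\<lambda>t::real. - (1 / (1 + t))) \<longlongrightarrow> - 0) at_top"
      by (intro tendsto_minus tendsto_divide_0[OF tendsto_const] filterlim_at_top_imp_at_infinity filterlim_tendsto_add_at_top[OF tendsto_const] filterlim_ident)
    then show "(((\<lambda>t. - (1 / (1 + t))) \<circ> real_of_ereal) \<longlongrightarrow> 0) (at_left \<infinity>)"
      by (simp add: ereal_tendsto_simps)
  qed auto
  then show ?thesis by (simp add: zero_ereal_def)
qed

text \<open>The values at \<open>0\<close> and \<open>\<infinity>\<close> enter only as limits,
  since the functions below are controlled on the open half-line only.\<close>

lemma half_line_FTC:
  fixes f F :: "real \<Rightarrow> complex"
  assumes "\<And>t. t > 0 \<Longrightarrow> (F has_vector_derivative f t) (at t)" "continuous_on {0<..} f"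
    and "set_integrable lborel {0<..} f" "(F \<longlongrightarrow> a) (at_right 0)" "(F \<longlongrightarrow> b) at_top"
  shows "(LINT t:{0<..}|lborel. f t) = b - a"
proof -
  have "(LBINT t=0..\<infinity>. f t) = b - a"
  proof (rule interval_integral_FTC_integrable)
    show "isCont f t" if "0 < ereal t" for t
      using assms(2) that by (simp add: continuous_on_eq_continuous_at)
    show "((F \<circ> real_of_ereal) \<longlongrightarrow> a) (at_right 0)" using assms(4) by (simp add: ereal_tendsto_simps zero_ereal_def)
    show "((F \<circ> real_of_ereal) \<longlongrightarrow> b) (at_left \<infinity>)" using assms(5) by (simp add: ereal_tendsto_simps)
  qed (use assms in \<open>auto simp: zero_ereal_def\<close>)
  then show ?thesis by (simp add: interval_lebesgue_integral_def zero_ereal_def)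
qed

lemma power_times_exp_tendsto_0:
  fixes y :: real
  assumes "y > 0"
  shows "((\<lambda>t. (1 + t) ^ m * exp (- (t * y))) \<longlongrightarrow> 0) at_top"
proof -
  have 1: "((\<lambda>u::real. u ^ m / exp u) \<longlongrightarrow> 0) at_top" by (rule tendsto_power_div_exp_0)
  have "filterlim (\<lambda>t. y * (1 + t)) at_top at_top"
    using assms by (intro filterlim_tendsto_pos_mult_at_top[OF tendsto_const] filterlim_tendsto_add_at_top[OF tendsto_const] filterlim_ident) auto
  then have "((\<lambda>t. (y * (1 + t)) ^ m / exp (y * (1 + t))) \<longlongrightarrow> 0) at_top"
    by (rule filterlim_compose[OF 1])
  then have "((\<lambda>t. (exp y / y ^ m) * ((y * (1 + t)) ^ m / exp (y * (1 + t)))) \<longlongrightarrow> (exp y / y ^ m) * 0) at_top"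
    by (intro tendsto_mult tendsto_const)
  moreover have "(exp y / y ^ m) * ((y * (1 + t)) ^ m / exp (y * (1 + t))) = (1 + t) ^ m * exp (- (t * y))" for t
  proof -
    have "exp (y * (1 + t)) = exp y * exp (t * y)" by (simp add: algebra_simps flip: exp_add)
    then show ?thesis using assms unfolding power_mult_distrib exp_minus by (simp add: divide_simps)
  qed
  ultimately show ?thesis by simp
qed

text \<open>Replaces exponential damping by the one integrable majorant used for all integrals over
  the half-line.\<close>

lemma power_times_exp_le_inverse_square:
  fixes y :: real
  assumes "y > 0"
  obtains C where "\<And>t. t > 0 \<Longrightarrow> (1 + t) ^ m * exp (- (t * y)) \<le> C * (1 / (1 + t)\<^sup>2)"
proof -
  let ?g = "\<lambda>t. (1 + t) ^ (m + 2) * exp (- (t * y))"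
  have "eventually (\<lambda>t. ?g t < 1) at_top"
    using power_times_exp_tendsto_0[OF assms] by (rule order_tendstoD) simp
  then obtain b where b: "\<And>t. t \<ge> b \<Longrightarrow> ?g t < 1"
    by (auto simp: eventually_at_top_linorder)
  have "compact (?g ` {0..b})" by (intro compact_continuous_image continuous_intros) auto
  then have "bdd_above (?g ` {0..b})" by (rule bounded_imp_bdd_above[OF compact_imp_bounded])
  then obtain B where B: "\<And>t. t \<in> {0..b} \<Longrightarrow> ?g t \<le> B" unfolding bdd_above_def by blast
  have "(1 + t) ^ m * exp (- (t * y)) \<le> max B 1 * (1 / (1 + t)\<^sup>2)" if "t > 0" for t
  proof -
    have "?g t \<le> max B 1" using b[of t] B[of t] that by (cases "t \<ge> b") auto
    then show ?thesis using that by (simp add: power_add divide_simps power2_eq_square mult_ac)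
  qed
  then show ?thesis by (rule that)
qed

lemma set_borel_measurable_half_line:
  fixes g :: "real \<Rightarrow> complex"
  shows "continuous_on {0<..} g \<Longrightarrow> set_borel_measurable lborel {0<..} g"
  unfolding set_borel_measurable_def by (simp add: borel_measurable_continuous_on_indicator)

lemma set_integrable_half_line_decay:
  fixes g :: "real \<Rightarrow> complex"
  assumes "continuous_on {0<..} g" "\<And>t. t > 0 \<Longrightarrow> norm (g t) \<le> C / (1 + t)\<^sup>2"
  shows "set_integrable lborel {0<..} g"
proof (rule set_integrable_bound)
  show "set_integrable lborel {0<..} (\<lambda>t. C * (1 / (1 + t)\<^sup>2))"
    by (intro set_integrable_mult_right set_integrable_inverse_square)
  show "AE t in lborel. t \<in> {0<..} \<longrightarrow> norm (g t) \<le> norm (C * (1 / (1 + t)\<^sup>2))"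
    using assms(2) by (intro AE_I2) (auto intro!: order_trans[OF assms(2)] divide_right_mono)
qed (rule set_borel_measurable_half_line[OF assms(1)])

lemma norm_half_line_integral_le:
  fixes g :: "real \<Rightarrow> complex"
  assumes "continuous_on {0<..} g" "\<And>t. t > 0 \<Longrightarrow> norm (g t) \<le> C / (1 + t)\<^sup>2"
  shows "norm (LINT t:{0<..}|lborel. g t) \<le> C * (LINT t:{0<..}|lborel. 1 / (1 + t)\<^sup>2)"
proof -
  have "norm (LINT t:{0<..}|lborel. g t) \<le> (LINT t:{0<..}|lborel. C * (1 / (1 + t)\<^sup>2))"
    unfolding set_lebesgue_integral_def
  proof (rule Bochner_Integration.integral_norm_bound_integral)
    show "integrable lborel (\<lambda>t. indicator {0<..} t *\<^sub>R g t)"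
      using set_integrable_half_line_decay[OF assms] by (simp add: set_integrable_def)
    show "integrable lborel (\<lambda>t. indicator {0<..} t *\<^sub>R (C * (1 / (1 + t)\<^sup>2)))"
      using set_integrable_mult_right[OF set_integrable_inverse_square, of C] by (simp add: set_integrable_def)
    show "norm (indicator {0<..} t *\<^sub>R g t) \<le> indicator {0<..} t *\<^sub>R (C * (1 / (1 + t)\<^sup>2))" for t
      using assms(2)[of t] by (auto simp: indicator_def)
  qed
  also have "\<dots> = C * (LINT t:{0<..}|lborel. 1 / (1 + t)\<^sup>2)" by (rule set_integral_mult_right)
  finally show ?thesis .
qed

lemma norm_exp_half_line:
  "norm (wave \<zeta> t) = exp (- (t * Im \<zeta>))"
  by simp

lemma set_integrable_exp_poly:
  fixes g :: "real \<Rightarrow> complex"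
  assumes "continuous_on {0<..} g" "\<And>t. t > 0 \<Longrightarrow> norm (g t) \<le> C * (1 + t) ^ m" "Im \<zeta> > 0"
  shows "set_integrable lborel {0<..} (\<lambda>t. wave \<zeta> t * g t)"
proof -
  obtain B where B: "\<And>t. t > 0 \<Longrightarrow> (1 + t) ^ m * exp (- (t * Im \<zeta>)) \<le> B * (1 / (1 + t)\<^sup>2)"
    using power_times_exp_le_inverse_square[OF assms(3)] by blast
  have C: "C \<ge> 0"
  proof -
    have "0 \<le> C * 2 ^ m" using order_trans[OF norm_ge_zero assms(2)[of 1]] by simp
    then show ?thesis using mult_neg_pos[of C "2 ^ m"] by (cases "C < 0") auto
  qed
  show ?thesis
  proof (rule set_integrable_half_line_decay[where C = "C * B"])
    show "continuous_on {0<..} (\<lambda>t. wave \<zeta> t * g t)"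
      by (intro continuous_intros assms(1))
    fix t :: real assume t: "t > 0"
    have "norm (wave \<zeta> t * g t) \<le> exp (- (t * Im \<zeta>)) * (C * (1 + t) ^ m)"
      unfolding norm_mult norm_exp_half_line by (intro mult_left_mono assms(2) t) auto
    also have "\<dots> = C * ((1 + t) ^ m * exp (- (t * Im \<zeta>)))" by simp
    also have "\<dots> \<le> C * (B * (1 / (1 + t)\<^sup>2))" by (intro mult_left_mono B t C)
    finally show "norm (wave \<zeta> t * g t) \<le> C * B / (1 + t)\<^sup>2" by simp
  qed
qed

lemma exp_half_line_deriv:
  "((\<lambda>t. wave \<zeta> t) has_vector_derivative (\<i> * \<zeta>) * wave \<zeta> t) (at t)"
proof -
  have "((\<lambda>z. exp (\<i> * z * \<zeta>)) has_field_derivative (\<i> * \<zeta>) * wave \<zeta> t) (at (of_real t))"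
    by (auto intro!: derivative_eq_intros)
  then show ?thesis by (rule has_vector_derivative_real_field)
qed

lemma solve_imaginary_factor:
  assumes "(\<i> * \<zeta>) * X = - Y" "\<zeta> \<noteq> 0" shows "X = (\<i> / \<zeta>) * Y"
proof -
  have "(\<i> / \<zeta>) * ((\<i> * \<zeta>) * X) = - X" using assms(2) by simp
  then show ?thesis using assms(1) by simp
qed

text \<open>The boundary term at \<open>0\<close> vanishes because \<open>h\<close> does near
  \<open>0\<close>, and the one at \<open>\<infinity>\<close> by the exponential damping \<open>Im
  \<zeta> > 0\<close>.\<close>

lemma half_line_ibp:
  fixes h h' :: "real \<Rightarrow> complex"
  assumes der: "\<And>t. t > 0 \<Longrightarrow> (h has_vector_derivative h' t) (at t)"
    and cont: "continuous_on {0<..} h'"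
    and t0: "t0 > 0" "\<And>t. 0 < t \<Longrightarrow> t < t0 \<Longrightarrow> h t = 0"
    and bd: "\<And>t. t > 0 \<Longrightarrow> norm (h t) \<le> C * (1 + t) ^ m" "\<And>t. t > 0 \<Longrightarrow> norm (h' t) \<le> C' * (1 + t) ^ m"
    and \<zeta>: "Im \<zeta> > 0"
  shows "(LINT t:{0<..}|lborel. wave \<zeta> t * h t) = (\<i> / \<zeta>) * (LINT t:{0<..}|lborel. wave \<zeta> t * h' t)"
proof -
  let ?e = "\<lambda>t. wave \<zeta> t"
  have hc: "continuous_on {0<..} h"
    using der by (intro continuous_at_imp_continuous_on) (auto intro: has_vector_derivative_continuous)
  have i1: "set_integrable lborel {0<..} (\<lambda>t. ?e t * h t)" by (rule set_integrable_exp_poly[OF hc bd(1) \<zeta>])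
  have i2: "set_integrable lborel {0<..} (\<lambda>t. ?e t * h' t)" by (rule set_integrable_exp_poly[OF cont bd(2) \<zeta>])
  have "(LINT t:{0<..}|lborel. (\<i> * \<zeta>) * (?e t * h t) + ?e t * h' t) = 0 - 0"
  proof (rule half_line_FTC)
    show "((\<lambda>t. ?e t * h t) has_vector_derivative (\<i> * \<zeta>) * (?e t * h t) + ?e t * h' t) (at t)" if "t > 0" for t
      using has_vector_derivative_mult[OF exp_half_line_deriv[of \<zeta> t] der[OF that]] by (simp add: algebra_simps)
    show "continuous_on {0<..} (\<lambda>t. (\<i> * \<zeta>) * (?e t * h t) + ?e t * h' t)"
      by (intro continuous_intros cont hc)
    show "set_integrable lborel {0<..} (\<lambda>t. (\<i> * \<zeta>) * (?e t * h t) + ?e t * h' t)"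
      using i1 i2 by (intro set_integral_add) auto
    show "((\<lambda>t. ?e t * h t) \<longlongrightarrow> 0) (at_right 0)"
      by (rule tendsto_eventually) (use t0 in \<open>auto simp: eventually_at_right_field intro!: exI[of _ t0]\<close>)
    have "((\<lambda>t. C * ((1 + t) ^ m * exp (- (t * Im \<zeta>)))) \<longlongrightarrow> C * 0) at_top"
      by (intro tendsto_mult tendsto_const power_times_exp_tendsto_0 \<zeta>)
    then have lim: "((\<lambda>t. C * ((1 + t) ^ m * exp (- (t * Im \<zeta>)))) \<longlongrightarrow> 0) at_top" by simp
    show "((\<lambda>t. ?e t * h t) \<longlongrightarrow> 0) at_top"
    proof (rule Lim_null_comparison[OF _ lim])
      show "\<forall>\<^sub>F t in at_top. norm (?e t * h t) \<le> C * ((1 + t) ^ m * exp (- (t * Im \<zeta>)))"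
        using eventually_gt_at_top[of 0]
      proof eventually_elim
        case (elim t)
        have "norm (?e t * h t) \<le> exp (- (t * Im \<zeta>)) * (C * (1 + t) ^ m)"
          unfolding norm_mult norm_exp_half_line by (intro mult_left_mono bd(1) elim) auto
        then show ?case by (simp add: mult_ac)
      qed
    qed
  qed
  also have "(LINT t:{0<..}|lborel. (\<i> * \<zeta>) * (?e t * h t) + ?e t * h' t)
      = (\<i> * \<zeta>) * (LINT t:{0<..}|lborel. ?e t * h t) + (LINT t:{0<..}|lborel. ?e t * h' t)"
    using i1 i2 by (subst set_integral_add) auto
  finally have "(\<i> * \<zeta>) * (LINT t:{0<..}|lborel. ?e t * h t) = - (LINT t:{0<..}|lborel. ?e t * h' t)"
    by (simp add: eq_neg_iff_add_eq_0)
  moreover have "\<zeta> \<noteq> 0" using \<zeta> by auto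
  ultimately show ?thesis by (rule solve_imaginary_factor)
qed

lemma half_line_exp_integral:
  assumes "Im \<zeta> > 0"
  shows "(LINT t:{0<..}|lborel. wave \<zeta> t) = \<i> / \<zeta>"
proof -
  have nz: "\<zeta> \<noteq> 0" using assms by auto
  have "(LINT t:{0<..}|lborel. wave \<zeta> t) = 0 - inverse (\<i> * \<zeta>)"
  proof (rule half_line_FTC)
    show "((\<lambda>t. inverse (\<i> * \<zeta>) * wave \<zeta> t) has_vector_derivative wave \<zeta> t) (at t)" for t
      using has_vector_derivative_mult_right[OF exp_half_line_deriv[of \<zeta> t], of "inverse (\<i> * \<zeta>)"] nz by (simp add: field_simps)
    show "set_integrable lborel {0<..} (\<lambda>t. wave \<zeta> t)"
      using set_integrable_exp_poly[of "\<lambda>_. 1" 1 0 \<zeta>] assms by simp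
    show "continuous_on {0<..} (\<lambda>t. wave \<zeta> t)" by (intro continuous_intros)
    have "((\<lambda>t::real. inverse (\<i> * \<zeta>) * wave \<zeta> t) \<longlongrightarrow> inverse (\<i> * \<zeta>) * exp (\<i> * of_real 0 * \<zeta>)) (at_right 0)"
      by (intro tendsto_intros)
    then show "((\<lambda>t::real. inverse (\<i> * \<zeta>) * wave \<zeta> t) \<longlongrightarrow> inverse (\<i> * \<zeta>)) (at_right 0)" by simp
    have "((\<lambda>t. wave \<zeta> t) \<longlongrightarrow> 0) at_top"
      using power_times_exp_tendsto_0[OF assms, of 0] by (intro tendsto_norm_zero_cancel[of "\<lambda>t. wave \<zeta> t"]) simp
    from tendsto_mult[OF tendsto_const[of "inverse (\<i> * \<zeta>)"] this]
    show "((\<lambda>t::real. inverse (\<i> * \<zeta>) * wave \<zeta> t) \<longlongrightarrow> 0) at_top" by (simp only: mult_zero_right)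
  qed
  also have "\<dots> = \<i> / \<zeta>" using nz by (simp add: divide_inverse)
  finally show ?thesis .
qed

text \<open>Each integration by parts produces a factor \<open>\<i> / \<zeta>\<close>. After
  \<open>n\<close> of them a symbol of order \<open>n\<close> has become bounded, and for
  \<open>c\<close> its limit at infinity the last integral converges for real \<open>\<zeta>\<close>
  as well.\<close>

theorem half_line_expansion:
  fixes h :: "nat \<Rightarrow> real \<Rightarrow> complex"
  assumes der: "\<And>k t. k < n \<Longrightarrow> t > 0 \<Longrightarrow> (h k has_vector_derivative h (Suc k) t) (at t)"
    and cont: "\<And>k. k \<le> n \<Longrightarrow> continuous_on {0<..} (h k)"
    and t0: "t0 > 0" "\<And>k t. k < n \<Longrightarrow> 0 < t \<Longrightarrow> t < t0 \<Longrightarrow> h k t = 0"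
    and bd: "\<And>k t. k \<le> n \<Longrightarrow> t > 0 \<Longrightarrow> norm (h k t) \<le> C k * (1 + t) ^ n"
    and \<zeta>: "Im \<zeta> > 0"
  shows "(LINT t:{0<..}|lborel. wave \<zeta> t * h 0 t)
    = (\<i> / \<zeta>) ^ Suc n * c + (\<i> / \<zeta>) ^ n * (LINT t:{0<..}|lborel. wave \<zeta> t * (h n t - c))"
proof -
  let ?e = "\<lambda>t. wave \<zeta> t"
  have "k \<le> n \<Longrightarrow> (LINT t:{0<..}|lborel. ?e t * h 0 t) = (\<i> / \<zeta>) ^ k * (LINT t:{0<..}|lborel. ?e t * h k t)" for k
  proof (induction k)
    case (Suc k)
    have "(LINT t:{0<..}|lborel. ?e t * h k t) = (\<i> / \<zeta>) * (LINT t:{0<..}|lborel. ?e t * h (Suc k) t)"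
      by (rule half_line_ibp[OF _ _ t0(1) _ bd bd \<zeta>]) (use Suc.prems der cont t0(2) in auto)
    then show ?case using Suc by simp
  qed simp
  then have "(LINT t:{0<..}|lborel. ?e t * h 0 t) = (\<i> / \<zeta>) ^ n * (LINT t:{0<..}|lborel. ?e t * h n t)" by simp
  moreover have "(LINT t:{0<..}|lborel. ?e t * h n t) = (LINT t:{0<..}|lborel. ?e t * (h n t - c)) + (\<i> / \<zeta>) * c"
  proof -
    have i1: "set_integrable lborel {0<..} (\<lambda>t. ?e t * h n t)"
      by (rule set_integrable_exp_poly[OF cont bd \<zeta>]) auto
    have i2: "set_integrable lborel {0<..} (\<lambda>t. ?e t * c)"
      by (rule set_integrable_exp_poly[of "\<lambda>_. c" "norm c" 0, OF _ _ \<zeta>]) auto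
    have "(LINT t:{0<..}|lborel. ?e t * (h n t - c)) = (LINT t:{0<..}|lborel. ?e t * h n t) - (LINT t:{0<..}|lborel. ?e t * c)"
      using i1 i2 by (subst set_integral_diff(2)[symmetric]) (auto simp: algebra_simps)
    also have "(LINT t:{0<..}|lborel. ?e t * c) = (\<i> / \<zeta>) * c"
      using half_line_exp_integral[OF \<zeta>] by simp
    finally show ?thesis by simp
  qed
  ultimately show ?thesis by (simp add: algebra_simps)
qed

text \<open>Covers at once the continuity of the remainder integral in the base point
  (\<open>p\<close> and \<open>\<zeta>\<close> varying together) and the removal of the damping
  (\<open>\<zeta> k\<close> tending to its undamped value).\<close>

lemma half_line_integral_tendsto:
  fixes g :: "'p::t2_space \<Rightarrow> real \<Rightarrow> complex"
  assumes P: "\<And>k. p k \<in> P" "q \<in> P" and lim: "\<And>t. t > 0 \<Longrightarrow> (\<lambda>k. g (p k) t) \<longlonglongrightarrow> g q t" "\<zeta> \<longlonglongrightarrow> \<xi>"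
    and Im: "\<And>k. Im (\<zeta> k) \<ge> 0"
    and cont: "\<And>x. x \<in> P \<Longrightarrow> continuous_on {0<..} (g x)"
    and bd: "\<And>x t. x \<in> P \<Longrightarrow> t > 0 \<Longrightarrow> norm (g x t) \<le> C / (1 + t)\<^sup>2"
  shows "(\<lambda>k. LINT t:{0<..}|lborel. wave (\<zeta> k) t * g (p k) t) \<longlonglongrightarrow> (LINT t:{0<..}|lborel. wave \<xi> t * g q t)"
  unfolding set_lebesgue_integral_def
proof (rule integral_dominated_convergence[where w = "\<lambda>t. indicator {0<..} t *\<^sub>R (C * (1 / (1 + t)\<^sup>2))"])
  have m: "(\<lambda>t. indicator {0<..} t *\<^sub>R (wave z t * g x t)) \<in> borel_measurable lborel" if "x \<in> P" for x z
    using set_borel_measurable_half_line[of "\<lambda>t. wave z t * g x t"] cont[OF that]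
    by (simp add: set_borel_measurable_def continuous_intros)
  show "(\<lambda>t. indicator {0<..} t *\<^sub>R (wave \<xi> t * g q t)) \<in> borel_measurable lborel" by (rule m[OF P(2)])
  show "(\<lambda>t. indicator {0<..} t *\<^sub>R (wave (\<zeta> k) t * g (p k) t)) \<in> borel_measurable lborel" for k by (rule m[OF P(1)])
  have "set_integrable lborel {0<..} (\<lambda>t. C * (1 / (1 + t)\<^sup>2))" by (intro set_integrable_mult_right set_integrable_inverse_square)
  then show "integrable lborel (\<lambda>t. indicator {0<..} t *\<^sub>R (C * (1 / (1 + t)\<^sup>2)))" by (simp add: set_integrable_def)
  show "AE t in lborel. (\<lambda>k. indicator {0<..} t *\<^sub>R (wave (\<zeta> k) t * g (p k) t)) \<longlonglongrightarrow> indicator {0<..} t *\<^sub>R (wave \<xi> t * g q t)"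
    using lim by (intro AE_I2) (auto simp: indicator_def intro!: tendsto_intros)
  show "AE t in lborel. norm (indicator {0<..} t *\<^sub>R (wave (\<zeta> k) t * g (p k) t)) \<le> indicator {0<..} t *\<^sub>R (C * (1 / (1 + t)\<^sup>2))" for k
  proof (intro AE_I2)
    fix t :: real
    show "norm (indicator {0<..} t *\<^sub>R (wave (\<zeta> k) t * g (p k) t)) \<le> indicator {0<..} t *\<^sub>R (C * (1 / (1 + t)\<^sup>2))"
    proof (cases "t > 0")
      case True
      have "norm (wave (\<zeta> k) t * g (p k) t) \<le> 1 * norm (g (p k) t)"
        unfolding norm_mult norm_exp_half_line using True Im by (intro mult_right_mono) auto
      then show ?thesis using bd[OF P(1) True, of k] True by simp
    qed auto
  qed
qed

section \<open>Coordinates on a smooth manifold\<close>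

lemma frechet_derivative_axis_sum:
  fixes f :: "real ^ 'm::finite \<Rightarrow> complex"
  assumes "f differentiable (at z)"
  shows "fd f z v = (\<Sum>k\<in>UNIV. of_real (v $ k) * fd f z (axis k 1))"
proof -
  interpret linear "fd f z" using linear_frechet_derivative[OF assms] .
  have "v = (\<Sum>k\<in>UNIV. (v $ k) *\<^sub>R axis k 1)"
    using basis_expansion[of v] by (simp add: scalar_mult_eq_scaleR)
  then have "fd f z v = fd f z (\<Sum>k\<in>UNIV. (v $ k) *\<^sub>R axis k 1)" by simp
  then show ?thesis by (simp only: sum scale) (simp only: scaleR_conv_of_real)
qed

context
  fixes c :: "('x::topological_space, 'm::finite) chart"
  assumes c: "is_chart c"
begin

lemma chart_open: "open (cdom c)" and cimg_open: "open (cimg c)"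
  using c by (auto simp: is_chart_def cimg_def)

lemma chart_homeomorphism: "homeomorphism (cdom c) (cimg c) (cmap c) (cinv c)"
  using c by (auto simp: is_chart_def cimg_def)

lemma cinv_cmap: "p \<in> cdom c \<Longrightarrow> cinv c (cmap c p) = p"
  using homeomorphism_apply1[OF chart_homeomorphism] .

lemma cmap_cinv: "z \<in> cimg c \<Longrightarrow> cmap c (cinv c z) = z"
  using homeomorphism_apply2[OF chart_homeomorphism] .

lemma cinv_in: "z \<in> cimg c \<Longrightarrow> cinv c z \<in> cdom c"
  using homeomorphism_image2[OF chart_homeomorphism] by blast

lemma cmap_in: "p \<in> cdom c \<Longrightarrow> cmap c p \<in> cimg c"
  by (simp add: cimg_def)

lemma continuous_cmap: "continuous_on (cdom c) (cmap c)" and continuous_cinv: "continuous_on (cimg c) (cinv c)"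
  using chart_homeomorphism by (auto simp: homeomorphism_def)

lemma open_chart_image: "open W \<Longrightarrow> W \<subseteq> cdom c \<Longrightarrow> open (cmap c ` W)"
  using homeomorphism_imp_open_map[OF chart_homeomorphism, of W] chart_open cimg_open
  by (simp add: openin_open_eq openin_open_trans)

lemma cinv_image: "W \<subseteq> cdom c \<Longrightarrow> z \<in> cmap c ` W \<Longrightarrow> cinv c z \<in> W"
  using cinv_cmap by auto

end

text \<open>Only functions on an open set that lies in both charts are transported, so one
  transition map is enough.\<close>

lemma smooth_change_chart:
  fixes a c :: "('x::topological_space, 'm::finite) chart" and f :: "'x \<Rightarrow> 'b::real_normed_vector"
  assumes "is_chart a" "is_chart c" "smooth_transition c a"
    and W: "open W" "W \<subseteq> cdom a" "W \<subseteq> cdom c"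
    and f: "smooth_on (cmap a ` W) (f \<circ> cinv a)"
  shows "smooth_on (cmap c ` W) (f \<circ> cinv c)"
proof -
  have "smooth_on (cmap c ` W) (\<lambda>z. (f \<circ> cinv a) ((cmap a \<circ> cinv c) z))"
  proof (rule smooth_on_compose[OF _ f])
    show "smooth_on (cmap c ` W) (cmap a \<circ> cinv c)"
      using assms(3) W open_chart_image[OF assms(2) W(1,3)] unfolding smooth_transition_def
      by (auto intro: smooth_on_subset)
    show "(cmap a \<circ> cinv c) ` cmap c ` W \<subseteq> cmap a ` W"
      using W cinv_cmap[OF assms(2)] by auto
  qed
  then show ?thesis
  proof (rule smooth_on_cong)
    fix z assume "z \<in> cmap c ` W"
    then obtain p where "p \<in> W" "z = cmap c p" by auto
    then show "(f \<circ> cinv a) ((cmap a \<circ> cinv c) z) = (f \<circ> cinv c) z"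
      using cinv_cmap[OF assms(1) subsetD[OF W(2)]] cinv_cmap[OF assms(2) subsetD[OF W(3)]] by simp
  qed
qed

locale smooth_manifold =
  fixes A :: "('x::t2_space, 'm::finite) chart set"
  assumes atlas: "smooth_atlas A"
begin

lemma charts_is_chart: "c \<in> charts A \<Longrightarrow> is_chart c" by (simp add: charts_def)

lemma exists_chart: "\<exists>a\<in>A. p \<in> cdom a"
  using atlas unfolding smooth_atlas_def by (metis UNIV_I UN_iff)

lemma atlas_charts: "a \<in> A \<Longrightarrow> a \<in> charts A" using atlas by (auto simp: smooth_atlas_def)

text \<open>Membership in \<open>charts A\<close> gives compatibility with the atlas
  \<open>A\<close> only; near each point the transition between two such charts factors through a
  chart of the atlas.\<close>

lemma charts_transition:
  assumes c: "c \<in> charts A" and d: "d \<in> charts A"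
  shows "smooth_transition c d"
  unfolding smooth_transition_def
proof (rule smooth_on_local)
  show "open (cmap c ` (cdom c \<inter> cdom d))"
    using open_chart_image[OF charts_is_chart[OF c]] chart_open charts_is_chart c d by (metis Int_lower1 open_Int)
  fix z assume "z \<in> cmap c ` (cdom c \<inter> cdom d)"
  then obtain p where p: "p \<in> cdom c" "p \<in> cdom d" "z = cmap c p" by auto
  obtain a where a: "a \<in> A" "p \<in> cdom a" using exists_chart by blast
  have ch: "is_chart a" "is_chart c" "is_chart d" using charts_is_chart atlas_charts a c d by auto
  let ?W = "cdom c \<inter> cdom d \<inter> cdom a"
  have W: "open ?W" by (intro open_Int chart_open ch)
  have "smooth_on (cmap c ` ?W) (cmap d \<circ> cinv c)"
  proof (rule smooth_change_chart[OF ch(1,2) _ W])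
    show "smooth_transition c a" using c a by (simp add: charts_def)
    have "smooth_transition a d" using d a by (simp add: charts_def)
    then show "smooth_on (cmap a ` ?W) (cmap d \<circ> cinv a)"
      unfolding smooth_transition_def by (rule smooth_on_subset) (use open_chart_image[OF ch(1) W] in auto)
  qed auto
  moreover have "z \<in> cmap c ` ?W" using p a by auto
  ultimately show "\<exists>N. z \<in> N \<and> smooth_on N (cmap d \<circ> cinv c)" by (intro exI[of _ "cmap c ` ?W"] conjI)
qed

lemma smooth_fun_chart:
  "smooth_fun A W f \<Longrightarrow> c \<in> charts A \<Longrightarrow> W \<subseteq> cdom c \<Longrightarrow> smooth_on (cmap c ` W) (f \<circ> cinv c)"
  unfolding smooth_fun_def by (metis inf.absorb2)

lemma smooth_fun_chartI:
  assumes c: "c \<in> charts A" and W: "open W" "W \<subseteq> cdom c" and f: "smooth_on (cmap c ` W) (f \<circ> cinv c)"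
  shows "smooth_fun A W f"
  unfolding smooth_fun_def
proof (intro conjI ballI W(1))
  fix d assume d: "d \<in> charts A"
  have ch: "is_chart c" "is_chart d" using c d charts_is_chart by auto
  have W': "open (cdom d \<inter> W)" using chart_open[OF ch(2)] W by auto
  show "smooth_on (cmap d ` (cdom d \<inter> W)) (f \<circ> cinv d)"
  proof (rule smooth_change_chart[OF ch charts_transition[OF d c] W'])
    show "smooth_on (cmap c ` (cdom d \<inter> W)) (f \<circ> cinv c)"
      by (rule smooth_on_subset[OF f open_chart_image[OF ch(1) W']]) (use W in auto)
  qed (use W in auto)
qed

lemma smooth_fun_subset:
  assumes "smooth_fun A W f" "open W'" "W' \<subseteq> W" shows "smooth_fun A W' f"
proof -
  have "smooth_on (cmap c ` (cdom c \<inter> W')) (f \<circ> cinv c)" if c: "c \<in> charts A" for c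
  proof (rule smooth_on_subset)
    show "smooth_on (cmap c ` (cdom c \<inter> W)) (f \<circ> cinv c)" using assms(1) c by (simp add: smooth_fun_def)
    show "open (cmap c ` (cdom c \<inter> W'))"
      using charts_is_chart[OF c] assms(2) by (intro open_chart_image open_Int chart_open) auto
  qed (use assms(3) in auto)
  then show ?thesis using assms(2) by (simp add: smooth_fun_def)
qed

lemma smooth_near_chart:
  assumes "smooth_near A p f" "c \<in> charts A" "p \<in> cdom c"
  obtains W where "open W" "p \<in> W" "W \<subseteq> cdom c" "smooth_fun A W f" "smooth_on (cmap c ` W) (f \<circ> cinv c)" "open (cmap c ` W)"
proof -
  obtain U where U: "p \<in> U" "smooth_fun A U f" using assms(1) by (auto simp: smooth_near_def)
  let ?W = "U \<inter> cdom c"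
  have o: "open ?W" using U chart_open[OF charts_is_chart[OF assms(2)]] by (auto simp: smooth_fun_def)
  have s: "smooth_fun A ?W f" by (rule smooth_fun_subset[OF U(2) o]) auto
  show ?thesis
    by (rule that[OF o _ _ s smooth_fun_chart[OF s assms(2)]])
      (use U assms o open_chart_image[OF charts_is_chart[OF assms(2)] o] in auto)
qed

lemma smooth_near_smooth_fun: "smooth_fun A W f \<Longrightarrow> p \<in> W \<Longrightarrow> smooth_near A p f"
  by (auto simp: smooth_near_def)

lemma smooth_fun_open: "smooth_fun A W f \<Longrightarrow> open W" by (simp add: smooth_fun_def)

lemma smooth_near_differentiable:
  assumes "smooth_near A p f" "c \<in> charts A" "p \<in> cdom c"
  shows "(f \<circ> cinv c) differentiable (at (cmap c p))"
  using smooth_near_chart[OF assms] smooth_on_differentiable by (metis imageI)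

abbreviation pd :: "('x, 'm) chart \<Rightarrow> 'm \<Rightarrow> ('x \<Rightarrow> complex) \<Rightarrow> real ^ 'm \<Rightarrow> complex" where
  "pd c j f z \<equiv> fd (f \<circ> cinv c) z (axis j 1)"

lemma coord_vec_apply:
  "smooth_near A p f \<Longrightarrow> coord_vec A c p a f = (\<Sum>j\<in>UNIV. a $ j * pd c j f (cmap c p))"
  by (simp add: coord_vec_def)

lemma pd_change_chart:
  assumes c: "c \<in> charts A" "p \<in> cdom c" and d: "d \<in> charts A" "p \<in> cdom d" and f: "smooth_near A p f"
  shows "pd d j f (cmap d p) = (\<Sum>k\<in>UNIV. of_real (fd (cmap c \<circ> cinv d) (cmap d p) (axis j 1) $ k) * pd c k f (cmap c p))"
proof -
  let ?t = "cmap c \<circ> cinv d"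
  have ch: "is_chart c" "is_chart d" using c d charts_is_chart by auto
  have fd: "(f \<circ> cinv c) differentiable (at (cmap c p))" by (rule smooth_near_differentiable[OF f c])
  have "smooth_on (cmap d ` (cdom d \<inter> cdom c)) ?t" using charts_transition[OF d(1) c(1)] by (simp add: smooth_transition_def)
  then have td: "(?t has_derivative fd ?t (cmap d p)) (at (cmap d p))"
    by (rule smooth_on_has_derivative) (use c d in auto)
  have tp: "?t (cmap d p) = cmap c p" using cinv_cmap[OF ch(2) d(2)] by simp
  have "((f \<circ> cinv c) \<circ> ?t has_derivative fd (f \<circ> cinv c) (cmap c p) \<circ> fd ?t (cmap d p)) (at (cmap d p))"
    by (rule diff_chain_at[OF td]) (use fd tp in \<open>simp add: frechet_derivative_works\<close>)
  then have "(f \<circ> cinv d has_derivative fd (f \<circ> cinv c) (cmap c p) \<circ> fd ?t (cmap d p)) (at (cmap d p))"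
  proof (rule has_derivative_transform_within_open)
    show "open (cmap d ` (cdom d \<inter> cdom c))" using ch by (intro open_chart_image open_Int chart_open) auto
  qed (use c d cinv_cmap[OF ch(1)] cinv_cmap[OF ch(2)] in auto)
  from frechet_derivative_eqI[OF this, of "axis j 1"]
  have "pd d j f (cmap d p) = fd (f \<circ> cinv c) (cmap c p) (fd ?t (cmap d p) (axis j 1))"
    unfolding comp_apply[of "fd (f \<circ> cinv c) (cmap c p)"] .
  also note frechet_derivative_axis_sum[OF fd]
  finally show ?thesis .
qed

lemma coord_vec_change_chart:
  assumes c: "c \<in> charts A" "p \<in> cdom c" and d: "d \<in> charts A" "p \<in> cdom d"
  shows "\<exists>b. coord_vec A d p a = coord_vec A c p b"
proof -
  let ?D = "\<lambda>j k. of_real (fd (cmap c \<circ> cinv d) (cmap d p) (axis j 1) $ k) :: complex"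
  have "coord_vec A d p a f = coord_vec A c p (\<chi> k. \<Sum>j\<in>UNIV. a $ j * ?D j k) f" for f
  proof (cases "smooth_near A p f")
    case True
    have "(\<Sum>j\<in>UNIV. a $ j * (\<Sum>k\<in>UNIV. ?D j k * pd c k f (cmap c p)))
        = (\<Sum>k\<in>UNIV. (\<Sum>j\<in>UNIV. a $ j * ?D j k) * pd c k f (cmap c p))"
      by (simp add: sum_distrib_left sum_distrib_right mult.assoc) (rule sum.swap)
    then show ?thesis using True by (simp add: coord_vec_apply pd_change_chart[OF c d])
  qed (simp add: coord_vec_def)
  then show ?thesis by blast
qed

text \<open>Tangent vectors are defined through arbitrary charts; every chart around the point
  represents all of them, so computations may stay in one chart.\<close>

lemma CT_coord: "c \<in> charts A \<Longrightarrow> p \<in> cdom c \<Longrightarrow> CT A p = range (coord_vec A c p)"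
  using coord_vec_change_chart unfolding CT_def by fastforce

definition coordf :: "('x, 'm) chart \<Rightarrow> 'm \<Rightarrow> 'x \<Rightarrow> complex" where
  "coordf c k q = of_real (cmap c q $ k)"

text \<open>A tangent vector is recovered from its values on the coordinate functions, which are
  smooth near every point of the chart.\<close>

definition comps :: "('x, 'm) chart \<Rightarrow> 'x tvec \<Rightarrow> complex ^ 'm" where
  "comps c v = (\<chi> k. v (coordf c k))"

lemma smooth_coordf: "c \<in> charts A \<Longrightarrow> smooth_fun A (cdom c) (coordf c k)"
proof (rule smooth_fun_chartI)
  assume c: "c \<in> charts A"
  then have ch: "is_chart c" by (rule charts_is_chart)
  show "open (cdom c)" by (rule chart_open[OF ch])
  have "smooth_on (cimg c) (\<lambda>z. complex_of_real (z $ k))"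
    by (intro smooth_on_of_real smooth_on_linear[OF bounded_linear_vec_nth] cimg_open[OF ch])
  then show "smooth_on (cmap c ` cdom c) (coordf c k \<circ> cinv c)"
    unfolding cimg_def[symmetric] by (rule smooth_on_cong) (simp add: coordf_def cmap_cinv[OF ch])
qed auto

lemma pd_coordf:
  assumes c: "c \<in> charts A" "p \<in> cdom c"
  shows "pd c j (coordf c k) (cmap c p) = (if j = k then 1 else 0)"
proof -
  have ch: "is_chart c" by (rule charts_is_chart[OF c(1)])
  have "((\<lambda>z. complex_of_real (z $ k)) has_derivative (\<lambda>v. of_real (v $ k))) (at (cmap c p))"
    by (intro bounded_linear_imp_has_derivative bounded_linear_compose[OF bounded_linear_of_real bounded_linear_vec_nth])
  then have "(coordf c k \<circ> cinv c has_derivative (\<lambda>v. of_real (v $ k))) (at (cmap c p))"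
    by (rule has_derivative_transform_within_open[OF _ cimg_open[OF ch] cmap_in[OF ch c(2)]])
      (simp add: coordf_def cmap_cinv[OF ch])
  then show ?thesis by (simp add: frechet_derivative_eqI axis_def)
qed

lemma comps_coord_vec:
  assumes c: "c \<in> charts A" "p \<in> cdom c" shows "comps c (coord_vec A c p a) = a"
  using smooth_near_smooth_fun[OF smooth_coordf[OF c(1)] c(2)]
  by (simp add: vec_eq_iff comps_def coord_vec_apply pd_coordf[OF c] if_distrib sum.delta cong: if_cong)

lemma CT_comps:
  assumes c: "c \<in> charts A" "p \<in> cdom c" and "v \<in> CT A p" shows "v = coord_vec A c p (comps c v)"
  using assms CT_coord[OF c] comps_coord_vec[OF c] by auto

lemma CT_apply:
  assumes "c \<in> charts A" "p \<in> cdom c" "v \<in> CT A p" "smooth_near A p f"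
  shows "v f = (\<Sum>j\<in>UNIV. comps c v $ j * pd c j f (cmap c p))"
  using CT_comps[OF assms(1-3)] coord_vec_apply[OF assms(4), of c "comps c v"] by simp

lemma vfield_CT: "smooth_vfield A W V \<Longrightarrow> p \<in> W \<Longrightarrow> V p \<in> CT A p"
  by (auto simp: smooth_vfield_def)

lemma smooth_vfield_apply:
  "smooth_vfield A W V \<Longrightarrow> smooth_fun A W' f \<Longrightarrow> W' \<subseteq> W \<Longrightarrow> smooth_fun A W' (\<lambda>q. V q f)"
  by (auto simp: smooth_vfield_def)

lemma smooth_vfield_subset: "smooth_vfield A W V \<Longrightarrow> open W' \<Longrightarrow> W' \<subseteq> W \<Longrightarrow> smooth_vfield A W' V"
  unfolding smooth_vfield_def by blast

lemma smooth_vfield_near: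
  assumes "smooth_vfield A W V" "p \<in> W" "smooth_near A p f"
  shows "smooth_near A p (\<lambda>q. V q f)"
proof -
  obtain U where U: "p \<in> U" "smooth_fun A U f" using assms(3) by (auto simp: smooth_near_def)
  have "smooth_fun A (U \<inter> W) (\<lambda>q. V q f)"
    using assms(1) U by (intro smooth_vfield_apply[OF assms(1)] smooth_fun_subset[OF U(2)]) (auto simp: smooth_vfield_def smooth_fun_def)
  then show ?thesis using U assms(2) by (auto simp: smooth_near_def)
qed

lemma smooth_comps:
  assumes V: "smooth_vfield A W V" and c: "c \<in> charts A"
  shows "smooth_fun A (W \<inter> cdom c) (\<lambda>q. comps c (V q) $ k)"
proof -
  have "open (W \<inter> cdom c)" using V chart_open[OF charts_is_chart[OF c]] by (auto simp: smooth_vfield_def)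
  then have "smooth_fun A (W \<inter> cdom c) (coordf c k)" using smooth_fun_subset[OF smooth_coordf[OF c]] by auto
  from smooth_vfield_apply[OF V this] show ?thesis by (simp add: comps_def)
qed

lemma smooth_coord_field:
  assumes c: "c \<in> charts A" shows "smooth_vfield A (cdom c) (\<lambda>p. coord_vec A c p a)"
  unfolding smooth_vfield_def
proof (intro conjI allI impI ballI)
  have ch: "is_chart c" by (rule charts_is_chart[OF c])
  show "open (cdom c)" by (rule chart_open[OF ch])
  show "coord_vec A c p a \<in> CT A p" if "p \<in> cdom c" for p using CT_coord[OF c that] by auto
  fix W f assume W: "W \<subseteq> cdom c" and f: "smooth_fun A W f"
  show "smooth_fun A W (\<lambda>p. coord_vec A c p a f)"
  proof (rule smooth_fun_chartI[OF c smooth_fun_open[OF f] W])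
    have sm: "smooth_on (cmap c ` W) (f \<circ> cinv c)" by (rule smooth_fun_chart[OF f c W])
    have "smooth_on (cmap c ` W) (\<lambda>z. \<Sum>j\<in>UNIV. a $ j * pd c j f z)"
      using smooth_on_open[OF sm] by (intro smooth_on_sum smooth_on_mult smooth_on_const smooth_on_deriv[OF sm])
    then show "smooth_on (cmap c ` W) ((\<lambda>p. coord_vec A c p a f) \<circ> cinv c)"
    proof (rule smooth_on_cong)
      fix z assume "z \<in> cmap c ` W"
      then obtain p where p: "p \<in> W" "z = cmap c p" by auto
      then show "(\<Sum>j\<in>UNIV. a $ j * pd c j f z) = ((\<lambda>p. coord_vec A c p a f) \<circ> cinv c) z"
        using coord_vec_apply[OF smooth_near_smooth_fun[OF f p(1)], of c a] cinv_cmap[OF ch, of p] W by auto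
    qed
  qed
qed

lemma smooth_fun_cnj: "smooth_fun A W f \<Longrightarrow> smooth_fun A W (\<lambda>q. cnj (f q))"
  unfolding smooth_fun_def
  using smooth_on_bounded_linear[OF bounded_linear_cnj] by (force simp: o_def)

lemma smooth_near_cnj: "smooth_near A p f \<Longrightarrow> smooth_near A p (\<lambda>q. cnj (f q))"
  unfolding smooth_near_def using smooth_fun_cnj by blast

lemma smooth_near_cnj_iff: "smooth_near A p (\<lambda>q. cnj (f q)) \<longleftrightarrow> smooth_near A p f"
  using smooth_near_cnj[of p f] smooth_near_cnj[of p "\<lambda>q. cnj (f q)"] by auto

lemma vconj_coord_vec:
  assumes c: "c \<in> charts A" "p \<in> cdom c"
  shows "vconj (coord_vec A c p a) = coord_vec A c p (\<chi> k. cnj (a $ k))"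
proof
  fix f
  show "vconj (coord_vec A c p a) f = coord_vec A c p (\<chi> k. cnj (a $ k)) f"
  proof (cases "smooth_near A p f")
    case True
    have "pd c j (\<lambda>q. cnj (f q)) (cmap c p) = cnj (pd c j f (cmap c p))" for j
      using frechet_derivative_bounded_linear[OF bounded_linear_cnj smooth_near_differentiable[OF True c]] by (simp add: o_def)
    then show ?thesis using True smooth_near_cnj[OF True] by (simp add: vconj_def coord_vec_apply)
  next
    case False
    then show ?thesis by (simp add: vconj_def coord_vec_def smooth_near_cnj_iff)
  qed
qed

lemma vconj_CT: 
  assumes "v \<in> CT A p" shows "vconj v \<in> CT A p"
proof -
  obtain a where a: "a \<in> A" "p \<in> cdom a" using exists_chart by blast
  show ?thesis using assms CT_coord[OF atlas_charts[OF a(1)] a(2)] vconj_coord_vec[OF atlas_charts[OF a(1)] a(2)] by auto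
qed

lemma comps_vconj:
  assumes c: "c \<in> charts A" "p \<in> cdom c" and "v \<in> CT A p"
  shows "comps c (vconj v) = (\<chi> k. cnj (comps c v $ k))"
  using CT_comps[OF assms] vconj_coord_vec[OF c] comps_coord_vec[OF c] by metis

lemma smooth_vconj:
  assumes V: "smooth_vfield A W V" shows "smooth_vfield A W (\<lambda>q. vconj (V q))"
  unfolding smooth_vfield_def
proof (intro conjI allI impI ballI)
  show "open W" using V by (simp add: smooth_vfield_def)
  show "vconj (V p) \<in> CT A p" if "p \<in> W" for p using vconj_CT vfield_CT[OF V that] by blast
  fix W' f assume "W' \<subseteq> W" "smooth_fun A W' f"
  then show "smooth_fun A W' (\<lambda>p. vconj (V p) f)"
    unfolding vconj_def by (intro smooth_fun_cnj smooth_vfield_apply[OF V])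
qed

lemma vcomb_coord_vec: "vcomb a (coord_vec A c p x) b (coord_vec A c p y) = coord_vec A c p (a *s x + b *s y)"
  by (rule ext) (simp add: vcomb_def coord_vec_def sum_distrib_left sum.distrib algebra_simps)

text \<open>States complex linearity by a single identity because it is applied to covectors and to
  the two slots of the metric, whose linearity is given in the form of \<open>vcomb\<close>.\<close>

lemma linear_coord_expansion:
  fixes L :: "complex ^ 'm \<Rightarrow> complex"
  assumes "\<And>a x b y. L (a *s x + b *s y) = a * L x + b * L y"
  shows "L x = (\<Sum>k\<in>UNIV. x $ k * L (axis k 1))"
proof -
  have "L (\<Sum>k\<in>I. x $ k *s axis k 1) = (\<Sum>k\<in>I. x $ k * L (axis k 1))" if "finite I" for I
    using that
  proof (induction I)
    case empty
    then show ?case using assms[of 0 0 0 0] by simp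
  next
    case (insert k I)
    then show ?case using assms[of "x $ k" "axis k 1" 1 "\<Sum>k\<in>I. x $ k *s axis k 1"] by simp
  qed
  from this[of UNIV] show ?thesis by (simp add: basis_expansion)
qed

lemma covector_coord:
  assumes c: "c \<in> charts A" "p \<in> cdom c" and \<eta>: "\<eta> \<in> CTdual A p"
  shows "\<eta> (coord_vec A c p x) = (\<Sum>k\<in>UNIV. x $ k * \<eta> (coord_vec A c p (axis k 1)))"
proof (rule linear_coord_expansion)
  fix a x b y
  have "coord_vec A c p x \<in> CT A p" "coord_vec A c p y \<in> CT A p" using CT_coord[OF c] by auto
  then have "\<eta> (vcomb a (coord_vec A c p x) b (coord_vec A c p y)) = a * \<eta> (coord_vec A c p x) + b * \<eta> (coord_vec A c p y)"
    using \<eta> by (auto simp: CTdual_def)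
  then show "\<eta> (coord_vec A c p (a *s x + b *s y)) = a * \<eta> (coord_vec A c p x) + b * \<eta> (coord_vec A c p y)"
    by (simp add: vcomb_coord_vec)
qed

end

section \<open>The exterior derivative in coordinates\<close>

lemma frechet_derivative_sum_mult:
  fixes a b :: "'k \<Rightarrow> 'a::euclidean_space \<Rightarrow> complex"
  assumes "\<And>k. k \<in> K \<Longrightarrow> a k differentiable (at z)" "\<And>k. k \<in> K \<Longrightarrow> b k differentiable (at z)"
  shows "fd (\<lambda>z. \<Sum>k\<in>K. a k z * b k z) z v
    = (\<Sum>k\<in>K. a k z * fd (b k) z v + fd (a k) z v * b k z)"
  by (rule frechet_derivative_eqI[OF has_derivative_sum[OF has_derivative_mult]])
    (use assms in \<open>auto simp: frechet_derivative_works\<close>)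

context smooth_manifold
begin

lemma smooth_fun_continuous:
  assumes "smooth_fun A W f" "c \<in> charts A" "W \<subseteq> cdom c"
  shows "continuous_on W f"
proof -
  have ch: "is_chart c" by (rule charts_is_chart[OF assms(2)])
  have "continuous_on W ((f \<circ> cinv c) \<circ> cmap c)"
    by (rule continuous_on_compose[OF continuous_on_subset[OF continuous_cmap[OF ch] assms(3)]
          smooth_on_continuous[OF smooth_fun_chart[OF assms]]])
  then show ?thesis
    by (rule continuous_on_eq) (use cinv_cmap[OF ch subsetD[OF assms(3)]] in simp)
qed

lemma smooth_fun_pd_continuous:
  assumes "smooth_fun A W f" "c \<in> charts A" "W \<subseteq> cdom c"
  shows "continuous_on W (\<lambda>q. pd c j f (cmap c q))"
proof -
  have "continuous_on W ((\<lambda>z. pd c j f z) \<circ> cmap c)"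
    by (rule continuous_on_compose[OF continuous_on_subset[OF continuous_cmap[OF charts_is_chart[OF assms(2)]] assms(3)]
          smooth_on_continuous[OF smooth_on_deriv[OF smooth_fun_chart[OF assms]]]])
  then show ?thesis by (simp add: o_def)
qed

text \<open>The product rule for a function that is a sum of components of \<open>V\<close> times
  coefficients. The derivative of a function along \<open>V\<close> and the value of a one-form on
  \<open>V\<close> both have this shape.\<close>

lemma comps_sum_pd:
  assumes V: "smooth_vfield A W V" and W1: "open W1" "W1 \<subseteq> W \<inter> cdom c" "p \<in> W1" and c: "c \<in> charts A"
    and w: "\<And>k. smooth_on (cmap c ` W1) (w k)" and g: "\<And>q. q \<in> W1 \<Longrightarrow> g q = (\<Sum>k\<in>UNIV. comps c (V q) $ k * w k (cmap c q))"
  shows "pd c j g (cmap c p) = (\<Sum>k\<in>UNIV. comps c (V p) $ k * fd (w k) (cmap c p) (axis j 1)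
       + pd c j (\<lambda>q. comps c (V q) $ k) (cmap c p) * w k (cmap c p))"
proof -
  have ch: "is_chart c" by (rule charts_is_chart[OF c])
  have W1c: "W1 \<subseteq> cdom c" using W1 by auto
  have sV: "smooth_on (cmap c ` W1) ((\<lambda>q. comps c (V q) $ k) \<circ> cinv c)" for k
    by (rule smooth_fun_chart[OF smooth_fun_subset[OF smooth_comps[OF V c] W1(1,2)] c W1c])
  have z: "cmap c p \<in> cmap c ` W1" using W1 by auto
  have oz: "open (cmap c ` W1)" by (rule smooth_on_open[OF w])
  define G where "G z = (\<Sum>k\<in>UNIV. ((\<lambda>q. comps c (V q) $ k) \<circ> cinv c) z * w k z)" for z
  have Gs: "smooth_on (cmap c ` W1) G" unfolding G_def
    by (intro smooth_on_sum smooth_on_mult sV w oz)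
  have "fd G (cmap c p) = fd (g \<circ> cinv c) (cmap c p)"
  proof (rule frechet_derivative_cong_open[OF oz z])
    fix y assume "y \<in> cmap c ` W1"
    then obtain q where q: "q \<in> W1" "y = cmap c q" by auto
    then show "G y = (g \<circ> cinv c) y" using g[OF q(1)] cinv_cmap[OF ch subsetD[OF W1c q(1)]] by (simp add: G_def)
  qed (rule smooth_on_differentiable[OF Gs z])
  moreover have "fd G (cmap c p) (axis j 1) =
     (\<Sum>k\<in>UNIV. ((\<lambda>q. comps c (V q) $ k) \<circ> cinv c) (cmap c p) * fd (w k) (cmap c p) (axis j 1)
       + pd c j (\<lambda>q. comps c (V q) $ k) (cmap c p) * w k (cmap c p))"
    unfolding G_def[abs_def]
    by (rule frechet_derivative_sum_mult)
      (rule smooth_on_differentiable[OF sV z], rule smooth_on_differentiable[OF w z])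
  ultimately show ?thesis using cinv_cmap[OF ch subsetD[OF W1c W1(3)]] by simp
qed

lemma vfield_pd:
  assumes V: "smooth_vfield A W V" "p \<in> W" and c: "c \<in> charts A" "p \<in> cdom c" and f: "smooth_near A p f"
  shows "pd c j (\<lambda>q. V q f) (cmap c p) =
    (\<Sum>k\<in>UNIV. comps c (V p) $ k * fd (pd c k f) (cmap c p) (axis j 1)
       + pd c j (\<lambda>q. comps c (V q) $ k) (cmap c p) * pd c k f (cmap c p))"
proof -
  obtain W1 where W1: "open W1" "p \<in> W1" "W1 \<subseteq> cdom c" "smooth_fun A W1 f"
    by (rule smooth_near_chart[OF f c])
  have o: "open (W \<inter> W1)" using W1 V by (auto simp: smooth_vfield_def)
  have fW: "smooth_fun A (W \<inter> W1) f" using smooth_fun_subset[OF W1(4) o] by auto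
  show ?thesis
  proof (rule comps_sum_pd[OF V(1) o _ _ c(1)])
    show "smooth_on (cmap c ` (W \<inter> W1)) (pd c k f)" for k
      by (rule smooth_on_deriv[OF smooth_fun_chart[OF fW c(1)]]) (use W1 in auto)
    show "V q f = (\<Sum>k\<in>UNIV. comps c (V q) $ k * pd c k f (cmap c q))" if "q \<in> W \<inter> W1" for q
      by (rule CT_apply[OF c(1) _ vfield_CT[OF V(1)] smooth_near_smooth_fun[OF fW that]]) (use that W1 in auto)
  qed (use W1 V in auto)
qed

text \<open>The second derivatives of \<open>f\<close> cancel by symmetry, so the bracket is again a
  derivation of first order.\<close>

lemma lie_bracket_coord:
  assumes U: "smooth_vfield A W U" and V: "smooth_vfield A W V" and p: "p \<in> W" and c: "c \<in> charts A" "p \<in> cdom c"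
  shows "lie_bracket A U V p = coord_vec A c p (\<chi> k. \<Sum>j\<in>UNIV.
    comps c (U p) $ j * pd c j (\<lambda>q. comps c (V q) $ k) (cmap c p) - comps c (V p) $ j * pd c j (\<lambda>q. comps c (U q) $ k) (cmap c p))"
proof
  fix f
  show "lie_bracket A U V p f = coord_vec A c p (\<chi> k. \<Sum>j\<in>UNIV.
    comps c (U p) $ j * pd c j (\<lambda>q. comps c (V q) $ k) (cmap c p) - comps c (V p) $ j * pd c j (\<lambda>q. comps c (U q) $ k) (cmap c p)) f"
  proof (cases "smooth_near A p f")
    case True
    let ?z = "cmap c p" and ?u = "\<lambda>j. comps c (U p) $ j" and ?v = "\<lambda>j. comps c (V p) $ j"
    let ?D = "\<lambda>j k. fd (\<lambda>z. pd c k f z) ?z (axis j 1)"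
    let ?dV = "\<lambda>j k. pd c j (\<lambda>q. comps c (V q) $ k) ?z" and ?dU = "\<lambda>j k. pd c j (\<lambda>q. comps c (U q) $ k) ?z"
    obtain W1 where W1: "p \<in> W1" "smooth_on (cmap c ` W1) (f \<circ> cinv c)" by (rule smooth_near_chart[OF True c])
    have sym: "?D j k = ?D k j" for j k
      by (rule second_derivative_symmetric[OF W1(2)]) (use W1 in auto)
    have "lie_bracket A U V p f = (\<Sum>j\<in>UNIV. ?u j * (\<Sum>k\<in>UNIV. ?v k * ?D j k + ?dV j k * pd c k f ?z))
       - (\<Sum>j\<in>UNIV. ?v j * (\<Sum>k\<in>UNIV. ?u k * ?D j k + ?dU j k * pd c k f ?z))"
      unfolding lie_bracket_def
      using True CT_apply[OF c vfield_CT[OF U p] smooth_vfield_near[OF V p True]] CT_apply[OF c vfield_CT[OF V p] smooth_vfield_near[OF U p True]]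
      by (simp add: vfield_pd[OF V p c True] vfield_pd[OF U p c True])
    also have "(\<Sum>j\<in>UNIV. ?u j * (\<Sum>k\<in>UNIV. ?v k * ?D j k + ?dV j k * pd c k f ?z))
       = (\<Sum>j\<in>UNIV. \<Sum>k\<in>UNIV. ?u j * ?v k * ?D j k) + (\<Sum>j\<in>UNIV. \<Sum>k\<in>UNIV. ?u j * ?dV j k * pd c k f ?z)"
      by (simp add: sum_distrib_left sum.distrib distrib_left mult.assoc)
    also have "(\<Sum>j\<in>UNIV. ?v j * (\<Sum>k\<in>UNIV. ?u k * ?D j k + ?dU j k * pd c k f ?z))
       = (\<Sum>j\<in>UNIV. \<Sum>k\<in>UNIV. ?v j * ?u k * ?D j k) + (\<Sum>j\<in>UNIV. \<Sum>k\<in>UNIV. ?v j * ?dU j k * pd c k f ?z)"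
      by (simp add: sum_distrib_left sum.distrib distrib_left mult.assoc)
    also have "(\<Sum>j\<in>UNIV. \<Sum>k\<in>UNIV. ?v j * ?u k * ?D j k) = (\<Sum>j\<in>UNIV. \<Sum>k\<in>UNIV. ?u j * ?v k * ?D j k)"
      by (subst sum.swap) (intro sum.cong refl, subst sym, simp add: mult.commute)
    finally have "lie_bracket A U V p f = (\<Sum>j\<in>UNIV. \<Sum>k\<in>UNIV. (?u j * ?dV j k - ?v j * ?dU j k) * pd c k f ?z)"
      by (simp only: add_diff_cancel_left sum_subtractf left_diff_distrib)
    also have "\<dots> = (\<Sum>k\<in>UNIV. (\<Sum>j\<in>UNIV. ?u j * ?dV j k - ?v j * ?dU j k) * pd c k f ?z)"
      by (subst sum.swap) (simp only: sum_distrib_right)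
    finally show ?thesis using coord_vec_apply[OF True] by simp
  qed (simp add: lie_bracket_def coord_vec_def)
qed

definition form_comp :: "'x oneform \<Rightarrow> ('x, 'm) chart \<Rightarrow> 'm \<Rightarrow> 'x \<Rightarrow> complex" where
  "form_comp \<eta> c k q = \<eta> q (coord_vec A c q (axis k 1))"

lemma smooth_form_comp:
  "smooth_oneform A \<eta> \<Longrightarrow> c \<in> charts A \<Longrightarrow> smooth_fun A (cdom c) (form_comp \<eta> c k)"
  unfolding form_comp_def[abs_def] using smooth_coord_field unfolding smooth_oneform_def by blast

lemma form_coord:
  assumes "smooth_oneform A \<eta>" "c \<in> charts A" "p \<in> cdom c" "v \<in> CT A p"
  shows "\<eta> p v = (\<Sum>k\<in>UNIV. comps c v $ k * form_comp \<eta> c k p)"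
proof -
  have "\<eta> p \<in> CTdual A p" using assms(1) by (simp add: smooth_oneform_def)
  from covector_coord[OF assms(2,3) this, of "comps c v"] show ?thesis
    using CT_comps[OF assms(2-4)] by (simp add: form_comp_def)
qed

lemma vfield_form_pd:
  assumes \<eta>: "smooth_oneform A \<eta>" and U: "smooth_vfield A W U" and V: "smooth_vfield A W V" and p: "p \<in> W"
    and c: "c \<in> charts A" "p \<in> cdom c"
  shows "U p (\<lambda>q. \<eta> q (V q)) = (\<Sum>j\<in>UNIV. comps c (U p) $ j * (\<Sum>k\<in>UNIV.
     comps c (V p) $ k * pd c j (form_comp \<eta> c k) (cmap c p) + pd c j (\<lambda>q. comps c (V q) $ k) (cmap c p) * form_comp \<eta> c k p))"
proof -
  have ch: "is_chart c" by (rule charts_is_chart[OF c(1)])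
  have o: "open (W \<inter> cdom c)" using U chart_open[OF ch] by (auto simp: smooth_vfield_def)
  have sm: "smooth_fun A W (\<lambda>q. \<eta> q (V q))" using \<eta> V by (auto simp: smooth_oneform_def)
  have "pd c j (\<lambda>q. \<eta> q (V q)) (cmap c p) = (\<Sum>k\<in>UNIV. comps c (V p) $ k * pd c j (form_comp \<eta> c k) (cmap c p)
     + pd c j (\<lambda>q. comps c (V q) $ k) (cmap c p) * (form_comp \<eta> c k \<circ> cinv c) (cmap c p))" for j
  proof (rule comps_sum_pd[OF V o _ _ c(1)])
    show "smooth_on (cmap c ` (W \<inter> cdom c)) (form_comp \<eta> c k \<circ> cinv c)" for k
      by (rule smooth_fun_chart[OF smooth_fun_subset[OF smooth_form_comp[OF \<eta> c(1)] o] c(1)]) auto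
    show "\<eta> q (V q) = (\<Sum>k\<in>UNIV. comps c (V q) $ k * (form_comp \<eta> c k \<circ> cinv c) (cmap c q))" if "q \<in> W \<inter> cdom c" for q
      using form_coord[OF \<eta> c(1) _ vfield_CT[OF V], of q] cinv_cmap[OF ch, of q] that by simp
  qed (use p c in auto)
  then show ?thesis
    using CT_apply[OF c vfield_CT[OF U p] smooth_near_smooth_fun[OF sm p]] cinv_cmap[OF ch c(2)] by simp
qed

lemma lie_bracket_CT:
  assumes "smooth_vfield A W U" "smooth_vfield A W V" "p \<in> W"
  shows "lie_bracket A U V p \<in> CT A p"
proof -
  obtain a where a: "a \<in> A" "p \<in> cdom a" using exists_chart by blast
  show ?thesis using lie_bracket_coord[OF assms atlas_charts[OF a(1)] a(2)] CT_coord[OF atlas_charts[OF a(1)] a(2)] by auto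
qed

text \<open>The defining expression contains derivatives of the two fields, which cancel in
  coordinates. What remains depends on the values at \<open>p\<close> only; this is what makes the
  definite description in \<open>ext_deriv\<close> meaningful, and it shows that the Levi form of
  smooth fields is continuous.\<close>

theorem ext_deriv_coord:
  assumes \<eta>: "smooth_oneform A \<eta>" and U: "smooth_vfield A W U" and V: "smooth_vfield A W V" and p: "p \<in> W"
    and c: "c \<in> charts A" "p \<in> cdom c"
  shows "ext_deriv A \<eta> p (U p) (V p) = (\<Sum>j\<in>UNIV. \<Sum>k\<in>UNIV.
     (comps c (U p) $ j * comps c (V p) $ k - comps c (V p) $ j * comps c (U p) $ k) * pd c j (form_comp \<eta> c k) (cmap c p))"
proof -
  have main: "U' p (\<lambda>q. \<eta> q (V' q)) - V' p (\<lambda>q. \<eta> q (U' q)) - \<eta> p (lie_bracket A U' V' p) = (\<Sum>j\<in>UNIV. \<Sum>k\<in>UNIV.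
     (comps c (U' p) $ j * comps c (V' p) $ k - comps c (V' p) $ j * comps c (U' p) $ k) * pd c j (form_comp \<eta> c k) (cmap c p))"
    if U': "smooth_vfield A W' U'" and V': "smooth_vfield A W' V'" and p': "p \<in> W'" for W' U' V'
  proof -
    let ?z = "cmap c p" and ?u = "\<lambda>j. comps c (U' p) $ j" and ?v = "\<lambda>j. comps c (V' p) $ j"
    let ?w = "\<lambda>j k. pd c j (form_comp \<eta> c k) ?z" and ?o = "\<lambda>k. form_comp \<eta> c k p"
    let ?dV = "\<lambda>j k. pd c j (\<lambda>q. comps c (V' q) $ k) ?z" and ?dU = "\<lambda>j k. pd c j (\<lambda>q. comps c (U' q) $ k) ?z"
    have "\<eta> p (lie_bracket A U' V' p) = (\<Sum>k\<in>UNIV. (\<Sum>j\<in>UNIV. ?u j * ?dV j k - ?v j * ?dU j k) * ?o k)"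
      using form_coord[OF \<eta> c lie_bracket_CT[OF U' V' p']] unfolding lie_bracket_coord[OF U' V' p' c] comps_coord_vec[OF c] by simp
    also have "\<dots> = (\<Sum>j\<in>UNIV. \<Sum>k\<in>UNIV. (?u j * ?dV j k - ?v j * ?dU j k) * ?o k)"
      unfolding sum_distrib_right by (rule sum.swap)
    finally have br: "\<eta> p (lie_bracket A U' V' p) = (\<Sum>j\<in>UNIV. \<Sum>k\<in>UNIV. (?u j * ?dV j k - ?v j * ?dU j k) * ?o k)" .
    show ?thesis
      unfolding br vfield_form_pd[OF \<eta> U' V' p' c] vfield_form_pd[OF \<eta> V' U' p' c] sum_distrib_left sum_subtractf[symmetric]
      by (intro sum.cong refl) (simp add: algebra_simps)
  qed
  show ?thesis
    unfolding ext_deriv_def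
  proof (rule the_equality)
    show "\<forall>W' U' V'. p \<in> W' \<longrightarrow> smooth_vfield A W' U' \<longrightarrow> smooth_vfield A W' V' \<longrightarrow> U' p = U p \<longrightarrow> V' p = V p \<longrightarrow>
      (\<Sum>j\<in>UNIV. \<Sum>k\<in>UNIV. (comps c (U p) $ j * comps c (V p) $ k - comps c (V p) $ j * comps c (U p) $ k) * pd c j (form_comp \<eta> c k) (cmap c p))
      = U' p (\<lambda>q. \<eta> q (V' q)) - V' p (\<lambda>q. \<eta> q (U' q)) - \<eta> p (lie_bracket A U' V' p)"
    proof (intro allI impI)
      fix W' U' V' assume p': "p \<in> W'" and s: "smooth_vfield A W' U'" "smooth_vfield A W' V'" and e: "U' p = U p" "V' p = V p"
      show "(\<Sum>j\<in>UNIV. \<Sum>k\<in>UNIV. (comps c (U p) $ j * comps c (V p) $ k - comps c (V p) $ j * comps c (U p) $ k) * pd c j (form_comp \<eta> c k) (cmap c p))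
        = U' p (\<lambda>q. \<eta> q (V' q)) - V' p (\<lambda>q. \<eta> q (U' q)) - \<eta> p (lie_bracket A U' V' p)"
        using main[OF s p'] unfolding e by (rule sym)
    qed
    fix z assume "\<forall>W' U' V'. p \<in> W' \<longrightarrow> smooth_vfield A W' U' \<longrightarrow> smooth_vfield A W' V' \<longrightarrow> U' p = U p \<longrightarrow> V' p = V p \<longrightarrow>
      z = U' p (\<lambda>q. \<eta> q (V' q)) - V' p (\<lambda>q. \<eta> q (U' q)) - \<eta> p (lie_bracket A U' V' p)"
    then show "z = (\<Sum>j\<in>UNIV. \<Sum>k\<in>UNIV. (comps c (U p) $ j * comps c (V p) $ k - comps c (V p) $ j * comps c (U p) $ k) * pd c j (form_comp \<eta> c k) (cmap c p))"
    proof -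
      assume a: "\<forall>W' U' V'. p \<in> W' \<longrightarrow> smooth_vfield A W' U' \<longrightarrow> smooth_vfield A W' V' \<longrightarrow> U' p = U p \<longrightarrow> V' p = V p \<longrightarrow>
        z = U' p (\<lambda>q. \<eta> q (V' q)) - V' p (\<lambda>q. \<eta> q (U' q)) - \<eta> p (lie_bracket A U' V' p)"
      show ?thesis by (rule trans[OF a[rule_format, OF p U V refl refl] main[OF U V p]])
    qed
  qed
qed

end

section \<open>The Gram determinant of the Levi metric\<close>

lemma det_cnj: "det (\<chi> i j. cnj (M $ i $ j)) = cnj (det (M :: complex ^ 'm ^ 'm::finite))"
  by (simp add: det_def)

lemma continuous_on_det:
  fixes M :: "'a::topological_space \<Rightarrow> complex ^ 'm ^ 'm::finite"
  assumes "\<And>i j. continuous_on S (\<lambda>x. M x $ i $ j)"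
  shows "continuous_on S (\<lambda>x. det (M x))"
  unfolding det_def by (intro continuous_intros assms)

lemma det_eq_0_left_kernel:
  fixes M :: "complex ^ 'm ^ 'm::finite"
  assumes "det M = 0"
  shows "\<exists>x. x \<noteq> 0 \<and> (\<forall>l. (\<Sum>k\<in>UNIV. x $ k * M $ k $ l) = 0)"
proof -
  have "\<not> invertible (transpose M)" using assms by (simp add: invertible_det_nz)
  then obtain x where x: "transpose M *v x = 0" "x \<noteq> 0"
    using matrix_left_invertible_ker[of "transpose M"] invertible_left_inverse by blast
  have "(\<Sum>k\<in>UNIV. x $ k * M $ k $ l) = (transpose M *v x) $ l" for l
    by (simp add: matrix_vector_mult_def transpose_def mult.commute)
  then show ?thesis using x by auto
qed

lemma hermitian_det_real:
  fixes M :: "complex ^ 'm ^ 'm::finite"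
  assumes "\<And>k l. M $ l $ k = cnj (M $ k $ l)"
  shows "Im (det M) = 0"
proof -
  have "(\<chi> i j. cnj (M $ i $ j)) = transpose M" by (simp add: vec_eq_iff transpose_def assms[symmetric])
  then have "cnj (det M) = det M" using det_cnj[of M] by (simp add: det_transpose)
  from arg_cong[OF this, of Im] show ?thesis unfolding cnj.simps(2) by linarith
qed

text \<open>Along the segment from the identity to \<open>M\<close> all matrices are Hermitian and
  positive definite, hence have real and non-zero determinant; the determinant cannot change its
  sign.\<close>

lemma positive_definite_det_pos:
  fixes M :: "complex ^ 'm ^ 'm::finite"
  assumes herm: "\<And>k l. M $ l $ k = cnj (M $ k $ l)"
    and pos: "\<And>x. x \<noteq> 0 \<Longrightarrow> 0 < Re (\<Sum>k\<in>UNIV. \<Sum>l\<in>UNIV. x $ k * cnj (x $ l) * M $ k $ l)"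
  shows "0 < Re (det M)"
proof (rule ccontr)
  assume neg: "\<not> 0 < Re (det M)"
  \<comment> \<open>the segment from the identity (\<open>t = 0\<close>) to \<open>M\<close> (\<open>t = 1\<close>)\<close>
  define P where "P t = (\<chi> k l. of_real t * M $ k $ l + of_real (1 - t) * (if k = l then 1 else 0))" for t
  have P1: "P 1 = M" and P0: "P 0 = mat 1" by (simp_all add: P_def vec_eq_iff mat_def)
  have cont: "continuous_on {0..1} (\<lambda>t. Re (det (P t)))"
    unfolding P_def by (intro continuous_intros continuous_on_det)
  have "\<exists>t\<ge>0. t \<le> 1 \<and> Re (det (P t)) = 0"
    by (rule IVT2'[OF _ _ _ cont]) (use neg in \<open>simp_all add: P0 P1\<close>)
  then obtain t where t: "0 \<le> t" "t \<le> 1" "Re (det (P t)) = 0" by blast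
  have hP: "P t $ l $ k = cnj (P t $ k $ l)" for k l using herm[of l k] by (simp add: P_def)
  have detP: "det (P t) = 0" using t(3) hermitian_det_real[of "P t", OF hP] by (simp add: complex_eq_iff)
  obtain x where x: "x \<noteq> 0" "\<And>l. (\<Sum>k\<in>UNIV. x $ k * P t $ k $ l) = 0" using det_eq_0_left_kernel[OF detP] by blast
  have "(\<Sum>k\<in>UNIV. \<Sum>l\<in>UNIV. x $ k * cnj (x $ l) * P t $ k $ l) = (\<Sum>l\<in>UNIV. cnj (x $ l) * (\<Sum>k\<in>UNIV. x $ k * P t $ k $ l))"
    by (subst sum.swap) (simp add: sum_distrib_left mult_ac)
  then have 0: "(\<Sum>k\<in>UNIV. \<Sum>l\<in>UNIV. x $ k * cnj (x $ l) * P t $ k $ l) = 0" using x by simp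
  have "(\<Sum>k\<in>UNIV. \<Sum>l\<in>UNIV. x $ k * cnj (x $ l) * P t $ k $ l)
      = of_real t * (\<Sum>k\<in>UNIV. \<Sum>l\<in>UNIV. x $ k * cnj (x $ l) * M $ k $ l) + of_real (1 - t) * (\<Sum>k\<in>UNIV. x $ k * cnj (x $ k))"
  proof -
    have "x $ k * cnj (x $ l) * P t $ k $ l = of_real t * (x $ k * cnj (x $ l) * M $ k $ l) + (if k = l then of_real (1 - t) * (x $ k * cnj (x $ k)) else 0)" for k l
      by (auto simp: P_def algebra_simps)
    then show ?thesis by (simp add: sum.distrib sum.delta' sum_distrib_left cong: if_cong)
  qed
  then have "Re 0 = Re (of_real t * (\<Sum>k\<in>UNIV. \<Sum>l\<in>UNIV. x $ k * cnj (x $ l) * M $ k $ l) + of_real (1 - t) * (\<Sum>k\<in>UNIV. x $ k * cnj (x $ k)))"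
    using 0 by (simp only:)
  moreover have "Re (\<Sum>k\<in>UNIV. x $ k * cnj (x $ k)) = (\<Sum>k\<in>UNIV. (norm (x $ k))\<^sup>2)"
    by (simp add: complex_mult_cnj cmod_power2)
  ultimately have "0 = t * Re (\<Sum>k\<in>UNIV. \<Sum>l\<in>UNIV. x $ k * cnj (x $ l) * M $ k $ l) + (1 - t) * (\<Sum>k\<in>UNIV. (norm (x $ k))\<^sup>2)"
    by (simp only: plus_complex.sel times_complex.sel Re_complex_of_real Im_complex_of_real zero_complex.sel mult_zero_left diff_0_right)
  moreover have "0 < (\<Sum>k\<in>UNIV. (norm (x $ k))\<^sup>2)"
  proof -
    obtain k where "x $ k \<noteq> 0" using x(1) by (auto simp: vec_eq_iff)
    then show ?thesis by (intro sum_pos2[of _ k]) auto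
  qed
  moreover note pos[OF x(1)]
  ultimately show False using t(1,2) 
    by (smt (verit, best) mult_nonneg_nonneg mult_pos_pos)
qed

lemma sum_lessThan_add: "(\<Sum>r<a + b. f r) = (\<Sum>r<a. f r) + (\<Sum>r<b. f (a + r :: nat))"
  by (induction b) (auto simp: add.assoc)

locale levi_manifold = smooth_manifold A
  for A :: "('x::t2_space, 'm::finite) chart set" +
  fixes n :: nat and T10 :: "'x \<Rightarrow> 'x tvec set" and \<omega> :: "'x oneform" and T :: "'x vfield" and h :: "'x metric"
  assumes n: "n \<ge> 1" and dim: "CARD('m) = 2 * n + 1"
    and cr: "cr_structure A n T10" and contact: "contact_form A T10 \<omega>" and reeb: "reeb_field A \<omega> T"
    and levi: "levi_metric A T10 \<omega> T h"
begin

lemma omega_smooth: "smooth_oneform A \<omega>" using contact by (simp add: contact_form_def)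

lemma T_smooth: "smooth_vfield A UNIV T" using reeb by (simp add: reeb_field_def)

lemma T_CT: "T p \<in> CT A p" using vfield_CT[OF T_smooth] by simp

lemma metric_linear:
  "u \<in> CT A p \<Longrightarrow> v \<in> CT A p \<Longrightarrow> w \<in> CT A p \<Longrightarrow> h p (vcomb a u b v) w = a * h p u w + b * h p v w"
  and metric_sym: "u \<in> CT A p \<Longrightarrow> v \<in> CT A p \<Longrightarrow> h p v u = cnj (h p u v)"
  and metric_pos: "u \<in> CT A p \<Longrightarrow> u \<noteq> (\<lambda>f. 0) \<Longrightarrow> 0 < Re (h p u u)"
  using levi unfolding levi_metric_def hermitian_metric_def by blast+

lemma metric_coord:
  assumes c: "c \<in> charts A" "p \<in> cdom c"
  shows "h p (coord_vec A c p x) (coord_vec A c p y)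
    = (\<Sum>k\<in>UNIV. \<Sum>l\<in>UNIV. x $ k * cnj (y $ l) * h p (coord_vec A c p (axis k 1)) (coord_vec A c p (axis l 1)))"
proof -
  have CT: "coord_vec A c p a \<in> CT A p" for a using CT_coord[OF c] by auto
  have 1: "h p (coord_vec A c p x) w = (\<Sum>k\<in>UNIV. x $ k * h p (coord_vec A c p (axis k 1)) w)" if "w \<in> CT A p" for w x
    by (rule linear_coord_expansion) (use that in \<open>simp add: metric_linear CT flip: vcomb_coord_vec\<close>)
  have 2: "h p u (coord_vec A c p y) = (\<Sum>l\<in>UNIV. cnj (y $ l) * h p u (coord_vec A c p (axis l 1)))" if "u \<in> CT A p" for u
  proof -
    have "h p u (coord_vec A c p y) = cnj (h p (coord_vec A c p y) u)" by (rule metric_sym[OF CT that])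
    also have "\<dots> = (\<Sum>l\<in>UNIV. cnj (y $ l) * cnj (h p (coord_vec A c p (axis l 1)) u))" unfolding 1[OF that, of y] by simp
    also have "\<dots> = (\<Sum>l\<in>UNIV. cnj (y $ l) * h p u (coord_vec A c p (axis l 1)))" by (intro sum.cong refl) (subst metric_sym[OF CT that], rule refl)
    finally show ?thesis .
  qed
  show ?thesis unfolding 1[OF CT, of x y] sum_distrib_left[symmetric] mult.assoc
    by (intro sum.cong refl arg_cong2[of _ _ _ _ "(*)"] 2[OF CT])
qed

lemma gram_det_pos:
  assumes c: "c \<in> charts A" "p \<in> cdom c"
  shows "0 < Re (gram_det A h c p)"
  unfolding gram_det_def
proof (rule positive_definite_det_pos)
  have CT: "coord_vec A c p a \<in> CT A p" for a using CT_coord[OF c] by auto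
  show "(\<chi> j k. h p (coord_vec A c p (axis j 1)) (coord_vec A c p (axis k 1))) $ l $ k
      = cnj ((\<chi> j k. h p (coord_vec A c p (axis j 1)) (coord_vec A c p (axis k 1))) $ k $ l)" for k l
    by simp (rule metric_sym[OF CT CT])
  fix x :: "complex ^ 'm" assume x: "x \<noteq> 0"
  have "coord_vec A c p x \<noteq> (\<lambda>f. 0)"
  proof
    assume "coord_vec A c p x = (\<lambda>f. 0)"
    then have "x = comps c (\<lambda>f. 0)" using comps_coord_vec[OF c, of x] by simp
    then show False using x by (simp add: comps_def zero_vec_def)
  qed
  from metric_pos[OF CT this, unfolded metric_coord[OF c, of x x]] show "0 < Re (\<Sum>k\<in>UNIV. \<Sum>l\<in>UNIV. x $ k * cnj (x $ l) * (\<chi> j k. h p (coord_vec A c p (axis j 1)) (coord_vec A c p (axis k 1))) $ k $ l)"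
    by simp
qed

lemma omega_T10: "v \<in> T10 p \<Longrightarrow> \<omega> p v = 0" "v \<in> T10 p \<Longrightarrow> \<omega> p (vconj v) = 0"
  using contact by (auto simp: contact_form_def)

lemma metric_T10:
  assumes "u \<in> T10 p" "v \<in> T10 p"
  shows "h p u v = levi_form A \<omega> p u v" "h p (vconj u) (vconj v) = cnj (h p u v)" "h p u (vconj v) = 0"
  using levi assms by (auto simp: levi_metric_def)

lemma metric_T:
  shows "u \<in> T10 p \<Longrightarrow> h p (T p) u = 0" "u \<in> T10 p \<Longrightarrow> h p (T p) (vconj u) = 0" "h p (T p) (T p) = 1"
  using levi by (auto simp: levi_metric_def)

text \<open>Near a point take the frame formed by a local frame \<open>Z\<close> of the CR bundle,
  its conjugate, and \<open>T\<close>. If \<open>B\<close> is the matrix of its coordinates, its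
  Gram matrix is \<open>H = B G B\<^sup>*\<close> with \<open>G\<close> the Gram matrix of the
  coordinate fields, so \<open>det G = det H / \<bar>det B\<bar>\<^sup>2\<close>. The entries of
  \<open>H\<close> are constants, values of the Levi form, or their conjugates, hence
  continuous.\<close>

theorem continuous_gram_det:
  assumes c: "c \<in> charts A" shows "continuous_on (cdom c) (gram_det A h c)"
proof (rule continuous_at_imp_continuous_on, rule ballI)
  fix p0 assume p0: "p0 \<in> cdom c"
  have ch: "is_chart c" by (rule charts_is_chart[OF c])
  have "\<exists>U Z. p0 \<in> U \<and> (\<forall>i<n. smooth_vfield A U (\<lambda>q. Z q i)) \<and>
        (\<forall>q\<in>U. T10 q = {vsum n a (Z q) | a. True} \<and>
           (\<forall>a. vsum n a (Z q) = (\<lambda>f. 0) \<longrightarrow> (\<forall>i<n. a i = 0)))"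
    using cr unfolding cr_structure_def by (elim conjE) (erule spec)
  then obtain U Z where U: "p0 \<in> U" and UZ: "(\<forall>i<n. smooth_vfield A U (\<lambda>q. Z q i)) \<and>
        (\<forall>q\<in>U. T10 q = {vsum n a (Z q) | a. True} \<and>
           (\<forall>a. vsum n a (Z q) = (\<lambda>f. 0) \<longrightarrow> (\<forall>i<n. a i = 0)))"
    by (elim exE conjE) (rule that, assumption, intro conjI)
  have Z: "smooth_vfield A U (\<lambda>q. Z q i)" if "i < n" for i using UZ that by simp
  have span: "T10 q = {vsum n a (Z q) | a. True}" if "q \<in> U" for q using UZ that by simp
  have indep: "a i = 0" if "q \<in> U" "vsum n a (Z q) = (\<lambda>f. 0)" "i < n" for q a i using UZ that by simp
  \<comment> \<open>the CR bundle meets its conjugate in \<open>0\<close>; used for the independence of the frame\<close>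
  have disj: "T10 q \<inter> vconj ` T10 q = {\<lambda>f. 0}" for q using cr by (simp add: cr_structure_def)
  \<comment> \<open>the frame, numbered \<open>0..n-1\<close>, \<open>n..2n-1\<close> and \<open>2n\<close>; \<open>e\<close> transfers the numbering to the index type\<close>
  define F' where "F' q r = (if r < n then Z q r else if r < n + n then vconj (Z q (r - n)) else T q)" for q r
  obtain e where e: "bij_betw e (UNIV :: 'm set) {..<2 * n + 1}"
    using ex_bij_betw_finite_nat[of "UNIV :: 'm set"] dim by (auto simp: atLeast0LessThan)
  have er: "e i < n + n + 1" for i using bij_betwE[OF e] by (simp add: mult_2)
  define F where "F q i = F' q (e i)" for q i
  have oU: "open U"
    using Z[of 0] n by (simp add: smooth_vfield_def)
  let ?W = "U \<inter> cdom c"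
  have oW: "open ?W" using oU chart_open[OF ch] by auto
  have ZT: "Z q i \<in> T10 q" if "q \<in> U" "i < n" for q i
  proof -
    have "vsum n (\<lambda>j. if j = i then 1 else 0) (Z q) = Z q i"
    proof
      fix f
      have "vsum n (\<lambda>j. if j = i then 1 else 0) (Z q) f = (\<Sum>j<n. if j = i then Z q j f else 0)"
        unfolding vsum_def by (intro sum.cong) auto
      then show "vsum n (\<lambda>j. if j = i then 1 else 0) (Z q) f = Z q i f" using that by (simp add: sum.delta)
    qed
    then show ?thesis unfolding span[OF that(1)] mem_Collect_eq by (metis (lifting))
  qed
  have F'sm: "smooth_vfield A ?W (\<lambda>q. F' q r)" for r
  proof -
    consider "r < n" | "\<not> r < n" "r < n + n" | "\<not> r < n + n" by linarith
    then show ?thesis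
    proof cases
      case 1
      then have "(\<lambda>q. F' q r) = (\<lambda>q. Z q r)" by (simp add: F'_def)
      then show ?thesis using smooth_vfield_subset[OF Z[OF 1] oW] by simp
    next
      case 2
      then have "(\<lambda>q. F' q r) = (\<lambda>q. vconj (Z q (r - n)))" by (simp add: F'_def)
      then show ?thesis using smooth_vfield_subset[OF smooth_vconj[OF Z] oW, of "r - n"] 2 by simp
    next
      case 3
      then have "(\<lambda>q. F' q r) = T" by (auto simp: F'_def)
      then show ?thesis using smooth_vfield_subset[OF T_smooth oW] by simp
    qed
  qed
  define B where "B q = (\<chi> i k. comps c (F q i) $ k)" for q
  have Bc: "continuous_on ?W (\<lambda>q. B q $ i $ k)" for i k
    using smooth_fun_continuous[OF smooth_comps[OF F'sm c] c, of "e i" k] by (simp add: B_def F_def)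
  have F'CT: "F' q r \<in> CT A q" if "q \<in> ?W" for q r using vfield_CT[OF F'sm that] .
  define H where "H q = (\<chi> i l. h q (F q i) (F q l))" for q
  have levic: "continuous_on ?W (\<lambda>q. h q (Z q i) (Z q j))" if "i < n" "j < n" for i j
  proof -
    have s1: "smooth_vfield A ?W (\<lambda>q. Z q i)" using smooth_vfield_subset[OF Z[OF that(1)] oW] by simp
    have s2: "smooth_vfield A ?W (\<lambda>q. vconj (Z q j))" using smooth_vfield_subset[OF smooth_vconj[OF Z[OF that(2)]] oW] by simp
    have c1: "continuous_on ?W (\<lambda>q. comps c (Z q i) $ k)" "continuous_on ?W (\<lambda>q. comps c (vconj (Z q j)) $ k)" for k
      using smooth_fun_continuous[OF smooth_comps[OF s1 c] c, of k] smooth_fun_continuous[OF smooth_comps[OF s2 c] c, of k] by auto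
    have "continuous_on ?W (\<lambda>q. - (1 / (2 * \<i>)) * (\<Sum>a\<in>UNIV. \<Sum>b\<in>UNIV.
       (comps c (Z q i) $ a * comps c (vconj (Z q j)) $ b - comps c (vconj (Z q j)) $ a * comps c (Z q i) $ b) * pd c a (form_comp \<omega> c b) (cmap c q)))"
      using smooth_fun_pd_continuous[OF smooth_fun_subset[OF smooth_form_comp[OF omega_smooth c] oW] c]
      by (intro continuous_intros c1) auto
    then show ?thesis
    proof (rule continuous_on_eq)
      fix q assume q: "q \<in> ?W"
      then have "h q (Z q i) (Z q j) = levi_form A \<omega> q (Z q i) (Z q j)" using metric_T10(1) ZT that by blast
      then show "- (1 / (2 * \<i>)) * (\<Sum>a\<in>UNIV. \<Sum>b\<in>UNIV.
       (comps c (Z q i) $ a * comps c (vconj (Z q j)) $ b - comps c (vconj (Z q j)) $ a * comps c (Z q i) $ b) * pd c a (form_comp \<omega> c b) (cmap c q))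
         = h q (Z q i) (Z q j)"
        unfolding levi_form_def using ext_deriv_coord[OF omega_smooth s1 s2 q c] q by simp
    qed
  qed
  have half: "h q (F' q s) (F' q r) = 0" if q: "q \<in> ?W" and rs: "r < n \<and> \<not> s < n \<or> r < n + n \<and> \<not> s < n + n" for q r s
  proof (cases "s < n + n")
    case True
    with rs have rs: "r < n" "\<not> s < n" "s - n < n" by auto
    have "h q (Z q r) (vconj (Z q (s - n))) = 0" using metric_T10(3) ZT q rs by auto
    then have "h q (F' q r) (F' q s) = 0" using rs True by (simp add: F'_def)
    then show ?thesis using metric_sym[OF F'CT[OF q] F'CT[OF q], of r s] by simp
  next
    case False
    then show ?thesis using rs metric_T(1,2)[OF ZT, of q] q by (auto simp: F'_def)
  qed
  have H'c: "continuous_on ?W (\<lambda>q. h q (F' q r) (F' q s))" for r s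
  proof (cases "(r < n) = (s < n) \<and> (r < n + n) = (s < n + n)")
    case True
    then consider "r < n" "s < n" | "\<not> r < n" "r < n + n" "\<not> s < n" "s < n + n" | "\<not> r < n + n" "\<not> s < n + n" by auto
    then show ?thesis
    proof cases
      case 1 then show ?thesis using levic[of r s] by (simp add: F'_def)
    next
      case 2
      then have "cnj (h q (Z q (r - n)) (Z q (s - n))) = h q (F' q r) (F' q s)" if "q \<in> ?W" for q
        using metric_T10(2)[OF ZT ZT, of q "r - n" "s - n"] that by (simp add: F'_def)
      moreover have "continuous_on ?W (\<lambda>q. cnj (h q (Z q (r - n)) (Z q (s - n))))"
        by (rule continuous_on_cnj[OF levic]) (use 2 in auto)
      ultimately show ?thesis by (rule continuous_on_eq[rotated])
    next
      case 3 then show ?thesis using metric_T(3) by (simp add: F'_def)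
    qed
  next
    case False
    have "h q (F' q r) (F' q s) = 0" if q: "q \<in> ?W" for q
      using False half[OF q, of r s] half[OF q, of s r] metric_sym[OF F'CT[OF q] F'CT[OF q], of s r] by auto
    then show ?thesis by (intro continuous_on_eq[OF continuous_on_const[of _ 0]]) auto
  qed
  have Hc: "continuous_on ?W (\<lambda>q. H q $ i $ l)" for i l using H'c[of "e i" "e l"] by (simp add: H_def F_def)
  have HG: "det (H q) = det (B q) * gram_det A h c q * cnj (det (B q))" if q: "q \<in> ?W" for q
  proof -
    let ?G = "\<chi> j k. h q (coord_vec A c q (axis j 1)) (coord_vec A c q (axis k 1))"
    let ?Bs = "\<chi> m l. cnj (B q $ l $ m)"
    have qc: "q \<in> cdom c" using q by simp
    have "H q $ i $ l = (B q ** ?G ** ?Bs) $ i $ l" for i l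
    proof -
      have "F q i = coord_vec A c q (B q $ i)" for i
      proof -
        have "B q $ i = comps c (F' q (e i))" by (simp add: F_def B_def vec_eq_iff)
        then show ?thesis using CT_comps[OF c qc F'CT[OF q], of "e i"] unfolding F_def by metis
      qed
      then have "H q $ i $ l = (\<Sum>k\<in>UNIV. \<Sum>m\<in>UNIV. B q $ i $ k * cnj (B q $ l $ m) * ?G $ k $ m)"
        by (simp add: H_def metric_coord[OF c qc, of "B q $ i" "B q $ l"])
      also have "\<dots> = (\<Sum>m\<in>UNIV. (\<Sum>k\<in>UNIV. B q $ i $ k * ?G $ k $ m) * cnj (B q $ l $ m))"
        by (subst sum.swap) (simp add: sum_distrib_right sum_distrib_left mult_ac)
      finally show ?thesis by (simp add: matrix_matrix_mult_def)
    qed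
    then have "H q = B q ** ?G ** ?Bs" by (simp add: vec_eq_iff)
    moreover have "det ?Bs = cnj (det (B q))"
      using det_cnj[of "transpose (B q)"] by (simp add: det_transpose) (simp add: transpose_def)
    ultimately show ?thesis by (simp add: det_mul gram_det_def)
  qed
  have Bnz: "det (B q) \<noteq> 0" if q: "q \<in> ?W" for q
  proof
    assume detB: "det (B q) = 0"
    obtain x where x: "x \<noteq> 0" "\<And>k. (\<Sum>i\<in>UNIV. x $ i * B q $ i $ k) = 0" using det_eq_0_left_kernel[OF detB] by blast
    have qc: "q \<in> cdom c" and qU: "q \<in> U" using q by auto
    define y where "y r = x $ (inv_into UNIV e r)" for r
    have ye: "y (e i) = x $ i" for i using e by (simp add: y_def bij_betw_def)
    have re: "(\<Sum>i\<in>UNIV. x $ i * g (e i)) = (\<Sum>r<n. y r * g r) + (\<Sum>r<n. y (n + r) * g (n + r)) + y (n + n) * g (n + n)" for g :: "nat \<Rightarrow> complex"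
    proof -
      have "(\<Sum>i\<in>UNIV. x $ i * g (e i)) = (\<Sum>i\<in>UNIV. y (e i) * g (e i))" by (simp add: ye)
      also have "\<dots> = (\<Sum>r<2 * n + 1. y r * g r)" by (rule sum.reindex_bij_betw[OF e])
      also have "\<dots> = (\<Sum>r<n + n + 1. y r * g r)" by (simp add: mult_2)
      finally show ?thesis by (simp add: sum_lessThan_add[of "\<lambda>r. y r * g r" n n])
    qed
    have lin: "(\<Sum>i\<in>UNIV. x $ i * (\<Sum>k\<in>UNIV. comps c (F q i) $ k * w k)) = 0" for w
    proof -
      have "(\<Sum>i\<in>UNIV. x $ i * (\<Sum>k\<in>UNIV. comps c (F q i) $ k * w k)) = (\<Sum>k\<in>UNIV. (\<Sum>i\<in>UNIV. x $ i * B q $ i $ k) * w k)"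
        unfolding sum_distrib_left sum_distrib_right by (subst sum.swap) (simp add: B_def mult.assoc)
      then show ?thesis using x(2) by simp
    qed
    \<comment> \<open>the contact form sees only the \<open>T\<close> component of a relation between frame vectors\<close>
    have "(\<Sum>i\<in>UNIV. x $ i * \<omega> q (F' q (e i))) = 0"
      using lin[of "\<lambda>k. form_comp \<omega> c k q"] form_coord[OF omega_smooth c qc F'CT[OF q]] by (simp add: F_def)
    then have "y (n + n) * \<omega> q (T q) = 0"
      unfolding re[of "\<lambda>r. \<omega> q (F' q r)"] using omega_T10[OF ZT[OF qU]] by (simp add: F'_def)
    moreover have "\<omega> q (T q) = - 1" using reeb by (simp add: reeb_field_def)
    ultimately have yT: "y (n + n) = 0" by simp
    have vec0: "(\<Sum>r<n. y r * Z q r f) + (\<Sum>r<n. y (n + r) * vconj (Z q r) f) = 0" for f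
    proof (cases "smooth_near A q f")
      case True
      have "(\<Sum>i\<in>UNIV. x $ i * F' q (e i) f) = 0"
        using lin[of "\<lambda>k. pd c k f (cmap c q)"] CT_apply[OF c qc F'CT[OF q] True] by (simp add: F_def)
      then show ?thesis unfolding re[of "\<lambda>r. F' q r f"] using yT by (simp add: F'_def)
    next
      case False
      have z: "v f = 0" if "v \<in> CT A q" for v using that False by (auto simp: CT_def coord_vec_def)
      have "Z q r f = 0" "vconj (Z q r) f = 0" if "r < n" for r
        using z vfield_CT[OF Z[OF that] qU] vconj_CT by auto
      then show ?thesis by simp
    qed
    \<comment> \<open>the relation now says that a vector of the CR bundle equals the conjugate of another one\<close>
    define u where "u = vsum n y (Z q)"
    define w where "w = vsum n (\<lambda>r. - cnj (y (n + r))) (Z q)"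
    have "u = vconj w"
    proof
      fix f show "u f = vconj w f" using vec0[of f] by (simp add: u_def w_def vsum_def vconj_def sum_negf eq_neg_iff_add_eq_0)
    qed
    moreover have "u \<in> T10 q" "w \<in> T10 q" using span[OF qU] by (auto simp: u_def w_def)
    ultimately have "u \<in> T10 q \<inter> vconj ` T10 q" by blast
    then have u0: "u = (\<lambda>f. 0)" using disj[of q] by blast
    then have w0: "w = (\<lambda>f. 0)"
    proof -
      have "w f = cnj (u (\<lambda>q. cnj (f q)))" for f using \<open>u = vconj w\<close> by (simp add: vconj_def)
      then show ?thesis using u0 by (simp add: fun_eq_iff)
    qed
    have "y r = 0" if "r < n + n + 1" for r
    proof -
      consider "r < n" | "\<not> r < n" "r < n + n" | "r = n + n" using \<open>r < n + n + 1\<close> by linarith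
      then show ?thesis
      proof cases
        case 1 then show ?thesis using indep[OF qU, of y r] u0 by (simp add: u_def)
      next
        case 2
        have "- cnj (y (n + (r - n))) = 0"
          using indep[OF qU, of "\<lambda>r. - cnj (y (n + r))" "r - n"] w0 2 by (simp add: w_def)
        then show ?thesis using 2 by simp
      qed (simp add: yT)
    qed
    then have "x = 0" using er ye by (simp add: vec_eq_iff)
    then show False using x(1) by simp
  qed
  have "continuous_on ?W (\<lambda>q. det (H q) / (det (B q) * cnj (det (B q))))"
    using Bnz by (intro continuous_intros continuous_on_det Hc Bc) auto
  then have "continuous_on ?W (gram_det A h c)"
    by (rule continuous_on_eq) (use HG Bnz in \<open>auto simp: field_simps\<close>)
  then show "isCont (gram_det A h c) p0"
    using oW p0 U by (simp add: continuous_on_eq_continuous_at)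
qed

end

section \<open>Frequency derivatives of classical symbols\<close>

lemma iter_deriv_add:
  assumes "smooth_on S f" "smooth_on S g" "x \<in> S"
  shows "iter_deriv vs (\<lambda>x. f x + g x) x = iter_deriv vs f x + iter_deriv vs g x"
  using assms(3)
proof (induction vs arbitrary: x)
  case (Cons v vs)
  have s: "smooth_on S (iter_deriv vs f)" "smooth_on S (iter_deriv vs g)" using assms smooth_on_iter_deriv by auto
  have "fd (\<lambda>x. iter_deriv vs f x + iter_deriv vs g x) x = fd (iter_deriv vs (\<lambda>x. f x + g x)) x"
    by (rule frechet_derivative_cong_open[OF smooth_on_open[OF assms(1)] Cons.prems])
      (use Cons smooth_on_differentiable[OF smooth_on_add[OF s]] in auto)
  moreover have "fd (\<lambda>x. iter_deriv vs f x + iter_deriv vs g x) x v = fd (iter_deriv vs f) x v + fd (iter_deriv vs g) x v"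
    by (rule frechet_derivative_plus) (use s Cons.prems in \<open>auto intro: smooth_on_differentiable\<close>)
  ultimately show ?case by simp
qed simp

abbreviation et :: "(real ^ 'm::finite) \<times> (real ^ 'm) \<times> real" where "et \<equiv> (0, 0, 1)"

abbreviation dt :: "nat \<Rightarrow> ((real ^ 'm::finite) \<times> (real ^ 'm) \<times> real \<Rightarrow> complex) \<Rightarrow> _" where
  "dt k \<equiv> iter_deriv (replicate k et)"

lemma iter_deriv_et_line:
  assumes f: "smooth_on S f" and x: "(z, w, t) \<in> S"
  shows "((\<lambda>t. dt k f (z, w, t)) has_vector_derivative dt (Suc k) f (z, w, t)) (at t)"
  using frechet_derivative_line[of "dt k f" "(z, w, 0)" t et]
    smooth_on_differentiable[OF smooth_on_iter_deriv[OF f] x] by simp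

text \<open>The falling factorial \<open>j (j - 1) \<dots> (j - k + 1)\<close>. Truncated
  subtraction makes it vanish for \<open>k > j\<close>, as the derivatives of
  \<open>t\<^sup>j\<close> do.\<close>

primrec falling :: "nat \<Rightarrow> nat \<Rightarrow> nat" where
  "falling j 0 = 1"
| "falling j (Suc k) = falling j k * (j - k)"

lemma falling_Suc: "falling (Suc j) (Suc k) = Suc j * falling j k"
proof (induction k)
  case (Suc k)
  have "falling (Suc j) (Suc (Suc k)) = falling (Suc j) (Suc k) * (j - k)"
    by (simp only: falling.simps(2)[of "Suc j" "Suc k"] diff_Suc_Suc)
  then show ?case by (simp only: Suc.IH falling.simps(2)[of j k] mult.assoc)
qed simp

lemma falling_self: "falling j j = fact j"
  by (induction j) (simp_all add: falling_Suc del: falling.simps(2))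

lemma falling_pred: "falling (Suc j) j = fact (Suc j)"
  by (induction j) (simp_all add: falling_Suc del: falling.simps(2))

lemma smooth_on_power:
  fixes f :: "'a::euclidean_space \<Rightarrow> complex"
  shows "smooth_on S f \<Longrightarrow> smooth_on S (\<lambda>x. f x ^ j)"
  by (induction j) (auto intro: smooth_on_const smooth_on_mult smooth_on_open)

lemma smooth_on_pair_part:
  fixes F :: "(real ^ 'm::finite) \<times> (real ^ 'm) \<Rightarrow> complex"
  assumes F: "smooth_on (S \<times> S) F" and S: "open S"
  shows "smooth_on (S \<times> S \<times> {0<..}) (\<lambda>(z, w, t). F (z, w) * of_real t ^ j)"
proof -
  have o: "open (S \<times> S \<times> {0<..} :: ((real ^ 'm) \<times> (real ^ 'm) \<times> real) set)" using S by (intro open_Times) auto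
  have "smooth_on (S \<times> S \<times> {0<..} :: ((real ^ 'm) \<times> (real ^ 'm) \<times> real) set) (\<lambda>x. (fst x, fst (snd x)))"
    by (intro smooth_on_linear bounded_linear_Pair bounded_linear_fst bounded_linear_compose[OF bounded_linear_fst bounded_linear_snd] o)
  moreover have "(\<lambda>x. (fst x, fst (snd x))) ` (S \<times> S \<times> {0::real<..}) \<subseteq> S \<times> S" by auto
  ultimately have "smooth_on (S \<times> S \<times> {0::real<..}) (\<lambda>x. F (fst x, fst (snd x)))"
    by (rule smooth_on_compose[where g = "\<lambda>x. (fst x, fst (snd x))", OF _ F])
  moreover have "smooth_on (S \<times> S \<times> {0<..} :: ((real ^ 'm) \<times> (real ^ 'm) \<times> real) set) (\<lambda>x. complex_of_real (snd (snd x)) ^ j)"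
    by (intro smooth_on_power smooth_on_of_real smooth_on_linear bounded_linear_compose[OF bounded_linear_snd bounded_linear_snd] o)
  ultimately show ?thesis using smooth_on_mult by (force simp: case_prod_unfold)
qed

lemma iter_deriv_power:
  fixes F :: "(real ^ 'm::finite) \<times> (real ^ 'm) \<Rightarrow> complex"
  assumes F: "smooth_on (S \<times> S) F" and S: "open S" and x: "z \<in> S" "w \<in> S" "t > 0"
  shows "dt k (\<lambda>(z, w, t). F (z, w) * of_real t ^ j) (z, w, t)
    = F (z, w) * of_nat (falling j k) * of_real t ^ (j - k)"
  using x
proof (induction k arbitrary: z w t)
  case (Suc k)
  let ?S = "S \<times> S \<times> {0<..}" and ?f = "\<lambda>(z, w, t). F (z, w) * of_real t ^ j"
  have "((\<lambda>t. dt k ?f (z, w, t)) has_vector_derivative dt (Suc k) ?f (z, w, t)) (at t)"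
    by (rule iter_deriv_et_line[OF smooth_on_pair_part[OF F S]]) (use Suc.prems in auto)
  moreover have "((\<lambda>t. F (z, w) * of_nat (falling j k) * of_real t ^ (j - k)) has_vector_derivative 
      F (z, w) * of_nat (falling j k) * (of_nat (j - k) * of_real t ^ (j - k - 1))) (at t)"
  proof -
    have "((\<lambda>t. F (z, w) * of_nat (falling j k) * t ^ (j - k)) has_field_derivative 
      F (z, w) * of_nat (falling j k) * (of_nat (j - k) * of_real t ^ (j - k - 1))) (at (of_real t))"
      by (auto intro!: derivative_eq_intros)
    then show ?thesis by (rule has_vector_derivative_real_field)
  qed
  then have "((\<lambda>t. dt k ?f (z, w, t)) has_vector_derivative 
      F (z, w) * of_nat (falling j k) * (of_nat (j - k) * of_real t ^ (j - k - 1))) (at t)"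
    by (rule has_vector_derivative_transform_within_open[of _ _ _ "{0<..}"]) (use Suc in auto)
  ultimately show ?case using vector_derivative_unique_at by (fastforce simp: mult.assoc)
qed simp

text \<open>Symbol estimates control large \<open>t\<close> and the cutoff controls small
  \<open>t\<close>; compactness bridges the interval between them.\<close>

lemma half_line_bound_glue:
  fixes f :: "'a::topological_space \<Rightarrow> real \<Rightarrow> complex"
  assumes K: "compact K" and cont: "continuous_on (K \<times> {t0..T1}) (\<lambda>(p, t). f p t)"
    and large: "\<And>p t. p \<in> K \<Longrightarrow> t \<ge> T1 \<Longrightarrow> norm (f p t) \<le> C1 * (1 + t) powr a"
    and small: "\<And>p t. p \<in> K \<Longrightarrow> 0 < t \<Longrightarrow> t < t0 \<Longrightarrow> norm (f p t) \<le> C0"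
    and T1: "T1 \<ge> 0"
  shows "\<exists>C. \<forall>p\<in>K. \<forall>t>0. norm (f p t) \<le> C * (1 + t) powr a"
proof -
  have "compact ((\<lambda>(p, t). f p t) ` (K \<times> {t0..T1}))"
    by (intro compact_continuous_image cont compact_Times K compact_Icc)
  from compact_imp_bounded[OF this] obtain B where B': "\<forall>y\<in>(\<lambda>(p, t). f p t) ` (K \<times> {t0..T1}). norm y \<le> B"
    unfolding bounded_iff by (elim exE) (rule that)
  have B: "norm (f p t) \<le> B" if "p \<in> K" "t \<in> {t0..T1}" for p t
    using bspec[OF B', of "f p t"] that by force
  define m where "m = min 1 ((1 + T1) powr a)"
  have m: "m > 0" using T1 by (simp add: m_def)
  have mle: "m \<le> (1 + t) powr a" if "0 < t" "t \<le> T1" for t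
  proof (cases "a \<ge> 0")
    case True
    have "1 \<le> (1 + t) powr a" using that True by (simp add: ge_one_powr_ge_zero)
    then show ?thesis by (simp add: m_def min_le_iff_disj)
  next
    case False
    have "(1 + T1) powr a \<le> (1 + t) powr a" using that False by (intro powr_mono2') auto
    then show ?thesis by (simp add: m_def min_le_iff_disj)
  qed
  define C where "C = max \<bar>C1\<bar> (max \<bar>B\<bar> \<bar>C0\<bar> / m)"
  have "norm (f p t) \<le> C * (1 + t) powr a" if p: "p \<in> K" and t: "t > 0" for p t
  proof (cases "t \<ge> T1")
    case True
    have "C1 * (1 + t) powr a \<le> C * (1 + t) powr a" by (intro mult_right_mono) (auto simp: C_def)
    then show ?thesis using large[OF p True] by simp
  next
    case False
    have "norm (f p t) \<le> max \<bar>B\<bar> \<bar>C0\<bar>"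
      using B[OF p, of t] small[OF p t] False by (cases "t < t0") auto
    also have "\<dots> = (max \<bar>B\<bar> \<bar>C0\<bar> / m) * m" using m by simp
    also have "\<dots> \<le> C * (1 + t) powr a"
      using False t m by (intro mult_mono mle) (auto simp: C_def)
    finally show ?thesis .
  qed
  then show ?thesis by blast
qed

text \<open>Here \<open>g\<close> is the \<open>n\<close>-th derivative of \<open>\<tau> b\<close>
  in \<open>t\<close> minus \<open>n! b\<^sub>0\<close>. For large \<open>t\<close> the terms
  \<open>b\<^sub>0 t\<^sup>n\<close> and \<open>b\<^sub>1 t\<^sup>n\<^sup>-\<^sup>1\<close>
  contribute \<open>n! b\<^sub>0\<close> and \<open>0\<close> to that derivative, so
  \<open>g\<close> is the derivative of a symbol of order \<open>n - 2\<close> and decays like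
  \<open>t\<^sup>-\<^sup>2\<close>. Its integral is the limit of the antiderivative
  \<open>\<partial>\<^sub>t\<^sup>n\<^sup>-\<^sup>1 (\<tau> b) - n! b\<^sub>0 t\<close>, to which
  only \<open>b\<^sub>1\<close> contributes.\<close>

lemma classical_symbol_expansion:
  fixes c :: "('x::topological_space, 'm::finite) chart"
  assumes c: "is_chart c" and n: "n \<ge> 1" and b: "classical_symbol c (real n) b bs" and tau: "cutoff \<tau>"
  shows "\<exists>g. (\<forall>P\<in>cimg c \<times> cimg c. continuous_on {0<..} (g P)) \<and>
     (\<forall>t>0. continuous_on (cimg c \<times> cimg c) (\<lambda>P. g P t)) \<and>
     (\<forall>K. compact K \<longrightarrow> K \<subseteq> cimg c \<times> cimg c \<longrightarrow> (\<exists>C. \<forall>P\<in>K. \<forall>t>0. norm (g P t) \<le> C / (1 + t)\<^sup>2)) \<and>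
     (\<forall>P\<in>cimg c \<times> cimg c. (LINT t:{0<..}|lborel. g P t) = fact (n - 1) * rep2 c (bs 1) P) \<and>
     (\<forall>P\<in>cimg c \<times> cimg c. \<forall>\<zeta>. Im \<zeta> > 0 \<longrightarrow>
        (LINT t:{0<..}|lborel. wave \<zeta> t * (of_real (\<tau> t) * rep3 c b (fst P, snd P, t)))
        = (\<i> / \<zeta>) ^ Suc n * (fact n * rep2 c (bs 0) P) + (\<i> / \<zeta>) ^ n * (LINT t:{0<..}|lborel. wave \<zeta> t * g P t))"
proof -
  let ?S = "cimg c" and ?S3 = "cimg c \<times> cimg c \<times> {0<..} :: ((real ^ 'm) \<times> (real ^ 'm) \<times> real) set"
  have oS: "open ?S" by (rule cimg_open[OF c])
  have oS3: "open ?S3" using oS by (intro open_Times) auto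
  define f where "f = rep3 c b"
  define b0 where "b0 = rep2 c (bs 0)"
  define b1 where "b1 = rep2 c (bs 1)"
  obtain t0 t1 where tau_s: "smooth_on UNIV \<tau>" and t0: "t0 > 0" "\<And>t. t \<le> t0 \<Longrightarrow> \<tau> t = 0" and t1: "\<And>t. t \<ge> t1 \<Longrightarrow> \<tau> t = 1"
    using tau unfolding cutoff_def by blast
  \<comment> \<open>beyond \<open>T1\<close> the cutoff is \<open>1\<close> on a neighbourhood, so it does not affect derivatives, and symbol estimates hold\<close>
  define T1 where "T1 = max 1 t1 + 1"
  have T1: "T1 \<ge> 1" "T1 > t1" by (auto simp: T1_def)
  have sb: "symbol c (real n) b" and s0: "smooth_on (?S \<times> ?S) b0" and s1: "smooth_on (?S \<times> ?S) b1"
    and sr: "symbol c (real n - 2) (\<lambda>x y t. b x y t - (\<Sum>j<2. bs j x y * of_real (t powr (real n - real j))))"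
    using b unfolding classical_symbol_def smooth2_def b0_def b1_def by (auto dest!: spec[of _ "2::nat"])
  have fs: "smooth_on ?S3 f" using sb by (simp add: symbol_def f_def)
  define r where "r = rep3 c (\<lambda>x y t. b x y t - (\<Sum>j<2. bs j x y * of_real (t powr (real n - real j))))"
  have rs: "smooth_on ?S3 r" using sr by (simp add: symbol_def r_def)
  define q where "q = (\<lambda>(z, w, t). b0 (z, w) * of_real t ^ n + b1 (z, w) * of_real t ^ (n - 1))"
  define p0 where "p0 = (\<lambda>(z, w, t). b0 (z, w) * complex_of_real t ^ n)"
  define p1 where "p1 = (\<lambda>(z, w, t). b1 (z, w) * complex_of_real t ^ (n - 1))"
  have ps: "smooth_on ?S3 p0" "smooth_on ?S3 p1"
    unfolding p0_def p1_def by (intro smooth_on_pair_part s0 s1 oS)+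
  have f_eq: "f x = (p0 x + p1 x) + r x" if "x \<in> ?S3" for x
  proof -
    obtain z w t where x: "x = (z, w, t)" by (cases x)
    then have t: "t > 0" using that by auto
    have "t powr (real n) = t ^ n" "t powr (real n - 1) = t ^ (n - 1)"
      using t n powr_realpow[OF t, of n] powr_realpow[OF t, of "n - 1"] by (simp_all add: of_nat_diff)
    then show ?thesis
      by (simp add: x f_def r_def p0_def p1_def rep3_def b0_def b1_def rep2_def numeral_2_eq_2 lessThan_Suc)
  qed
  have f_deriv: "dt k f (z, w, t) = b0 (z, w) * of_nat (falling n k) * of_real t ^ (n - k)
      + b1 (z, w) * of_nat (falling (n - 1) k) * of_real t ^ (n - 1 - k) + dt k r (z, w, t)"
    if "z \<in> ?S" "w \<in> ?S" "t > 0" for k z w t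
  proof -
    have x: "(z, w, t) \<in> ?S3" using that by auto
    have "dt k f (z, w, t) = dt k (\<lambda>x. (p0 x + p1 x) + r x) (z, w, t)"
      by (rule iter_deriv_cong_open[OF fs x f_eq])
    also have "\<dots> = dt k p0 (z, w, t) + dt k p1 (z, w, t) + dt k r (z, w, t)"
      by (simp add: iter_deriv_add[OF smooth_on_add[OF ps] rs x] iter_deriv_add[OF ps x])
    finally show ?thesis
      unfolding p0_def p1_def iter_deriv_power[OF s0 oS that] iter_deriv_power[OF s1 oS that] .
  qed
  define F where "F = (\<lambda>x. of_real (\<tau> (snd (snd x))) * f x)"
  have Fs: "smooth_on ?S3 F" unfolding F_def
  proof (intro smooth_on_mult smooth_on_of_real fs)
    have "smooth_on ?S3 (\<lambda>x. snd (snd x))"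
      by (intro smooth_on_linear bounded_linear_compose[OF bounded_linear_snd bounded_linear_snd] oS3)
    then show "smooth_on ?S3 (\<lambda>x. \<tau> (snd (snd x)))" by (rule smooth_on_compose[OF _ tau_s]) auto
  qed
  define H where "H k P t = dt k F (fst P, snd P, t)" for k P t
  have Hc3: "continuous_on ?S3 (dt k F)" for k
    by (rule smooth_on_continuous[OF smooth_on_iter_deriv[OF Fs]])
  have Hc2: "continuous_on ((?S \<times> ?S) \<times> {0<..}) (\<lambda>(P, t). H k P t)" for k
    unfolding H_def case_prod_unfold
    by (rule continuous_on_compose2[OF Hc3]) (auto intro!: continuous_intros)
  have Hct: "continuous_on {0<..} (H k P)" if "P \<in> ?S \<times> ?S" for k P
    unfolding H_def by (rule continuous_on_compose2[OF Hc3]) (use that in \<open>auto intro!: continuous_intros\<close>)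
  have HcP: "continuous_on (?S \<times> ?S) (\<lambda>P. H k P t)" if "t > 0" for k t
    unfolding H_def by (rule continuous_on_compose2[OF Hc3]) (use that in \<open>auto intro!: continuous_intros\<close>)
  have Hd: "(H k P has_vector_derivative H (Suc k) P t) (at t)" if "P \<in> ?S \<times> ?S" "t > 0" for k P t
    unfolding H_def by (rule iter_deriv_et_line[OF Fs]) (use that in auto)
  have H_small: "H k P t = 0" if "P \<in> ?S \<times> ?S" "0 < t" "t < t0" for k P t
  proof -
    let ?N = "?S \<times> ?S \<times> {0<..<t0}"
    have N: "open ?N" using oS by (intro open_Times) auto
    have "iter_deriv vs (\<lambda>x. 0) x = 0" for vs and x :: "(real ^ 'm) \<times> (real ^ 'm) \<times> real"
    proof (induction vs arbitrary: x)
      case (Cons v vs)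
      then have "iter_deriv vs (\<lambda>x. 0) = (\<lambda>x. 0)" by auto
      then show ?case by simp
    qed simp
    moreover have "dt k (\<lambda>x. 0) (fst P, snd P, t) = dt k F (fst P, snd P, t)"
      by (rule iter_deriv_cong_open[OF smooth_on_const[OF N]]) (use that t0 in \<open>auto simp: F_def\<close>)
    ultimately show ?thesis by (simp add: H_def)
  qed
  have H_large: "H k P t = dt k f (fst P, snd P, t)" if "P \<in> ?S \<times> ?S" "t \<ge> T1" for k P t
  proof -
    let ?N = "?S \<times> ?S \<times> ({0<..} \<inter> {t1<..})"
    have "smooth_on ?N F" by (rule smooth_on_subset[OF Fs]) (use oS in \<open>auto intro!: open_Times\<close>)
    then show ?thesis unfolding H_def
      by (rule iter_deriv_cong_open) (use that T1 t1 in \<open>auto simp: F_def\<close>)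
  qed
  have sbd: "\<exists>C. \<forall>P\<in>K. \<forall>t\<ge>1. norm (dt k (rep3 c a) (fst P, snd P, t)) \<le> C * (1 + t) powr (m - real k)"
    if a: "symbol c m a" and K: "compact K" "K \<subseteq> ?S \<times> ?S" for a m K k
  proof -
    have "\<exists>C>0. \<forall>(z, w)\<in>K. \<forall>t\<ge>1. norm (iter_deriv ([] @ replicate k (0, 0, 1)) (rep3 c a) (z, w, t)) \<le> C * (1 + \<bar>t\<bar>) powr (m - real k)"
      using spec[OF spec[OF spec[OF conjunct2[OF a[unfolded symbol_def]], of K], of "[]"], of k] K by simp
    then obtain C where C: "\<forall>(z, w)\<in>K. \<forall>t\<ge>1. norm (dt k (rep3 c a) (z, w, t)) \<le> C * (1 + \<bar>t\<bar>) powr (m - real k)"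
      by auto
    show ?thesis
    proof (intro exI[of _ C] ballI allI impI)
      fix P t assume "P \<in> K" "(1::real) \<le> t"
      then show "norm (dt k (rep3 c a) (fst P, snd P, t)) \<le> C * (1 + t) powr (m - real k)"
        using C by (cases P) fastforce
    qed
  qed
  note rbd = sbd[OF sr, folded r_def] and fbd = sbd[OF sb, folded f_def]
  have Hbd: "\<exists>C. \<forall>t>0. norm (H k P t) \<le> C * (1 + t) ^ n" if P: "P \<in> ?S \<times> ?S" for k P
  proof -
    obtain C1 where C1: "\<And>t. t \<ge> 1 \<Longrightarrow> norm (dt k f (fst P, snd P, t)) \<le> C1 * (1 + t) powr (real n - real k)"
      using fbd[of "{P}" k] P by auto
    have "\<exists>C. \<forall>p\<in>{P}. \<forall>t>0. norm (H k p t) \<le> C * (1 + t) powr (real n)"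
    proof (rule half_line_bound_glue[where ?T1.0 = T1 and ?t0.0 = t0 and ?C0.0 = 0 and ?C1.0 = "\<bar>C1\<bar>"])
      show "continuous_on ({P} \<times> {t0..T1}) (\<lambda>(p, t). H k p t)"
        by (rule continuous_on_subset[OF Hc2]) (use P t0 in auto)
      fix p t assume p: "p \<in> {P}" and t: "T1 \<le> t"
      have "norm (H k p t) \<le> C1 * (1 + t) powr (real n - real k)"
        using C1[of t] p t T1 H_large[OF P t] by simp
      also have "\<dots> \<le> \<bar>C1\<bar> * (1 + t) powr (real n)"
        using t T1 by (intro mult_mono powr_mono) auto
      finally show "norm (H k p t) \<le> \<bar>C1\<bar> * (1 + t) powr (real n)" .
    qed (use P H_small T1 in auto)
    then show ?thesis by (auto simp: powr_realpow)
  qed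
  define CH where "CH k P = (SOME C. \<forall>t>0. norm (H k P t) \<le> C * (1 + t) ^ n)" for k P
  have CH: "norm (H k P t) \<le> CH k P * (1 + t) ^ n" if "P \<in> ?S \<times> ?S" "t > 0" for k P t
    using someI_ex[OF Hbd[OF that(1), of k]] that(2) by (simp add: CH_def)
  define g where "g P t = H n P t - fact n * b0 P" for P t
  have gt: "continuous_on {0<..} (g P)" if "P \<in> ?S \<times> ?S" for P
    unfolding g_def by (intro continuous_intros Hct that)
  have gP: "continuous_on (?S \<times> ?S) (\<lambda>P. g P t)" if "t > 0" for t
    unfolding g_def by (intro continuous_intros HcP that smooth_on_continuous[OF s0])
  have g_large: "g P t = dt n r (fst P, snd P, t)" if "P \<in> ?S \<times> ?S" "t \<ge> T1" for P t
  proof -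
    have "falling (n - 1) n = 0" using n by (cases n) auto
    then show ?thesis
      using that T1 by (simp add: g_def H_large f_deriv falling_self mem_Times_iff)
  qed
  have gbd: "\<exists>C. \<forall>P\<in>K. \<forall>t>0. norm (g P t) \<le> C / (1 + t)\<^sup>2" if K: "compact K" "K \<subseteq> ?S \<times> ?S" for K
  proof -
    obtain C1 where C1: "\<And>P t. P \<in> K \<Longrightarrow> t \<ge> 1 \<Longrightarrow> norm (dt n r (fst P, snd P, t)) \<le> C1 * (1 + t) powr (real n - 2 - real n)"
      using rbd[OF K, of n] by blast
    have "continuous_on K b0" by (rule continuous_on_subset[OF smooth_on_continuous[OF s0] K(2)])
    then have "compact (b0 ` K)" using K(1) by (rule compact_continuous_image)
    from compact_imp_bounded[OF this] obtain B where "\<forall>y\<in>b0 ` K. norm y \<le> B"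
      unfolding bounded_iff by (elim exE) (rule that)
    then have B: "norm (b0 P) \<le> B" if "P \<in> K" for P using that by simp
    have "\<exists>C. \<forall>p\<in>K. \<forall>t>0. norm (g p t) \<le> C * (1 + t) powr (- 2)"
    proof (rule half_line_bound_glue[where ?T1.0 = T1 and ?t0.0 = t0 and ?C0.0 = "fact n * B" and ?C1.0 = "C1"])
      have "continuous_on (K \<times> {t0..T1}) (\<lambda>(p, t). H n p t)"
        by (rule continuous_on_subset[OF Hc2]) (use K t0 in auto)
      moreover have "continuous_on (K \<times> {t0..T1}) (\<lambda>x. b0 (fst x))"
        by (rule continuous_on_compose2[OF \<open>continuous_on K b0\<close>]) (auto intro!: continuous_intros)
      ultimately show "continuous_on (K \<times> {t0..T1}) (\<lambda>(p, t). g p t)"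
        unfolding g_def case_prod_unfold by (intro continuous_intros)
      show "norm (g p t) \<le> C1 * (1 + t) powr (- 2)" if "p \<in> K" "T1 \<le> t" for p t
        using C1[of p t] that K T1 g_large[of p t] by auto
      show "norm (g p t) \<le> fact n * B" if "p \<in> K" "0 < t" "t < t0" for p t
        using H_small[of p t n] that K B[OF that(1)] by (auto simp: g_def norm_mult norm_fact intro!: mult_left_mono)
    qed (use K T1 in auto)
    then obtain C where C: "\<And>p t. p \<in> K \<Longrightarrow> t > 0 \<Longrightarrow> norm (g p t) \<le> C * (1 + t) powr (- 2)" by blast
    have "C * (1 + t) powr (- 2) = C / (1 + t)\<^sup>2" if "t > 0" for t
      using that by (simp add: powr_minus powr_realpow[of "1 + t" 2, simplified] divide_inverse powr_numeral)
    then show ?thesis using C by (intro exI[of _ C]) auto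
  qed
  have gint: "(LINT t:{0<..}|lborel. g P t) = fact (n - 1) * b1 P" if P: "P \<in> ?S \<times> ?S" for P
  proof -
    obtain C where C: "\<And>t. t > 0 \<Longrightarrow> norm (g P t) \<le> C / (1 + t)\<^sup>2" using gbd[of "{P}"] P by auto
    obtain m where m: "n = Suc m" using n by (cases n) auto
    \<comment> \<open>\<open>H m P\<close> is the derivative of order \<open>n - 1\<close>, and \<open>g P\<close> is the derivative of \<open>H m P - n! b\<^sub>0 t\<close>\<close>
    have "(LINT t:{0<..}|lborel. g P t) = fact (n - 1) * b1 P - 0"
    proof (rule half_line_FTC[where F = "\<lambda>t. H m P t - of_real t * (fact n * b0 P)"])
      show "((\<lambda>t. H m P t - of_real t * (fact n * b0 P)) has_vector_derivative g P t) (at t)" if t: "t > 0" for t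
      proof -
        have "((\<lambda>t. complex_of_real t) has_vector_derivative 1) (at t)"
          using has_vector_derivative_of_real[OF DERIV_ident] by simp
        from has_vector_derivative_diff[OF Hd[OF P t, of m] has_vector_derivative_mult_left[OF this, of "fact n * b0 P"]]
        show ?thesis by (simp add: g_def m)
      qed
      show "continuous_on {0<..} (g P)" by (rule gt[OF P])
      show "set_integrable lborel {0<..} (g P)" by (rule set_integrable_half_line_decay[OF gt[OF P] C])
      have "((\<lambda>t. - (complex_of_real t * (fact n * b0 P))) \<longlongrightarrow> - (of_real 0 * (fact n * b0 P))) (at_right 0)"
        by (intro tendsto_intros)
      then have "((\<lambda>t. - (complex_of_real t * (fact n * b0 P))) \<longlongrightarrow> 0) (at_right 0)" by simp
      then show "((\<lambda>t. H m P t - of_real t * (fact n * b0 P)) \<longlongrightarrow> 0) (at_right 0)"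
        by (rule Lim_transform_eventually) (use t0 H_small[OF P] in \<open>auto simp: eventually_at_right_field intro!: exI[of _ t0]\<close>)
      obtain C2 where C2: "\<And>t. t \<ge> 1 \<Longrightarrow> norm (dt m r (fst P, snd P, t)) \<le> C2 * (1 + t) powr (real n - 2 - real m)"
        using rbd[of "{P}" m] P by auto
      have lim1: "((\<lambda>t. C2 * (1 / (1 + t))) \<longlongrightarrow> C2 * 0) at_top"
        by (intro tendsto_mult tendsto_const tendsto_divide_0[OF tendsto_const] filterlim_at_top_imp_at_infinity filterlim_tendsto_add_at_top[OF tendsto_const] filterlim_ident)
      have "((\<lambda>t. dt m r (fst P, snd P, t)) \<longlongrightarrow> 0) at_top"
      proof (rule Lim_null_comparison[OF _ lim1[simplified mult_zero_right]])
        show "\<forall>\<^sub>F t in at_top. norm (dt m r (fst P, snd P, t)) \<le> C2 * (1 / (1 + t))"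
          using eventually_ge_at_top[of 1]
        proof eventually_elim
          case (elim t)
          have "(1 + t) powr (real n - 2 - real m) = 1 / (1 + t)" using elim by (simp add: m powr_minus_divide)
          then show ?case using C2[OF elim] by simp
        qed
      qed
      then have "((\<lambda>t. fact m * b1 P + dt m r (fst P, snd P, t)) \<longlongrightarrow> fact m * b1 P + 0) at_top"
        by (intro tendsto_intros)
      then have "((\<lambda>t. fact m * b1 P + dt m r (fst P, snd P, t)) \<longlongrightarrow> fact (n - 1) * b1 P) at_top"
        by (simp add: m)
      then show "((\<lambda>t. H m P t - of_real t * (fact n * b0 P)) \<longlongrightarrow> fact (n - 1) * b1 P) at_top"
      proof (rule Lim_transform_eventually)
        show "\<forall>\<^sub>F t in at_top. fact m * b1 P + dt m r (fst P, snd P, t) = H m P t - of_real t * (fact n * b0 P)"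
          using eventually_ge_at_top[of T1]
        proof eventually_elim
          case (elim t)
          have "falling n m = fact n" "falling (n - 1) m = fact m" by (simp_all only: m falling_pred falling_self diff_Suc_1)
          then show ?case
            using P elim T1 by (simp add: H_large[OF P elim] f_deriv mem_Times_iff) (simp add: m algebra_simps)
        qed
      qed
    qed
    then show ?thesis by simp
  qed
  have expansion: "(LINT t:{0<..}|lborel. wave \<zeta> t * (of_real (\<tau> t) * rep3 c b (fst P, snd P, t)))
        = (\<i> / \<zeta>) ^ Suc n * (fact n * b0 P) + (\<i> / \<zeta>) ^ n * (LINT t:{0<..}|lborel. wave \<zeta> t * g P t)"
    if P: "P \<in> ?S \<times> ?S" and \<zeta>: "Im \<zeta> > 0" for P \<zeta>
  proof -
    have "(LINT t:{0<..}|lborel. wave \<zeta> t * H 0 P t)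
        = (\<i> / \<zeta>) ^ Suc n * (fact n * b0 P) + (\<i> / \<zeta>) ^ n * (LINT t:{0<..}|lborel. wave \<zeta> t * (H n P t - fact n * b0 P))"
      by (rule half_line_expansion[where ?t0.0 = t0 and C = "\<lambda>k. CH k P"]) (use P \<zeta> Hd Hct H_small t0 CH in auto)
    then show ?thesis by (simp add: H_def F_def f_def g_def)
  qed
  show ?thesis
    by (rule exI[of _ g]) (use gt gP gbd gint expansion in \<open>auto simp: b0_def b1_def simp del: power_Suc\<close>)
qed

section \<open>The volume measure\<close>

context levi_manifold
begin

lemma continuous_density:
  assumes c: "c \<in> charts A"
  shows "continuous_on (cimg c) (\<lambda>z. sqrt (Re (gram_det A h c (cinv c z))))"
proof -
  have ch: "is_chart c" by (rule charts_is_chart[OF c])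
  have "continuous_on (cimg c) (\<lambda>z. gram_det A h c (cinv c z))"
    by (rule continuous_on_compose2[OF continuous_gram_det[OF c] continuous_cinv[OF ch]]) (use cinv_in[OF ch] in auto)
  then show ?thesis by (intro continuous_intros)
qed

text \<open>The density is positive and continuous in every chart, and a continuous positive function
  has a positive integral over a non-empty open set.\<close>

lemma volume_measure_open_pos:
  assumes mu: "volume_measure A h \<mu>" and B: "open B" "B \<noteq> {}"
  shows "emeasure \<mu> B > 0"
proof (rule ccontr)
  assume "\<not> emeasure \<mu> B > 0"
  then have B0: "emeasure \<mu> B = 0" by simp
  obtain p where p: "p \<in> B" using B by auto
  obtain c where c: "c \<in> charts A" "p \<in> cdom c" using exists_chart atlas_charts by blast
  have ch: "is_chart c" by (rule charts_is_chart[OF c(1)])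
  let ?J = "\<lambda>z. sqrt (Re (gram_det A h c (cinv c z)))"
  let ?B = "B \<inter> cdom c" and ?V = "cmap c ` (B \<inter> cdom c)"
  have oB: "open ?B" using B chart_open[OF ch] by auto
  have oV: "open ?V" using open_chart_image[OF ch oB] by auto
  have VS: "?V \<subseteq> cimg c" by (auto simp: cimg_def)
  have sets: "sets \<mu> = sets borel" using mu by (simp add: volume_measure_def)
  have "emeasure \<mu> ?B \<le> emeasure \<mu> B" by (rule emeasure_mono) (use B sets in auto)
  then have "emeasure \<mu> ?B = 0" using B0 by simp
  moreover have "emeasure \<mu> ?B = (\<integral>\<^sup>+ z\<in>?V. ennreal (?J z) \<partial>lborel)"
    using mu c oB unfolding volume_measure_def by auto
  ultimately have int0: "(\<integral>\<^sup>+ z. ennreal (indicator ?V z *\<^sub>R ?J z) \<partial>lborel) = 0"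
  proof -
    assume "emeasure \<mu> ?B = 0" "emeasure \<mu> ?B = (\<integral>\<^sup>+ z\<in>?V. ennreal (?J z) \<partial>lborel)"
    moreover have "(\<integral>\<^sup>+ z\<in>?V. ennreal (?J z) \<partial>lborel) = (\<integral>\<^sup>+ z. ennreal (indicator ?V z *\<^sub>R ?J z) \<partial>lborel)"
      by (intro nn_integral_cong) (auto simp: indicator_def)
    ultimately show ?thesis by simp
  qed
  have m: "(\<lambda>z. indicator ?V z *\<^sub>R ?J z) \<in> borel_measurable borel"
    by (rule borel_measurable_continuous_on_indicator[OF _ continuous_on_subset[OF continuous_density[OF c(1)] VS]]) (use oV in auto)
  then have "AE z in lborel. ennreal (indicator ?V z *\<^sub>R ?J z) = 0"
    using int0 by (subst (asm) nn_integral_0_iff_AE) auto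
  then have "AE z in lborel. z \<notin> ?V"
  proof (rule AE_mp, intro AE_I2 impI notI)
    fix z assume "ennreal (indicator ?V z *\<^sub>R ?J z) = 0" and z: "z \<in> ?V"
    then have "?J z \<le> 0" by (simp add: ennreal_eq_0_iff)
    moreover have "0 < Re (gram_det A h c (cinv c z))"
      by (rule gram_det_pos[OF c(1) cinv_in[OF ch]]) (use z VS in auto)
    ultimately show False by simp
  qed
  then have "?V \<in> null_sets lborel" using oV by (subst (asm) AE_iff_null_sets[symmetric]) auto
  then have "negligible ?V" by (simp add: negligible_iff_null_sets null_sets_completionI)
  then show False using open_not_negligible[OF oV] p c by auto
qed

text \<open>The density is bounded on a small ball around each point, and finitely many such balls
  cover the manifold.\<close>

lemma volume_measure_finite:
  assumes mu: "volume_measure A h \<mu>" and cpt: "compact (UNIV :: 'x set)"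
  shows "finite_measure \<mu>"
proof (rule finite_measureI)
  have sets: "sets \<mu> = sets borel" using mu by (simp add: volume_measure_def)
  have sp: "space \<mu> = UNIV" using sets_eq_imp_space_eq[OF sets] by simp
  have "\<exists>W. open W \<and> p \<in> W \<and> emeasure \<mu> W < \<infinity>" for p
  proof -
    obtain c where c: "c \<in> charts A" "p \<in> cdom c" using exists_chart atlas_charts by blast
    have ch: "is_chart c" by (rule charts_is_chart[OF c(1)])
    let ?J = "\<lambda>z. sqrt (Re (gram_det A h c (cinv c z)))"
    obtain r where r: "r > 0" "cball (cmap c p) r \<subseteq> cimg c"
      using cimg_open[OF ch] cmap_in[OF ch c(2)] open_contains_cball by blast
    have "compact (?J ` cball (cmap c p) r)"
      by (intro compact_continuous_image compact_cball continuous_on_subset[OF continuous_density[OF c(1)] r(2)])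
    from compact_imp_bounded[OF this] obtain B where B': "\<forall>y\<in>?J ` cball (cmap c p) r. norm y \<le> B"
      unfolding bounded_iff by (elim exE) (rule that)
    then have B: "?J z \<le> B" if "z \<in> cball (cmap c p) r" for z
      using order_trans[OF norm_ge_zero bspec[OF B' imageI[OF that]]] bspec[OF B' imageI[OF that]] by simp
    let ?W = "cdom c \<inter> cmap c -` ball (cmap c p) r"
    have oW: "open ?W"
      using continuous_open_preimage[OF continuous_cmap[OF ch] chart_open[OF ch]] by blast
    have im: "cmap c ` ?W \<subseteq> ball (cmap c p) r" by auto
    have "emeasure \<mu> ?W = (\<integral>\<^sup>+ z\<in>cmap c ` ?W. ennreal (?J z) \<partial>lborel)"
      using mu c oW unfolding volume_measure_def by auto
    also have "\<dots> \<le> (\<integral>\<^sup>+ z. ennreal B * indicator (ball (cmap c p) r) z \<partial>lborel)"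
    proof (rule nn_integral_mono)
      fix z
      have "ennreal (?J z) \<le> ennreal B" if "z \<in> cmap c ` ?W"
        using subsetD[OF im that] by (intro ennreal_leI B) auto
      then show "ennreal (?J z) * indicator (cmap c ` ?W) z \<le> ennreal B * indicator (ball (cmap c p) r) z"
        using im by (auto simp: indicator_def)
    qed
    also have "\<dots> = ennreal B * emeasure lborel (ball (cmap c p) r)"
      by (rule nn_integral_cmult_indicator) simp
    also have "\<dots> < \<infinity>"
      using emeasure_bounded_finite[OF bounded_ball, of "cmap c p" r] by (simp add: ennreal_mult_less_top)
    finally show ?thesis using oW c r by (intro exI[of _ ?W]) auto
  qed
  then have "\<forall>p. \<exists>W. open W \<and> p \<in> W \<and> emeasure \<mu> W < \<infinity>" by blast
  from choice[OF this] obtain W where "\<forall>p. open (W p) \<and> p \<in> W p \<and> emeasure \<mu> (W p) < \<infinity>" ..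
  then have W: "open (W p)" "p \<in> W p" "emeasure \<mu> (W p) < \<infinity>" for p by auto
  obtain P where P: "finite P" "UNIV \<subseteq> (\<Union>p\<in>P. W p)"
    by (rule compactE_image[OF cpt, of UNIV W]) (use W in auto)
  have "emeasure \<mu> UNIV \<le> emeasure \<mu> (\<Union>p\<in>P. W p)" by (rule emeasure_mono) (use P W sets in auto)
  also have "\<dots> \<le> (\<Sum>p\<in>P. emeasure \<mu> (W p))"
    by (rule emeasure_subadditive_finite[OF P(1)]) (use W sets in auto)
  also have "\<dots> < \<infinity>" using W(3) by (simp add: P(1))
  finally show "emeasure \<mu> (space \<mu>) \<noteq> \<infinity>" by (simp add: sp)
qed

end

section \<open>Oscillatory integrals off the diagonal\<close>

text \<open>The function that represents an oscillatory integral away from the zeros of the phase: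
  the first term comes from the constant \<open>n! b\<^sub>0\<close> that remains of the leading
  part after \<open>n\<close> integrations by parts, the second one from the decaying rest.\<close>

definition singular_kernel :: "nat \<Rightarrow> ('a \<Rightarrow> 'a \<Rightarrow> complex) \<Rightarrow> ('a \<Rightarrow> 'a \<Rightarrow> complex) \<Rightarrow> ('a \<Rightarrow> 'a \<Rightarrow> complex) \<Rightarrow> 'a \<Rightarrow> 'a \<Rightarrow> complex" where
  "singular_kernel n \<psi> b0 G x y = (\<i> / \<psi> x y) ^ Suc n * (fact n * b0 x y) + (\<i> / \<psi> x y) ^ n * G x y"

lemma compact_bound:
  fixes f :: "'b::topological_space \<Rightarrow> complex"
  assumes "compact K" "continuous_on K f"
  shows "\<exists>B\<ge>0. \<forall>z\<in>K. norm (f z) \<le> B"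
proof -
  from compact_imp_bounded[OF compact_continuous_image[OF assms(2,1)]] obtain B where "\<forall>y\<in>f ` K. norm y \<le> B"
    unfolding bounded_iff by (elim exE) (rule that)
  then show ?thesis by (intro exI[of _ "\<bar>B\<bar>"]) force
qed

lemma cmod_add_imaginary_ge: "0 \<le> Im z \<Longrightarrow> 0 \<le> e \<Longrightarrow> cmod z \<le> cmod (z + \<i> * of_real e)"
  unfolding cmod_def by (intro real_sqrt_le_mono add_mono) (auto intro!: power_mono)

locale chart_measure = finite_measure \<mu>
  for \<mu> :: "'x::{t2_space,second_countable_topology} measure" +
  fixes c :: "('x, 'm::finite) chart"
  assumes sets_mu: "sets \<mu> = sets borel" and open_pos: "\<And>B. open B \<Longrightarrow> B \<noteq> {} \<Longrightarrow> emeasure \<mu> B > 0"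
    and chart: "is_chart c"
begin

abbreviation "\<mu>2 \<equiv> \<mu> \<Otimes>\<^sub>M \<mu>"

lemma sets_pair: "sets \<mu>2 = sets (borel :: ('x \<times> 'x) measure)"
  using sets_pair_measure_cong[OF sets_mu sets_mu] unfolding borel_prod .

lemma finite_pair: "finite_measure \<mu>2"
proof (rule finite_measureI)
  have "emeasure \<mu>2 (space \<mu> \<times> space \<mu>) = emeasure \<mu> (space \<mu>) * emeasure \<mu> (space \<mu>)"
    by (rule emeasure_pair_measure_Times) auto
  then show "emeasure \<mu>2 (space \<mu>2) \<noteq> \<infinity>"
    using emeasure_finite by (simp add: space_pair_measure ennreal_mult_eq_top_iff)
qed

lemma pair_measurable:
  fixes f :: "'x \<times> 'x \<Rightarrow> complex"
  assumes "open V" "continuous_on V f" "\<And>z. z \<notin> V \<Longrightarrow> f z = 0"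
  shows "f \<in> borel_measurable \<mu>2"
proof -
  have "(\<lambda>z. indicator V z *\<^sub>R f z) \<in> borel_measurable borel"
    by (rule borel_measurable_continuous_on_indicator[OF _ assms(2)]) (use assms(1) in auto)
  also have "(\<lambda>z. indicator V z *\<^sub>R f z) = f" using assms(3) by (auto simp: indicator_def fun_eq_iff)
  finally show ?thesis using measurable_cong_sets[OF sets_pair refl] by blast
qed

lemma pair_integrable:
  fixes f :: "'x \<times> 'x \<Rightarrow> complex"
  assumes "open V" "continuous_on V f" "compact K" "K \<subseteq> V" "\<And>z. z \<notin> K \<Longrightarrow> f z = 0"
  shows "integrable \<mu>2 f"
proof -
  obtain B where B: "B \<ge> 0" "\<And>z. z \<in> K \<Longrightarrow> norm (f z) \<le> B"
    using compact_bound[OF assms(3) continuous_on_subset[OF assms(2,4)]] by blast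
  show ?thesis
  proof (rule finite_measure.integrable_const_bound[OF finite_pair])
    show "AE z in \<mu>2. norm (f z) \<le> B"
    proof (rule AE_I2)
      fix z show "norm (f z) \<le> B" using B assms(5)[of z] by (cases "z \<in> K") auto
    qed
    show "f \<in> borel_measurable \<mu>2" by (rule pair_measurable[OF assms(1,2)]) (use assms in auto)
  qed
qed

abbreviation "D \<equiv> cdom c"
abbreviation "S \<equiv> cimg c"

lemma open_D2: "open (D \<times> D)" using chart_open[OF chart] by (intro open_Times)

lemma rep2_cmap: "x \<in> D \<Longrightarrow> y \<in> D \<Longrightarrow> rep2 c \<psi> (cmap c x, cmap c y) = \<psi> x y"
  by (simp add: rep2_def cinv_cmap[OF chart])

lemma continuous_rep2:
  assumes "continuous_on (S \<times> S) (rep2 c \<psi>)"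
  shows "continuous_on (D \<times> D) (\<lambda>(x, y). \<psi> x y)"
proof -
  have "continuous_on (D \<times> D) (\<lambda>z. (cmap c (fst z), cmap c (snd z)))"
    by (intro continuous_on_Pair continuous_on_compose2[OF continuous_cmap[OF chart]] continuous_intros) auto
  moreover have "(\<lambda>z. (cmap c (fst z), cmap c (snd z))) ` (D \<times> D) \<subseteq> S \<times> S"
    using cmap_in[OF chart] by auto
  ultimately have "continuous_on (D \<times> D) (\<lambda>z. rep2 c \<psi> (cmap c (fst z), cmap c (snd z)))"
    by (rule continuous_on_compose2[OF assms])
  then show ?thesis by (rule continuous_on_eq) (auto simp: rep2_cmap)
qed

lemma smooth2_continuous: "smooth2 c \<psi> \<Longrightarrow> continuous_on (D \<times> D) (\<lambda>(x, y). \<psi> x y)"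
  unfolding smooth2_def by (rule continuous_rep2[OF smooth_on_continuous])

lemma test_fun2_continuous: "test_fun2 c \<theta> \<Longrightarrow> continuous_on (D \<times> D) (\<lambda>(x, y). \<theta> x y)"
  unfolding test_fun2_def using smooth2_continuous by blast

text \<open>Products of bump functions in the two variables; the strictly positive values on a
  product of open sets are what the positivity of the measure is applied to.\<close>

lemma bump_test_fun:
  assumes V: "open V" "V \<subseteq> D \<times> D" "(x0, y0) \<in> V"
  obtains \<theta> :: "'x \<Rightarrow> 'x \<Rightarrow> real" and W1 W2 where "test_fun2 c (\<lambda>x y. of_real (\<theta> x y))" "\<And>x y. 0 \<le> \<theta> x y"
    "open W1" "x0 \<in> W1" "open W2" "y0 \<in> W2" "\<And>x y. x \<in> W1 \<Longrightarrow> y \<in> W2 \<Longrightarrow> \<theta> x y > 0"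
    "closure {(x, y). complex_of_real (\<theta> x y) \<noteq> 0} \<subseteq> V"
proof -
  have "\<exists>X Y. open X \<and> open Y \<and> (x0, y0) \<in> X \<times> Y \<and> X \<times> Y \<subseteq> V" using V(1,3) open_prod_def by blast
  then obtain X Y where XY: "open X" "open Y" "x0 \<in> X" "y0 \<in> Y" "X \<times> Y \<subseteq> V" by auto
  have XD: "X \<subseteq> D" "Y \<subseteq> D" using XY V(2) by auto
  have ball: "\<exists>r>0. cball (cmap c x) r \<subseteq> cmap c ` X" if "open X" "X \<subseteq> D" "x \<in> X" for X x
    using open_chart_image[OF chart that(1,2)] that(3) open_contains_cball by (metis imageI)
  obtain r where r: "r > 0" "cball (cmap c x0) r \<subseteq> cmap c ` X" using ball[OF XY(1) XD(1) XY(3)] by blast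
  obtain s where s: "s > 0" "cball (cmap c y0) s \<subseteq> cmap c ` Y" using ball[OF XY(2) XD(2) XY(4)] by blast
  obtain f :: "real ^ 'm \<Rightarrow> real" where f: "smooth_on UNIV f" "\<And>z. 0 \<le> f z" "\<And>z. f z \<noteq> 0 \<longleftrightarrow> z \<in> ball (cmap c x0) r"
    using bump_function_exists[OF r(1), of "cmap c x0"] by blast
  obtain g :: "real ^ 'm \<Rightarrow> real" where g: "smooth_on UNIV g" "\<And>z. 0 \<le> g z" "\<And>z. g z \<noteq> 0 \<longleftrightarrow> z \<in> ball (cmap c y0) s"
    using bump_function_exists[OF s(1), of "cmap c y0"] by blast
  define \<theta> where "\<theta> x y = (if x \<in> D \<and> y \<in> D then f (cmap c x) * g (cmap c y) else 0)" for x y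
  let ?W1 = "D \<inter> cmap c -` ball (cmap c x0) r" and ?W2 = "D \<inter> cmap c -` ball (cmap c y0) s"
  let ?K = "cinv c ` cball (cmap c x0) r \<times> cinv c ` cball (cmap c y0) s"
  have XS: "cmap c ` X \<subseteq> S" "cmap c ` Y \<subseteq> S" using XD by (auto simp: cimg_def)
  have K: "compact ?K"
    using r s XS by (intro compact_Times compact_continuous_image compact_cball continuous_on_subset[OF continuous_cinv[OF chart]]) auto
  have KV: "?K \<subseteq> V"
  proof -
    have "cinv c ` cball (cmap c x0) r \<subseteq> X" "cinv c ` cball (cmap c y0) s \<subseteq> Y"
      using r(2) s(2) cinv_image[OF chart XD(1)] cinv_image[OF chart XD(2)] by blast+
    then show ?thesis using XY(5) by blast
  qed
  have supp: "{(x, y). complex_of_real (\<theta> x y) \<noteq> 0} \<subseteq> ?K"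
  proof clarify
    fix x y assume "complex_of_real (\<theta> x y) \<noteq> 0"
    then have xy: "x \<in> D" "y \<in> D" "f (cmap c x) \<noteq> 0" "g (cmap c y) \<noteq> 0" by (auto simp: \<theta>_def split: if_splits)
    then have "cmap c x \<in> cball (cmap c x0) r" "cmap c y \<in> cball (cmap c y0) s" using f(3) g(3) by auto
    then show "x \<in> cinv c ` cball (cmap c x0) r \<and> y \<in> cinv c ` cball (cmap c y0) s"
      using cinv_cmap[OF chart xy(1)] cinv_cmap[OF chart xy(2)] by (metis imageI)
  qed
  have cl: "closure {(x, y). complex_of_real (\<theta> x y) \<noteq> 0} \<subseteq> ?K"
    by (rule closure_minimal[OF supp compact_imp_closed[OF K]])
  have "smooth_on (S \<times> S) (\<lambda>z. complex_of_real (f (fst z)) * of_real (g (snd z)))"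
  proof -
    have o: "open (S \<times> S)" using cimg_open[OF chart] by (intro open_Times)
    have "smooth_on (S \<times> S) (\<lambda>z. f (fst z))" "smooth_on (S \<times> S) (\<lambda>z. g (snd z))"
      by (rule smooth_on_compose[OF smooth_on_linear[OF bounded_linear_fst o] f(1)], simp,
          rule smooth_on_compose[OF smooth_on_linear[OF bounded_linear_snd o] g(1)], simp)
    then show ?thesis by (intro smooth_on_mult smooth_on_of_real)
  qed
  then have "smooth2 c (\<lambda>x y. of_real (\<theta> x y))"
    unfolding smooth2_def
    by (rule smooth_on_cong) (auto simp: rep2_def \<theta>_def cinv_in[OF chart] cmap_cinv[OF chart])
  moreover have "compact (closure {(x, y). complex_of_real (\<theta> x y) \<noteq> 0})"
    using compact_Int_closed[OF K closed_closure, of "{(x, y). complex_of_real (\<theta> x y) \<noteq> 0}"] cl by (simp add: Int_absorb1)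
  ultimately have "test_fun2 c (\<lambda>x y. of_real (\<theta> x y))"
    unfolding test_fun2_def using cl KV V(2) by blast
  moreover have oW: "open ?W1" "open ?W2"
    using continuous_open_preimage[OF continuous_cmap[OF chart] chart_open[OF chart]] by blast+
  moreover have "x0 \<in> ?W1" "y0 \<in> ?W2" using XY XD r s by auto
  moreover have "\<theta> x y > 0" if "x \<in> ?W1" "y \<in> ?W2" for x y
  proof -
    have "f (cmap c x) > 0" "g (cmap c y) > 0" using that f(2)[of "cmap c x"] g(2)[of "cmap c y"] f(3)[of "cmap c x"] g(3)[of "cmap c y"] by auto
    then show ?thesis using that by (simp add: \<theta>_def)
  qed
  moreover have "0 \<le> \<theta> x y" for x y using f(2) g(2) by (simp add: \<theta>_def)
  moreover have "closure {(x, y). complex_of_real (\<theta> x y) \<noteq> 0} \<subseteq> V" using cl KV by blast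
  ultimately show ?thesis by (intro that[of \<theta> ?W1 ?W2]) assumption+
qed

lemma pairing_integrable:
  assumes V: "open V" "V \<subseteq> D \<times> D" and F: "continuous_on V (\<lambda>(x, y). F x y)"
    and \<theta>: "test_fun2 c \<theta>" "closure {(x, y). \<theta> x y \<noteq> 0} \<subseteq> V"
  shows "integrable \<mu>2 (\<lambda>z. F (fst z) (snd z) * \<theta> (fst z) (snd z))"
proof (rule pair_integrable[OF V(1)])
  show "continuous_on V (\<lambda>z. F (fst z) (snd z) * \<theta> (fst z) (snd z))"
    using F continuous_on_subset[OF test_fun2_continuous[OF \<theta>(1)] V(2)] by (intro continuous_intros) (auto simp: case_prod_unfold)
  show "compact (closure {(x, y). \<theta> x y \<noteq> 0})" using \<theta> by (simp add: test_fun2_def)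
  fix z assume "z \<notin> closure {(x, y). \<theta> x y \<noteq> 0}"
  then have "z \<notin> {(x, y). \<theta> x y \<noteq> 0}" using subsetD[OF closure_subset[of "{(x, y). \<theta> x y \<noteq> 0}"], of z] by metis
  then show "F (fst z) (snd z) * \<theta> (fst z) (snd z) = 0" by (auto simp: case_prod_unfold)
qed (rule \<theta>(2))

text \<open>If \<open>F\<close> does not vanish at a point, then \<open>Re (cnj (F x0 y0) *
  F)\<close> is positive nearby, and pairing with a bump function supported there cannot give
  \<open>0\<close> because the measure charges open sets.\<close>

lemma pairing_eq_0_imp:
  assumes V: "open V" "V \<subseteq> D \<times> D" and F: "continuous_on V (\<lambda>(x, y). F x y)"
    and 0: "\<And>\<theta>. test_fun2 c \<theta> \<Longrightarrow> closure {(x, y). \<theta> x y \<noteq> 0} \<subseteq> V \<Longrightarrow> pairing \<mu> F \<theta> = 0"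
    and xy: "(x0, y0) \<in> V"
  shows "F x0 y0 = 0"
proof (rule ccontr)
  assume nz: "F x0 y0 \<noteq> 0"
  \<comment> \<open>positive near \<open>(x0, y0)\<close>, where it equals \<open>\<bar>F x0 y0\<bar>\<^sup>2\<close>\<close>
  define R where "R z = Re (cnj (F x0 y0) * F (fst z) (snd z))" for z
  have Rc: "continuous_on V R" unfolding R_def using F by (intro continuous_intros) (simp add: case_prod_unfold)
  define N where "N = V \<inter> R -` {0<..}"
  have oN: "open N" unfolding N_def by (rule continuous_open_preimage[OF Rc V(1)]) simp
  have "R (x0, y0) = (cmod (F x0 y0))\<^sup>2" unfolding cmod_power2 by (simp add: R_def power2_eq_square)
  then have N: "(x0, y0) \<in> N" using xy nz by (simp add: N_def)
  have ND: "N \<subseteq> D \<times> D" using V(2) by (auto simp: N_def)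
  obtain \<theta> :: "'x \<Rightarrow> 'x \<Rightarrow> real" and W1 W2 where \<theta>: "test_fun2 c (\<lambda>x y. of_real (\<theta> x y))" "\<And>x y. 0 \<le> \<theta> x y"
    and W: "open W1" "x0 \<in> W1" "open W2" "y0 \<in> W2" "\<And>x y. x \<in> W1 \<Longrightarrow> y \<in> W2 \<Longrightarrow> \<theta> x y > 0"
    and cl: "closure {(x, y). complex_of_real (\<theta> x y) \<noteq> 0} \<subseteq> N"
    using bump_test_fun[OF oN ND N] by blast
  let ?f = "\<lambda>z. F (fst z) (snd z) * complex_of_real (\<theta> (fst z) (snd z))"
  have clV: "closure {(x, y). complex_of_real (\<theta> x y) \<noteq> 0} \<subseteq> V" using cl by (auto simp: N_def)
  have int: "integrable \<mu>2 ?f" by (rule pairing_integrable[OF V F \<theta>(1) clV])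
  have "(LINT z|\<mu>2. ?f z) = 0" using 0[OF \<theta>(1) clV] by (simp add: pairing_def)
  moreover have "(LINT z|\<mu>2. Re (cnj (F x0 y0) * ?f z)) = Re (cnj (F x0 y0) * (LINT z|\<mu>2. ?f z))"
    using int by (subst integral_Re) auto
  moreover have Rf: "Re (cnj (F x0 y0) * ?f z) = R z * \<theta> (fst z) (snd z)" for z
    by (simp add: R_def algebra_simps)
  ultimately have "(LINT z|\<mu>2. R z * \<theta> (fst z) (snd z)) = 0" by simp
  moreover have "integrable \<mu>2 (\<lambda>z. R z * \<theta> (fst z) (snd z))"
  proof -
    have "integrable \<mu>2 (\<lambda>z. Re (cnj (F x0 y0) * ?f z))" using int by (intro integrable_Re integrable_mult_right)
    then show ?thesis by (simp only: Rf)
  qed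
  moreover have nn: "0 \<le> R z * \<theta> (fst z) (snd z)" for z
  proof (cases "\<theta> (fst z) (snd z) = 0")
    case False
    then have "z \<in> {(x, y). complex_of_real (\<theta> x y) \<noteq> 0}" by (auto simp: case_prod_unfold)
    then have "z \<in> N" by (rule subsetD[OF cl subsetD[OF closure_subset]])
    then show ?thesis using \<theta>(2) by (simp add: N_def)
  qed simp
  ultimately have AE: "AE z in \<mu>2. R z * \<theta> (fst z) (snd z) = 0"
    using integral_nonneg_eq_0_iff_AE by blast
  have "AE z in \<mu>2. z \<notin> W1 \<times> W2"
    using AE
  proof (rule AE_mp, intro AE_I2 impI notI)
    fix z assume z: "R z * \<theta> (fst z) (snd z) = 0" "z \<in> W1 \<times> W2"
    then have p: "\<theta> (fst z) (snd z) > 0" using W(5)[of "fst z" "snd z"] by (simp add: mem_Times_iff)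
    then have "z \<in> {(x, y). complex_of_real (\<theta> x y) \<noteq> 0}" by (auto simp: case_prod_unfold)
    then have "z \<in> N" by (rule subsetD[OF cl subsetD[OF closure_subset]])
    then show False using z p by (simp add: N_def)
  qed
  moreover have "W1 \<times> W2 \<in> sets \<mu>2" using W sets_mu by auto
  ultimately have "emeasure \<mu>2 (W1 \<times> W2) = 0"
    by (simp add: AE_iff_null_sets[symmetric] null_setsD1)
  moreover have "emeasure \<mu>2 (W1 \<times> W2) = emeasure \<mu> W1 * emeasure \<mu> W2"
    by (rule emeasure_pair_measure_Times) (use W sets_mu in auto)
  moreover have "W1 \<noteq> {}" "W2 \<noteq> {}" using W(2,4) by blast+
  then have "emeasure \<mu> W1 \<noteq> 0" "emeasure \<mu> W2 \<noteq> 0" using open_pos[OF W(1)] open_pos[OF W(3)] by auto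
  ultimately show False by auto
qed

lemma open_off_diagonal: "open {z \<in> D \<times> D. fst z \<noteq> snd z}"
proof -
  have o: "open {z :: 'x \<times> 'x. fst z \<noteq> snd z}" by (intro open_Collect_neq continuous_intros)
  have eq: "{z \<in> D \<times> D. fst z \<noteq> snd z} = (D \<times> D) \<inter> {z. fst z \<noteq> snd z}" by blast
  from open_Int[OF open_D2 o] show ?thesis unfolding eq .
qed

abbreviation "off_diagonal \<equiv> {z \<in> D \<times> D. fst z \<noteq> snd z}"

text \<open>The phase \<open>\<psi>\<close> is bounded away from \<open>0\<close> on the support of the test
  function, and adding \<open>\<i> \<epsilon>\<close> only increases its modulus since
  \<open>Im \<psi> \<ge> 0\<close>. Hence the expansion after integration by parts is bounded
  uniformly in \<open>\<epsilon>\<close>, and the limit may be taken under the integral. The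
  remainder \<open>G\<close> is continuous up to the diagonal, where the phase vanishes and
  \<open>G\<close> is the plain integral of \<open>g\<close>.\<close>

theorem osc_integral_off_diagonal:
  assumes n: "n \<ge> 1" and b: "classical_symbol c (real n) b bs" and osc: "osc_integral c \<mu> \<psi> b I"
    and sm: "smooth2 c \<psi>" and ph: "\<forall>x\<in>D. \<forall>y\<in>D. 0 \<le> Im (\<psi> x y) \<and> (\<psi> x y = 0 \<longleftrightarrow> x = y)"
  shows "\<exists>G. continuous_on (D \<times> D) (\<lambda>(x, y). G x y) \<and> (\<forall>x\<in>D. G x x = fact (n - 1) * bs 1 x x) \<and>
    (\<forall>\<theta>. test_fun2 c \<theta> \<longrightarrow> closure {(x, y). \<theta> x y \<noteq> 0} \<subseteq> {z \<in> D \<times> D. fst z \<noteq> snd z} \<longrightarrow>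
       I \<theta> = pairing \<mu> (singular_kernel n \<psi> (bs 0) G) \<theta>)"
proof -
  have \<psi>: "smooth2 c \<psi>" "\<And>x y. x \<in> D \<Longrightarrow> y \<in> D \<Longrightarrow> 0 \<le> Im (\<psi> x y)" "\<And>x y. x \<in> D \<Longrightarrow> y \<in> D \<Longrightarrow> \<psi> x y = 0 \<longleftrightarrow> x = y"
    using sm ph by auto
  obtain \<tau> where tau: "cutoff \<tau>" and lim: "\<And>\<theta>. test_fun2 c \<theta> \<Longrightarrow>
     ((\<lambda>\<epsilon>. pairing \<mu> (\<lambda>x y. LINT t:{0<..}|lborel.
        of_real (\<tau> t) * wave (\<psi> x y + \<i> * of_real \<epsilon>) t * b x y t) \<theta>) \<longlongrightarrow> I \<theta>) (at_right 0)"
    using osc unfolding osc_integral_def by blast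
  obtain g where gt: "\<forall>P\<in>S \<times> S. continuous_on {0<..} (g P)" and gP: "\<forall>t>0. continuous_on (S \<times> S) (\<lambda>P. g P t)"
    and gbd: "\<forall>K. compact K \<longrightarrow> K \<subseteq> S \<times> S \<longrightarrow> (\<exists>C. \<forall>P\<in>K. \<forall>t>0. norm (g P t) \<le> C / (1 + t)\<^sup>2)"
    and gint: "\<forall>P\<in>S \<times> S. (LINT t:{0<..}|lborel. g P t) = fact (n - 1) * rep2 c (bs 1) P"
    and gexp: "\<forall>P\<in>S \<times> S. \<forall>\<zeta>. Im \<zeta> > 0 \<longrightarrow>
        (LINT t:{0<..}|lborel. wave \<zeta> t * (of_real (\<tau> t) * rep3 c b (fst P, snd P, t)))
        = (\<i> / \<zeta>) ^ Suc n * (fact n * rep2 c (bs 0) P) + (\<i> / \<zeta>) ^ n * (LINT t:{0<..}|lborel. wave \<zeta> t * g P t)"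
    using classical_symbol_expansion[OF chart n b tau] by (elim exE conjE) (rule that)
  define \<gamma> where "\<gamma> e P = (LINT t:{0<..}|lborel. wave (rep2 c \<psi> P + \<i> * of_real e) t * g P t)" for e P
  have \<psi>S: "continuous_on (S \<times> S) (rep2 c \<psi>)" using \<psi>(1) smooth_on_continuous by (auto simp: smooth2_def)
  have Im\<psi>: "0 \<le> Im (rep2 c \<psi> P)" if "P \<in> S \<times> S" for P
    using \<psi>(2) cinv_in[OF chart] that by (auto simp: rep2_def)
  have \<gamma>lim: "(\<lambda>k. \<gamma> (e k) (X k)) \<longlonglongrightarrow> \<gamma> e' P"
    if X: "\<And>k. X k \<in> S \<times> S" "X \<longlonglongrightarrow> P" "P \<in> S \<times> S" and e: "\<And>k. 0 \<le> e k" "e \<longlonglongrightarrow> e'" for X P e e'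
  proof -
    let ?K = "insert P (range X)"
    have "range X \<subseteq> S \<times> S" using X(1) by blast
    then have K: "compact ?K" "?K \<subseteq> S \<times> S"
      using compact_sequence_with_limit[OF X(2)] X(3) by (simp_all only: insert_subset simp_thms)
    obtain C where C': "\<forall>P\<in>?K. \<forall>t>0. norm (g P t) \<le> C / (1 + t)\<^sup>2"
      using gbd[rule_format, OF K] ..
    have C: "norm (g Y t) \<le> C / (1 + t)\<^sup>2" if "Y \<in> ?K" "t > 0" for Y t
      using bspec[OF C' that(1)] that(2) by simp
    have c\<psi>: "(\<lambda>k. rep2 c \<psi> (X k)) \<longlonglongrightarrow> rep2 c \<psi> P"
      using continuous_on_tendsto_compose[OF \<psi>S X(2,3)] X(1) by simp
    show ?thesis unfolding \<gamma>_def
    proof (rule half_line_integral_tendsto[where P = ?K and C = C])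
      show "(\<lambda>k. g (X k) t) \<longlonglongrightarrow> g P t" if "t > 0" for t
        using continuous_on_tendsto_compose[OF gP[rule_format, OF that] X(2,3)] X(1) by simp
      show "(\<lambda>k. rep2 c \<psi> (X k) + \<i> * of_real (e k)) \<longlonglongrightarrow> rep2 c \<psi> P + \<i> * of_real e'"
        by (intro tendsto_intros c\<psi> e)
      show "Im (rep2 c \<psi> (X k) + \<i> * of_real (e k)) \<ge> 0" for k using Im\<psi>[OF X(1)] e(1) by simp
      show "continuous_on {0<..} (g x)" if "x \<in> ?K" for x using gt K(2) that by blast
    qed (use C in auto)
  qed
  have \<gamma>c: "continuous_on (S \<times> S) (\<gamma> e)" if "e \<ge> 0" for e
    unfolding continuous_on_sequentially o_def using \<gamma>lim[where e = "\<lambda>_. e" and e' = e] that by auto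
  define G where "G x y = \<gamma> 0 (cmap c x, cmap c y)" for x y
  have GS: "rep2 c G P = \<gamma> 0 P" if "P \<in> S \<times> S" for P
    using that by (auto simp: G_def rep2_def cmap_cinv[OF chart])
  have Gc: "continuous_on (D \<times> D) (\<lambda>(x, y). G x y)"
    by (rule continuous_rep2[OF continuous_on_eq[OF \<gamma>c[of 0]]]) (auto simp: GS)
  have Gd: "G x x = fact (n - 1) * bs 1 x x" if x: "x \<in> D" for x
  proof -
    have P: "(cmap c x, cmap c x) \<in> S \<times> S" using cmap_in[OF chart x] by simp
    have "G x x = (LINT t:{0<..}|lborel. g (cmap c x, cmap c x) t)"
      using \<psi>(3)[OF x x] by (simp add: G_def \<gamma>_def rep2_cmap[OF x x])
    then show ?thesis using gint P by (simp add: rep2_cmap[OF x x])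
  qed
  have main: "I \<theta> = pairing \<mu> (singular_kernel n \<psi> (bs 0) G) \<theta>"
    if \<theta>: "test_fun2 c \<theta>" and supp: "closure {(x, y). \<theta> x y \<noteq> 0} \<subseteq> {z \<in> D \<times> D. fst z \<noteq> snd z}" for \<theta>
  proof -
    define K where "K = closure {(x, y). \<theta> x y \<noteq> 0}"
    let ?V = "{z \<in> D \<times> D. fst z \<noteq> snd z}"
    have K: "compact K" "K \<subseteq> ?V" using \<theta> supp by (simp_all add: test_fun2_def K_def)
    have \<theta>0: "\<theta> (fst z) (snd z) = 0" if "z \<notin> K" for z
      using that subsetD[OF closure_subset[of "{(x, y). \<theta> x y \<noteq> 0}"], of z] by (auto simp: K_def case_prod_unfold)
    define m where "m z = (cmap c (fst z), cmap c (snd z))" for z :: "'x \<times> 'x"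
    have mS: "m z \<in> S \<times> S" if "z \<in> D \<times> D" for z using that cmap_in[OF chart] by (auto simp: m_def)
    have mc: "continuous_on (D \<times> D) m" unfolding m_def
      by (intro continuous_on_Pair continuous_on_compose2[OF continuous_cmap[OF chart]] continuous_intros) auto
    define \<Phi> where "\<Phi> e z = \<psi> (fst z) (snd z) + \<i> * of_real e" for e and z :: "'x \<times> 'x"
    define f where "f e z = ((\<i> / \<Phi> e z) ^ Suc n * (fact n * bs 0 (fst z) (snd z)) + (\<i> / \<Phi> e z) ^ n * \<gamma> e (m z)) * \<theta> (fst z) (snd z)" for e z
    have \<psi>c: "continuous_on (D \<times> D) (\<lambda>z. \<psi> (fst z) (snd z))" using smooth2_continuous[OF \<psi>(1)] by (simp add: case_prod_unfold)
    have b0c: "continuous_on (D \<times> D) (\<lambda>z. bs 0 (fst z) (snd z))"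
      using smooth2_continuous[of "bs 0"] b by (simp add: case_prod_unfold classical_symbol_def)
    have \<theta>c: "continuous_on (D \<times> D) (\<lambda>z. \<theta> (fst z) (snd z))" using test_fun2_continuous[OF \<theta>] by (simp add: case_prod_unfold)
    have \<gamma>m: "continuous_on (D \<times> D) (\<lambda>z. \<gamma> e (m z))" if "e \<ge> 0" for e
      by (rule continuous_on_compose2[OF \<gamma>c[OF that] mc]) (rule image_subsetI, rule mS)
    have \<Phi>ge: "cmod (\<psi> (fst z) (snd z)) \<le> cmod (\<Phi> e z)" if "z \<in> D \<times> D" "e \<ge> 0" for e z
      unfolding \<Phi>_def using \<psi>(2) that by (intro cmod_add_imaginary_ge) auto
    have \<Phi>nz: "\<Phi> e z \<noteq> 0" if "z \<in> ?V" "e \<ge> 0" for e z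
      using \<Phi>ge[of z e] that \<psi>(3)[of "fst z" "snd z"] by auto
    have fc: "continuous_on ?V (f e)" if "e \<ge> 0" for e
      unfolding f_def
      by (intro continuous_intros continuous_on_subset[OF b0c] continuous_on_subset[OF \<gamma>m[OF that]] continuous_on_subset[OF \<theta>c])
        (use \<Phi>nz[OF _ that] continuous_on_subset[OF \<psi>c, of ?V] in \<open>auto simp: \<Phi>_def intro!: continuous_intros\<close>)
    have f0: "f e z = 0" if "z \<notin> K" for e z using \<theta>0[OF that] by (simp add: f_def)
    have fm: "f e \<in> borel_measurable \<mu>2" if "e \<ge> 0" for e
      by (rule pair_measurable[OF open_off_diagonal fc[OF that]]) (use f0 K(2) in blast)
    have KD: "K \<subseteq> D \<times> D" using K by auto
    have mK: "compact (m ` K)" "m ` K \<subseteq> S \<times> S"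
      using compact_continuous_image[OF continuous_on_subset[OF mc KD] K(1)] mS KD by blast+
    obtain C where C': "\<forall>P\<in>m ` K. \<forall>t>0. norm (g P t) \<le> C / (1 + t)\<^sup>2"
      using gbd[rule_format, OF mK] ..
    have C: "norm (g (m z) t) \<le> C / (1 + t)\<^sup>2" if "z \<in> K" "t > 0" for z t
      using bspec[OF C' imageI[OF that(1)]] that(2) by simp
    define L where "L = C * (LINT t:{0<..}|lborel. 1 / (1 + t)\<^sup>2)"
    have \<gamma>bd: "norm (\<gamma> e (m z)) \<le> L" if z: "z \<in> K" and e: "e \<ge> 0" for e z
    proof -
      have P: "m z \<in> S \<times> S" using mS z KD by auto
      show ?thesis unfolding \<gamma>_def L_def
      proof (rule norm_half_line_integral_le)
        show "continuous_on {0<..} (\<lambda>t. wave (rep2 c \<psi> (m z) + \<i> * of_real e) t * g (m z) t)"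
          using gt P by (intro continuous_intros) auto
        fix t :: real assume t: "t > 0"
        have "norm (wave (rep2 c \<psi> (m z) + \<i> * of_real e) t * g (m z) t) \<le> 1 * norm (g (m z) t)"
          unfolding norm_mult norm_exp_half_line using t e Im\<psi>[OF P] by (intro mult_right_mono) auto
        then show "norm (wave (rep2 c \<psi> (m z) + \<i> * of_real e) t * g (m z) t) \<le> C / (1 + t)\<^sup>2"
          using C[OF z t] by simp
      qed
    qed
    have "continuous_on K (\<lambda>z. \<i> / \<psi> (fst z) (snd z))"
      using \<psi>(3) K(2) by (intro continuous_intros continuous_on_subset[OF \<psi>c KD]) auto
    from compact_bound[OF K(1) this] obtain B1 where B1: "B1 \<ge> 0" "\<And>z. z \<in> K \<Longrightarrow> norm (\<i> / \<psi> (fst z) (snd z)) \<le> B1" by blast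
    obtain B2 where B2: "B2 \<ge> 0" "\<And>z. z \<in> K \<Longrightarrow> norm (fact n * bs 0 (fst z) (snd z)) \<le> B2"
      using compact_bound[OF K(1) continuous_on_mult[OF continuous_on_const continuous_on_subset[OF b0c KD]], of "fact n"] by blast
    obtain B3 where B3: "B3 \<ge> 0" "\<And>z. z \<in> K \<Longrightarrow> norm (\<theta> (fst z) (snd z)) \<le> B3"
      using compact_bound[OF K(1) continuous_on_subset[OF \<theta>c KD]] by blast
    define B where "B = (B1 ^ Suc n * B2 + B1 ^ n * \<bar>L\<bar>) * B3"
    have fbd: "norm (f e z) \<le> B" if e: "e \<ge> 0" for e z
    proof (cases "z \<in> K")
      case True
      have zV: "z \<in> ?V" using True K by auto
      have "norm (\<i> / \<Phi> e z) \<le> norm (\<i> / \<psi> (fst z) (snd z))"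
        unfolding norm_divide norm_ii using \<Phi>ge[of z e] \<psi>(3)[of "fst z" "snd z"] zV e by (intro divide_left_mono mult_pos_pos) (auto simp: \<Phi>nz)
      then have i: "norm (\<i> / \<Phi> e z) \<le> B1" using B1(2)[OF True] by simp
      let ?a = "(\<i> / \<Phi> e z) ^ Suc n * (fact n * bs 0 (fst z) (snd z))" and ?b = "(\<i> / \<Phi> e z) ^ n * \<gamma> e (m z)"
      have "norm (f e z) = norm (?a + ?b) * norm (\<theta> (fst z) (snd z))" unfolding f_def by (rule norm_mult)
      also have "\<dots> \<le> (norm ?a + norm ?b) * norm (\<theta> (fst z) (snd z))"
        by (intro mult_right_mono norm_triangle_ineq norm_ge_zero)
      finally have le: "norm (f e z) \<le> (norm ?a + norm ?b) * norm (\<theta> (fst z) (snd z))" .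
      have na: "norm ?a = norm (\<i> / \<Phi> e z) ^ Suc n * norm (fact n * bs 0 (fst z) (snd z))"
        by (simp only: norm_mult[of "(\<i> / \<Phi> e z) ^ Suc n"] norm_power)
      have nb: "norm ?b = norm (\<i> / \<Phi> e z) ^ n * norm (\<gamma> e (m z))"
        by (simp only: norm_mult norm_power)
      note le
      also have "(norm ?a + norm ?b) * norm (\<theta> (fst z) (snd z)) \<le> B" unfolding na nb B_def
        by (intro mult_mono add_mono power_mono i B2(2) B3(2) True order_trans[OF \<gamma>bd[OF True e] abs_ge_self]) (use B1 B2 B3 in auto)
      finally show ?thesis .
    next
      case False
      have "B \<ge> 0" using B1 B2 B3 by (simp add: B_def)
      then show ?thesis using f0[OF False] by simp
    qed
    \<comment> \<open>a sequence of dampings, so that dominated convergence applies\<close>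
    define e where "e k = inverse (real (Suc k))" for k
    have e: "e k > 0" for k by (simp add: e_def)
    have e0: "e \<longlonglongrightarrow> 0" unfolding e_def by (rule LIMSEQ_inverse_real_of_nat)
    have "filterlim e (at_right 0) sequentially"
      using e0 e by (auto simp: filterlim_at intro!: always_eventually less_imp_neq[symmetric])
    from filterlim_compose[OF lim[OF \<theta>] this]
    have "(\<lambda>k. pairing \<mu> (\<lambda>x y. LINT t:{0<..}|lborel.
        of_real (\<tau> t) * wave (\<psi> x y + \<i> * of_real (e k)) t * b x y t) \<theta>) \<longlonglongrightarrow> I \<theta>" .
    moreover have "pairing \<mu> (\<lambda>x y. LINT t:{0<..}|lborel.
        of_real (\<tau> t) * wave (\<psi> x y + \<i> * of_real (e k)) t * b x y t) \<theta> = (LINT z|\<mu>2. f (e k) z)" for k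
      unfolding pairing_def
    proof (rule Bochner_Integration.integral_cong[OF refl])
      fix z
      show "(LINT t:{0<..}|lborel. of_real (\<tau> t) * wave (\<psi> (fst z) (snd z) + \<i> * of_real (e k)) t * b (fst z) (snd z) t) * \<theta> (fst z) (snd z) = f (e k) z"
      proof (cases "z \<in> K")
        case False then show ?thesis using \<theta>0 f0 by simp
      next
        case True
        then have zD: "fst z \<in> D" "snd z \<in> D" using KD by auto
        have P: "m z \<in> S \<times> S" using mS True KD by auto
        have r3: "rep3 c b (fst (m z), snd (m z), t) = b (fst z) (snd z) t" for t
          using zD by (simp add: rep3_def m_def cinv_cmap[OF chart])
        have r2: "rep2 c q (m z) = q (fst z) (snd z)" for q using rep2_cmap[OF zD] by (simp add: m_def)
        have Im: "Im (\<Phi> (e k) z) > 0" using \<psi>(2)[OF zD] e[of k] by (simp add: \<Phi>_def add_nonneg_pos)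
        have "(LINT t:{0<..}|lborel. of_real (\<tau> t) * wave (\<Phi> (e k) z) t * b (fst z) (snd z) t)
          = (\<i> / \<Phi> (e k) z) ^ Suc n * (fact n * bs 0 (fst z) (snd z)) + (\<i> / \<Phi> (e k) z) ^ n * \<gamma> (e k) (m z)"
          using gexp[rule_format, OF P Im] unfolding r3 r2 \<gamma>_def \<Phi>_def by (simp add: mult_ac)
        then show ?thesis by (simp add: f_def \<Phi>_def)
      qed
    qed
    ultimately have l1: "(\<lambda>k. LINT z|\<mu>2. f (e k) z) \<longlonglongrightarrow> I \<theta>" by simp
    have l2: "(\<lambda>k. LINT z|\<mu>2. f (e k) z) \<longlonglongrightarrow> (LINT z|\<mu>2. f 0 z)"
    proof (rule integral_dominated_convergence[where w = "\<lambda>_. B"])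
      show "f 0 \<in> borel_measurable \<mu>2" by (rule fm) simp
      show "f (e k) \<in> borel_measurable \<mu>2" for k by (rule fm) (use e less_imp_le in blast)
      show "integrable \<mu>2 (\<lambda>_. B)" by (rule finite_measure.integrable_const[OF finite_pair])
      show "AE z in \<mu>2. norm (f (e k) z) \<le> B" for k using fbd less_imp_le[OF e] by (intro AE_I2) blast
      show "AE z in \<mu>2. (\<lambda>k. f (e k) z) \<longlonglongrightarrow> f 0 z"
      proof (rule AE_I2)
        fix z show "(\<lambda>k. f (e k) z) \<longlonglongrightarrow> f 0 z"
        proof (cases "z \<in> K")
          case True
          then have P: "m z \<in> S \<times> S" and zV: "z \<in> ?V" using mS KD K by auto
          have "(\<lambda>k. \<gamma> (e k) (m z)) \<longlonglongrightarrow> \<gamma> 0 (m z)"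
            by (rule \<gamma>lim[of "\<lambda>_. m z"]) (use P e e0 less_imp_le in auto)
          moreover have "(\<lambda>k. \<Phi> (e k) z) \<longlonglongrightarrow> \<Phi> 0 z" unfolding \<Phi>_def by (intro tendsto_intros e0)
          ultimately show ?thesis unfolding f_def by (intro tendsto_intros) (use \<Phi>nz[OF zV, of 0] in auto)
        qed (simp add: f0)
      qed
    qed
    have "I \<theta> = (LINT z|\<mu>2. f 0 z)" by (rule LIMSEQ_unique[OF l1 l2])
    then show ?thesis by (simp add: pairing_def singular_kernel_def f_def \<Phi>_def G_def m_def)
  qed
  show ?thesis using Gc Gd main by blast
qed

end

section \<open>Approach to the diagonal along the Reeb field\<close>

lemma has_vector_derivative_quotient:
  fixes F :: "real \<Rightarrow> 'b::real_normed_vector"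
  assumes "(F has_vector_derivative D) (at 0)"
  shows "((\<lambda>h. (F h - F 0) /\<^sub>R h) \<longlongrightarrow> D) (at 0)"
proof -
  have "((\<lambda>h. norm ((F h - F 0 - h *\<^sub>R D) /\<^sub>R norm h)) \<longlongrightarrow> 0) (at 0)"
    using assms by (intro tendsto_norm_zero) (simp add: has_vector_derivative_def has_derivative_def)
  then have "((\<lambda>h. norm ((F h - F 0) /\<^sub>R h - D)) \<longlongrightarrow> 0) (at 0)"
  proof (rule Lim_transform_eventually)
    have "norm ((F h - F 0 - h *\<^sub>R D) /\<^sub>R norm h) = norm ((F h - F 0) /\<^sub>R h - D)" if "h \<noteq> 0" for h
    proof -
      have "(F h - F 0) /\<^sub>R h - D = (F h - F 0 - h *\<^sub>R D) /\<^sub>R h" using that by (simp add: scaleR_diff_right)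
      then show ?thesis by simp
    qed
    then show "\<forall>\<^sub>F h in at 0. norm ((F h - F 0 - h *\<^sub>R D) /\<^sub>R norm h) = norm ((F h - F 0) /\<^sub>R h - D)"
      by (auto simp: eventually_at_filter)
  qed
  then show ?thesis by (rule LIM_zero_cancel[OF tendsto_norm_zero_cancel])
qed

text \<open>The mean value inequality for \<open>h\<close> on \<open>{0..t}\<close>, with
  \<open>h'\<close> bounded by a small multiple of \<open>t\<close>.\<close>

lemma second_order_flat_quotient:
  fixes h h' :: "real \<Rightarrow> complex"
  assumes r: "r > 0" and der: "\<And>t. \<bar>t\<bar> < r \<Longrightarrow> (h has_vector_derivative h' t) (at t)"
    and 0: "h 0 = 0" "h' 0 = 0" and der2: "(h' has_vector_derivative 0) (at 0)"
  shows "((\<lambda>t. h t / (of_real t)\<^sup>2) \<longlongrightarrow> 0) (at_right 0)"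
proof (rule tendstoI)
  fix e :: real assume e: "e > 0"
  have "((\<lambda>t. (h' t - h' 0) /\<^sub>R t) \<longlongrightarrow> 0) (at 0)" by (rule has_vector_derivative_quotient[OF der2])
  then have "eventually (\<lambda>t. dist ((h' t - h' 0) /\<^sub>R t) 0 < e / 2) (at 0)" by (rule tendstoD) (use e in simp)
  then obtain d where d: "d > 0" "\<And>t. t \<noteq> 0 \<Longrightarrow> \<bar>t\<bar> < d \<Longrightarrow> norm (h' t /\<^sub>R t) < e / 2"
    using 0 by (auto simp: eventually_at dist_real_def)
  have h'bd: "norm (h' t) \<le> e / 2 * \<bar>t\<bar>" if "\<bar>t\<bar> < d" for t
  proof (cases "t = 0")
    case False then show ?thesis using d(2)[OF False that] by (simp add: divide_simps mult.commute)
  qed (simp add: 0)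
  have "norm (h t / (of_real t)\<^sup>2) < e" if t: "0 < t" "t < min r d" for t
  proof -
    have "norm (h t - h 0) \<le> (e / 2 * t) * norm (t - 0)"
    proof (rule differentiable_bound[of "{0..t}" _ "\<lambda>s w. w *\<^sub>R h' s"])
      fix s assume s: "s \<in> {0..t}"
      show "(h has_derivative (\<lambda>w. w *\<^sub>R h' s)) (at s within {0..t})"
        using has_vector_derivative_at_within[OF der[of s]] s t by (simp add: has_vector_derivative_def)
      have "norm (h' s) \<le> e / 2 * t"
        using h'bd[of s] s t e by (smt (verit, best) atLeastAtMost_iff divide_pos_pos mult_left_mono)
      then have "norm (w *\<^sub>R h' s) \<le> e / 2 * t * norm w" for w :: real
        using mult_right_mono[of "norm (h' s)" "e / 2 * t" "norm w"] by (simp add: mult.commute[of "\<bar>w\<bar>"])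
      then show "onorm (\<lambda>w. w *\<^sub>R h' s) \<le> e / 2 * t" by (rule onorm_le)
    qed (use t in auto)
    then have "norm (h t) \<le> e / 2 * t\<^sup>2" using t by (simp add: 0 power2_eq_square)
    also have "\<dots> < e * t\<^sup>2" using t e by simp
    finally show ?thesis using t by (simp add: norm_divide norm_power divide_simps)
  qed
  then show "eventually (\<lambda>t. dist (h t / (of_real t)\<^sup>2) 0 < e) (at_right 0)"
    using r d(1) unfolding eventually_at_right_field by (intro exI[of _ "min r d"]) auto
qed

context smooth_manifold
begin

lemma chart_line:
  assumes c: "c \<in> charts A" "x \<in> cdom c"
  obtains r where "r > 0" "\<And>t. \<bar>t\<bar> < r \<Longrightarrow> cmap c x + t *\<^sub>R \<tau> \<in> cimg c"
proof -
  have ch: "is_chart c" by (rule charts_is_chart[OF c(1)])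
  obtain d where d: "d > 0" "ball (cmap c x) d \<subseteq> cimg c"
    using cimg_open[OF ch] cmap_in[OF ch c(2)] open_contains_ball by blast
  have "cmap c x + t *\<^sub>R \<tau> \<in> cimg c" if "\<bar>t\<bar> < d / (norm \<tau> + 1)" for t
  proof -
    have pos: "norm \<tau> + 1 > 0" by (simp add: add_nonneg_pos)
    have "\<bar>t\<bar> * norm \<tau> \<le> \<bar>t\<bar> * (norm \<tau> + 1)" by (intro mult_left_mono) auto
    also have "\<dots> < d" using that pos by (simp only: pos_less_divide_eq)
    finally have "cmap c x + t *\<^sub>R \<tau> \<in> ball (cmap c x) d" by (simp add: dist_norm)
    then show ?thesis using d by blast
  qed
  then show ?thesis using that[of "d / (norm \<tau> + 1)"] d(1) by (simp add: add_nonneg_pos)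
qed

lemma vector_apply_line:
  assumes c: "c \<in> charts A" "x \<in> cdom c" and v: "v \<in> CT A x" "\<And>k. comps c v $ k = of_real (\<tau> $ k)" and u: "smooth_fun A (cdom c) u"
  shows "v u = fd (u \<circ> cinv c) (cmap c x) \<tau>"
  using CT_apply[OF c v(1) smooth_near_smooth_fun[OF u c(2)]]
    frechet_derivative_axis_sum[OF smooth_near_differentiable[OF smooth_near_smooth_fun[OF u c(2)] c], of \<tau>]
  by (simp add: v(2))

lemma line_quotient:
  assumes c: "c \<in> charts A" "x \<in> cdom c" and v: "v \<in> CT A x" "\<And>k. comps c v $ k = of_real (\<tau> $ k)" and u: "smooth_fun A (cdom c) u"
  shows "((\<lambda>t. (u (cinv c (cmap c x + t *\<^sub>R \<tau>)) - u x) / of_real t) \<longlongrightarrow> v u) (at_right 0)"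
proof -
  have ch: "is_chart c" by (rule charts_is_chart[OF c(1)])
  have "((\<lambda>t. (u \<circ> cinv c) (cmap c x + t *\<^sub>R \<tau>)) has_vector_derivative v u) (at 0)"
    using frechet_derivative_line[of "u \<circ> cinv c" "cmap c x" 0 \<tau>] smooth_near_differentiable[OF smooth_near_smooth_fun[OF u c(2)] c]
      vector_apply_line[OF assms] by simp
  from has_vector_derivative_quotient[OF this]
  have "((\<lambda>t. (u (cinv c (cmap c x + t *\<^sub>R \<tau>)) - u x) / of_real t) \<longlongrightarrow> v u) (at 0)"
    by (simp add: cinv_cmap[OF ch c(2)] scaleR_conv_of_real divide_inverse mult.commute)
  then show ?thesis by (rule tendsto_mono[OF at_le[OF subset_UNIV]])
qed

text \<open>In coordinates \<open>V (V u)\<close> is the second derivative of \<open>u\<close> in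
  the direction \<open>\<tau>\<close> plus first derivatives of \<open>u\<close> weighted by
  derivatives of the components of \<open>V\<close>. If \<open>u1\<close> and \<open>u2\<close> have
  the same first derivatives, the latter cancel in the difference, which is therefore flat to second
  order along the line.\<close>

lemma second_order_line_quotient:
  assumes c: "c \<in> charts A" "x \<in> cdom c" and V: "smooth_vfield A UNIV V" "\<And>k. comps c (V x) $ k = of_real (\<tau> $ k)"
    and u: "smooth_fun A (cdom c) u1" "smooth_fun A (cdom c) u2"
    and eq0: "u1 x = u2 x" and eq1: "\<And>k. pd c k u1 (cmap c x) = pd c k u2 (cmap c x)"
    and eq2: "V x (\<lambda>q. V q u1) = V x (\<lambda>q. V q u2)"
  shows "((\<lambda>t. (u2 (cinv c (cmap c x + t *\<^sub>R \<tau>)) - u1 (cinv c (cmap c x + t *\<^sub>R \<tau>))) / (of_real t)\<^sup>2) \<longlongrightarrow> 0) (at_right 0)"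
proof -
  have ch: "is_chart c" by (rule charts_is_chart[OF c(1)])
  let ?z = "cmap c x"
  have z: "?z \<in> cimg c" by (rule cmap_in[OF ch c(2)])
  have s: "smooth_on (cimg c) (u1 \<circ> cinv c)" "smooth_on (cimg c) (u2 \<circ> cinv c)"
    using smooth_fun_chart[OF u(1) c(1)] smooth_fun_chart[OF u(2) c(1)] by (simp_all add: cimg_def)
  have spd: "smooth_on (cimg c) (pd c k u1)" "smooth_on (cimg c) (pd c k u2)" for k
    using smooth_on_deriv[OF s(1)] smooth_on_deriv[OF s(2)] by auto
  define a where "a k = comps c (V x) $ k" for k
  define d where "d = (\<lambda>z. (u2 \<circ> cinv c) z - (u1 \<circ> cinv c) z)"
  have ds: "smooth_on (cimg c) d" unfolding d_def by (intro smooth_on_diff s)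
  define d1 where "d1 z = fd d z \<tau>" for z
  have d1s: "smooth_on (cimg c) d1" unfolding d1_def by (rule smooth_on_deriv[OF ds])
  have d1_eq: "d1 y = (\<Sum>k\<in>UNIV. a k * (pd c k u2 y - pd c k u1 y))" if y: "y \<in> cimg c" for y
    using frechet_derivative_axis_sum[OF smooth_on_differentiable[OF ds y], of \<tau>]
      frechet_derivative_minus[OF smooth_on_differentiable[OF s(2) y] smooth_on_differentiable[OF s(1) y]]
    by (simp add: d1_def d_def a_def V(2))
  have d10: "d1 ?z = 0" using d1_eq[OF z] eq1 by simp
  have D: "fd d1 ?z \<tau> = 0"
  proof -
    let ?D = "\<lambda>u j k. fd (pd c k u) ?z (axis j 1)"
    have VV: "V x (\<lambda>q. V q u) = (\<Sum>j\<in>UNIV. a j * (\<Sum>k\<in>UNIV. a k * ?D u j k + pd c j (\<lambda>q. comps c (V q) $ k) ?z * pd c k u ?z))"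
      if "smooth_fun A (cdom c) u" for u
    proof -
      have sn: "smooth_near A x u" by (rule smooth_near_smooth_fun[OF that c(2)])
      show ?thesis
        using CT_apply[OF c vfield_CT[OF V(1) UNIV_I] smooth_vfield_near[OF V(1) UNIV_I sn]]
          vfield_pd[OF V(1) UNIV_I c sn] by (simp add: a_def)
    qed
    have "0 = (\<Sum>j\<in>UNIV. a j * (\<Sum>k\<in>UNIV. a k * (?D u2 j k - ?D u1 j k)))"
      using eq2 unfolding VV[OF u(1)] VV[OF u(2)] eq1 by (simp add: sum.distrib distrib_left right_diff_distrib sum_subtractf)
    also have "\<dots> = (\<Sum>k\<in>UNIV. a k * (\<Sum>j\<in>UNIV. a j * (?D u2 j k - ?D u1 j k)))"
      unfolding sum_distrib_left by (subst sum.swap) (simp add: mult_ac)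
    also have "\<dots> = (\<Sum>k\<in>UNIV. a k * fd (\<lambda>z. pd c k u2 z - pd c k u1 z) ?z \<tau>)"
    proof (intro sum.cong refl arg_cong2[of _ _ _ _ "(*)"])
      fix k
      have df: "pd c k u1 differentiable (at ?z)" "pd c k u2 differentiable (at ?z)"
        using smooth_on_differentiable[OF spd(1) z] smooth_on_differentiable[OF spd(2) z] by auto
      have "fd (\<lambda>z. pd c k u2 z - pd c k u1 z) ?z \<tau>
         = fd (pd c k u2) ?z \<tau> - fd (pd c k u1) ?z \<tau>"
        by (rule frechet_derivative_minus[OF df(2,1)])
      also have "\<dots> = (\<Sum>j\<in>UNIV. a j * (?D u2 j k - ?D u1 j k))"
        unfolding frechet_derivative_axis_sum[OF df(2), of \<tau>] frechet_derivative_axis_sum[OF df(1), of \<tau>]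
        by (simp add: a_def V(2) right_diff_distrib sum_subtractf)
      finally show "(\<Sum>j\<in>UNIV. a j * (?D u2 j k - ?D u1 j k)) = fd (\<lambda>z. pd c k u2 z - pd c k u1 z) ?z \<tau>" by simp
    qed
    also have "\<dots> = fd (\<lambda>z. \<Sum>k\<in>UNIV. a k * (pd c k u2 z - pd c k u1 z)) ?z \<tau>"
      by (subst frechet_derivative_sum_mult)
        (auto intro: smooth_on_differentiable[OF smooth_on_diff[OF spd(2) spd(1)] z])
    also have "fd (\<lambda>z. \<Sum>k\<in>UNIV. a k * (pd c k u2 z - pd c k u1 z)) ?z = fd d1 ?z"
      by (rule frechet_derivative_cong_open[OF smooth_on_open[OF ds] z, symmetric])
        (use d1_eq smooth_on_differentiable[OF d1s z] in auto)
    finally show ?thesis by simp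
  qed
  obtain r where r: "r > 0" "\<And>t. \<bar>t\<bar> < r \<Longrightarrow> ?z + t *\<^sub>R \<tau> \<in> cimg c" using chart_line[OF c, of \<tau>] by blast
  have "((\<lambda>t. d (?z + t *\<^sub>R \<tau>) / (of_real t)\<^sup>2) \<longlongrightarrow> 0) (at_right 0)"
  proof (rule second_order_flat_quotient[OF r(1)])
    show "((\<lambda>t. d (?z + t *\<^sub>R \<tau>)) has_vector_derivative d1 (?z + t *\<^sub>R \<tau>)) (at t)" if "\<bar>t\<bar> < r" for t
      unfolding d1_def by (rule frechet_derivative_line[OF smooth_on_differentiable[OF ds r(2)[OF that]]])
    show "((\<lambda>t. d1 (?z + t *\<^sub>R \<tau>)) has_vector_derivative 0) (at 0)"
      using frechet_derivative_line[of d1 ?z 0 \<tau>] smooth_on_differentiable[OF d1s z] D by simp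
  qed (use eq0 d10 in \<open>auto simp: d_def cinv_cmap[OF ch c(2)]\<close>)
  then show ?thesis by (simp add: d_def)
qed

lemma smooth_slice:
  assumes c: "c \<in> charts A" "y \<in> cdom c" and \<psi>: "smooth2 c \<psi>"
  shows "smooth_fun A (cdom c) (\<lambda>x. \<psi> x y)"
proof (rule smooth_fun_chartI[OF c(1)])
  have ch: "is_chart c" by (rule charts_is_chart[OF c(1)])
  show "open (cdom c)" by (rule chart_open[OF ch])
  have "smooth_on (cimg c) (\<lambda>z. (z, cmap c y))"
  proof -
    have "smooth_on (cimg c) (\<lambda>z. (z, 0) + (0, cmap c y))"
      by (intro smooth_on_add smooth_on_const smooth_on_linear bounded_linear_Pair bounded_linear_ident bounded_linear_zero cimg_open[OF ch])
    then show ?thesis by simp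
  qed
  from smooth_on_compose[OF this \<psi>[unfolded smooth2_def]]
  have "smooth_on (cimg c) (\<lambda>z. rep2 c \<psi> (z, cmap c y))" using cmap_in[OF ch c(2)] by auto
  then show "smooth_on (cmap c ` cdom c) ((\<lambda>x. \<psi> x y) \<circ> cinv c)"
    by (simp add: rep2_def cinv_cmap[OF ch c(2)] o_def cimg_def)
qed auto

end

text \<open>Multiply the equation by \<open>t\<^sup>n\<close>. With \<open>u\<^sub>k = \<i> t /
  f\<^sub>k\<close>, which tends to \<open>\<i>\<close>, the leading terms become \<open>n!
  (u\<^sub>2\<^sup>n\<^sup>+\<^sup>1 a - u\<^sub>1\<^sup>n\<^sup>+\<^sup>1 b) / t\<close>, and this
  tends to \<open>0\<close> since \<open>a - b\<close> and \<open>u\<^sub>2 - u\<^sub>1\<close> are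
  both \<open>o(t)\<close>. The right-hand side tends to \<open>0\<close> because \<open>n \<ge>
  1\<close>.\<close>

lemma subleading_coefficients_agree:
  fixes f1 f2 a b G1 G2 F :: "real \<Rightarrow> complex"
  assumes n: "n \<ge> 1"
    and f: "((\<lambda>t. f1 t / of_real t) \<longlongrightarrow> 1) (at_right 0)" "((\<lambda>t. f2 t / of_real t) \<longlongrightarrow> 1) (at_right 0)"
    and ff: "((\<lambda>t. (f2 t - f1 t) / (of_real t)\<^sup>2) \<longlongrightarrow> 0) (at_right 0)"
    and ab: "((\<lambda>t. (a t - b t) / of_real t) \<longlongrightarrow> 0) (at_right 0)" "(b \<longlongrightarrow> b0) (at_right 0)"
    and G: "(G1 \<longlongrightarrow> g1) (at_right 0)" "(G2 \<longlongrightarrow> g2) (at_right 0)" and F: "(F \<longlongrightarrow> F0) (at_right 0)"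
    and eq: "\<forall>\<^sub>F t in at_right 0. f1 t \<noteq> 0 \<and> f2 t \<noteq> 0 \<and>
      ((\<i> / f2 t) ^ Suc n * (fact n * a t) + (\<i> / f2 t) ^ n * G2 t) - ((\<i> / f1 t) ^ Suc n * (fact n * b t) + (\<i> / f1 t) ^ n * G1 t) = F t"
  shows "g1 = g2"
proof -
  define u where "u f t = \<i> / (f t / of_real t)" for f :: "real \<Rightarrow> complex" and t
  have u: "((u f1) \<longlongrightarrow> \<i>) (at_right 0)" "((u f2) \<longlongrightarrow> \<i>) (at_right 0)"
    unfolding u_def using tendsto_divide[OF tendsto_const f(1), of \<i>] tendsto_divide[OF tendsto_const f(2), of \<i>] by auto
  define q where "q t = (u f2 t - u f1 t) / of_real t" for t
  have "((\<lambda>t. \<i> * ((f2 t - f1 t) / (of_real t)\<^sup>2) * (u f1 t * u f2 t)) \<longlongrightarrow> \<i> * 0 * (\<i> * \<i>)) (at_right 0)"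
    by (intro tendsto_intros ff u)
  then have "((\<lambda>t. \<i> * ((f2 t - f1 t) / (of_real t)\<^sup>2) * (u f1 t * u f2 t)) \<longlongrightarrow> 0) (at_right 0)" by simp
  then have q: "(q \<longlongrightarrow> 0) (at_right 0)"
  proof (rule Lim_transform_eventually)
    show "\<forall>\<^sub>F t in at_right 0. \<i> * ((f2 t - f1 t) / (of_real t)\<^sup>2) * (u f1 t * u f2 t) = q t"
      using eq eventually_at_right_less[of 0]
    proof eventually_elim
      case (elim t)
      then show ?case by (simp add: q_def u_def power2_eq_square divide_simps) (simp add: algebra_simps)
    qed
  qed
  define P where "P t = (\<Sum>i<Suc n. u f1 t ^ (Suc n - Suc i) * u f2 t ^ i)" for t
  have P: "(P \<longlongrightarrow> (\<Sum>i<Suc n. \<i> ^ (Suc n - Suc i) * \<i> ^ i)) (at_right 0)"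
    unfolding P_def by (intro tendsto_intros u)
  have "((\<lambda>t. fact n * (u f2 t ^ Suc n * ((a t - b t) / of_real t) + b t * (q t * P t)) + (u f2 t ^ n * G2 t - u f1 t ^ n * G1 t))
     \<longlongrightarrow> fact n * (\<i> ^ Suc n * 0 + b0 * (0 * (\<Sum>i<Suc n. \<i> ^ (Suc n - Suc i) * \<i> ^ i))) + (\<i> ^ n * g2 - \<i> ^ n * g1)) (at_right 0)"
    by (intro tendsto_intros ab G u q P)
  then have l1: "((\<lambda>t. fact n * (u f2 t ^ Suc n * ((a t - b t) / of_real t) + b t * (q t * P t)) + (u f2 t ^ n * G2 t - u f1 t ^ n * G1 t))
     \<longlongrightarrow> \<i> ^ n * (g2 - g1)) (at_right 0)" by (simp add: right_diff_distrib)
  have "((\<lambda>t::real. complex_of_real t ^ n * F t) \<longlongrightarrow> of_real 0 ^ n * F0) (at_right 0)"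
    by (intro tendsto_intros F)
  then have "((\<lambda>t::real. complex_of_real t ^ n * F t) \<longlongrightarrow> 0) (at_right 0)" using n by (simp add: power_0_left)
  then have l2: "((\<lambda>t. fact n * (u f2 t ^ Suc n * ((a t - b t) / of_real t) + b t * (q t * P t)) + (u f2 t ^ n * G2 t - u f1 t ^ n * G1 t))
     \<longlongrightarrow> 0) (at_right 0)"
  proof (rule Lim_transform_eventually)
    show "\<forall>\<^sub>F t in at_right 0. complex_of_real t ^ n * F t
       = fact n * (u f2 t ^ Suc n * ((a t - b t) / of_real t) + b t * (q t * P t)) + (u f2 t ^ n * G2 t - u f1 t ^ n * G1 t)"
      using eq eventually_at_right_less[of 0]
    proof eventually_elim
      case (elim t)
      let ?t = "complex_of_real t"
      have t: "?t \<noteq> 0" using elim by simp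
      have uf: "u f t = ?t * (\<i> / f t)" for f by (simp add: u_def)
      have qP: "q t * P t = (u f2 t ^ Suc n - u f1 t ^ Suc n) / ?t"
        using power_diff_sumr2[of "u f2 t" "Suc n" "u f1 t"] by (simp add: q_def P_def del: sum.lessThan_Suc)
      have "u f2 t ^ Suc n * ((a t - b t) / ?t) + b t * (q t * P t) = (u f2 t ^ Suc n * a t - u f1 t ^ Suc n * b t) / ?t"
        unfolding qP by (simp add: diff_divide_distrib[symmetric] add_divide_distrib[symmetric]) (simp add: algebra_simps)
      also have "\<dots> = ?t ^ n * ((\<i> / f2 t) ^ Suc n * a t - (\<i> / f1 t) ^ Suc n * b t)"
        unfolding uf power_mult_distrib using t by (simp add: field_simps)
      finally have 1: "u f2 t ^ Suc n * ((a t - b t) / ?t) + b t * (q t * P t) = ?t ^ n * ((\<i> / f2 t) ^ Suc n * a t - (\<i> / f1 t) ^ Suc n * b t)" .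
      have 2: "u f2 t ^ n * G2 t - u f1 t ^ n * G1 t = ?t ^ n * ((\<i> / f2 t) ^ n * G2 t - (\<i> / f1 t) ^ n * G1 t)"
        unfolding uf power_mult_distrib by (simp add: algebra_simps)
      have 3: "F t = ((\<i> / f2 t) ^ Suc n * (fact n * a t) + (\<i> / f2 t) ^ n * G2 t) - ((\<i> / f1 t) ^ Suc n * (fact n * b t) + (\<i> / f1 t) ^ n * G1 t)"
        using elim by simp
      show ?case unfolding 1 2 3 by (simp add: algebra_simps del: power_Suc)
    qed
  qed
  have "\<i> ^ n * (g2 - g1) = 0" by (rule tendsto_unique[OF _ l1 l2]) simp
  then show ?thesis by simp
qed

theorem lemma1p1:
  fixes A :: "('x::{t2_space, second_countable_topology}, 'm::finite) chart set"
    and n :: nat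
    and T10 :: "'x \<Rightarrow> 'x tvec set"
    and \<omega> :: "'x oneform"
    and T :: "'x vfield"
    and h :: "'x metric"
    and \<mu> :: "'x measure"
    and c :: "('x, 'm) chart"
    and \<phi> \<phi>1 \<phi>2 :: "'x \<Rightarrow> 'x \<Rightarrow> complex"
    and \<alpha> \<beta> :: "'x \<Rightarrow> 'x \<Rightarrow> real \<Rightarrow> complex"
    and \<alpha>s \<beta>s :: "nat \<Rightarrow> 'x \<Rightarrow> 'x \<Rightarrow> complex"
    and I1 I2 :: "('x \<Rightarrow> 'x \<Rightarrow> complex) \<Rightarrow> complex"
  assumes "n \<ge> 1" and "CARD('m) = 2 * n + 1"
    and "compact (UNIV :: 'x set)"
    and "smooth_atlas A" and "orientable A"
    and "cr_structure A n T10"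
    and "contact_form A T10 \<omega>"
    and "reeb_field A \<omega> T"
    and "levi_metric A T10 \<omega> T h"
    and "volume_measure A h \<mu>"
    and "dbar_b_closed_range A T10 T h \<mu>"
    and "c \<in> charts A"
    and "bms_phase_function A n T10 \<omega> T h \<mu> c \<phi>"
    and "phase_function A \<omega> c \<phi>1" and "phase_function A \<omega> c \<phi>2"
    and "\<forall>x\<in>cdom c. act1 T (act1 T \<phi>1) x x = 0"
    and "\<forall>x\<in>cdom c. act1 T (act1 T \<phi>2) x x = 0"
    and "ms_equivalent c \<phi>1 \<phi>" and "ms_equivalent c \<phi>2 \<phi>"
    and "classical_symbol c (real n) \<alpha> \<alpha>s"
    and "classical_symbol c (real n) \<beta> \<beta>s"
    and "osc_integral c \<mu> \<phi>2 \<alpha> I2" and "osc_integral c \<mu> \<phi>1 \<beta> I1"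
    and "equiv_mod_smooth c \<mu> I2 I1"
    and "\<forall>x\<in>cdom c. \<alpha>s 0 x x = \<beta>s 0 x x"
    and "\<forall>x\<in>cdom c. act1 T (\<alpha>s 0) x x = 0 \<and> act1 T (\<beta>s 0) x x = 0"
  shows "\<forall>x\<in>cdom c. \<alpha>s 1 x x = \<beta>s 1 x x"
proof
  fix x assume x: "x \<in> cdom c"
  note n = assms(1) and c = assms(12) and ph1 = assms(14) and ph2 = assms(15)
  interpret levi_manifold A n T10 \<omega> T h
    by unfold_locales (use assms in auto)
  interpret fm: finite_measure \<mu> by (rule volume_measure_finite[OF assms(10,3)])
  have ch: "is_chart c" by (rule charts_is_chart[OF c])
  interpret chart_measure \<mu> c
    by unfold_locales (use volume_measure_open_pos[OF assms(10)] ch assms(10) in \<open>auto simp: volume_measure_def\<close>)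
  have sp: "smooth2 c \<phi>1" "smooth2 c \<phi>2" using ph1 ph2 by (auto simp: phase_function_def)
  have ph: "\<forall>p\<in>D. \<forall>q\<in>D. 0 \<le> Im (\<phi>1 p q) \<and> (\<phi>1 p q = 0 \<longleftrightarrow> p = q)"
    "\<forall>p\<in>D. \<forall>q\<in>D. 0 \<le> Im (\<phi>2 p q) \<and> (\<phi>2 p q = 0 \<longleftrightarrow> p = q)"
    using ph1 ph2 by (simp_all add: phase_function_def)
  then have zero: "\<phi>1 p q = 0 \<longleftrightarrow> p = q" "\<phi>2 p q = 0 \<longleftrightarrow> p = q" if "p \<in> D" "q \<in> D" for p q
    using that by simp_all
  have s0: "smooth2 c (\<alpha>s 0)" "smooth2 c (\<beta>s 0)" using assms(20,21) by (auto simp: classical_symbol_def)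
  obtain G2 where G2: "continuous_on (D \<times> D) (\<lambda>(x, y). G2 x y)" "\<forall>x\<in>D. G2 x x = fact (n - 1) * \<alpha>s 1 x x"
    "\<forall>\<theta>. test_fun2 c \<theta> \<longrightarrow> closure {(x, y). \<theta> x y \<noteq> 0} \<subseteq> off_diagonal \<longrightarrow> I2 \<theta> = pairing \<mu> (singular_kernel n \<phi>2 (\<alpha>s 0) G2) \<theta>"
    using osc_integral_off_diagonal[OF n assms(20,22) sp(2) ph(2)] by (elim exE conjE) (rule that)
  obtain G1 where G1: "continuous_on (D \<times> D) (\<lambda>(x, y). G1 x y)" "\<forall>x\<in>D. G1 x x = fact (n - 1) * \<beta>s 1 x x"
    "\<forall>\<theta>. test_fun2 c \<theta> \<longrightarrow> closure {(x, y). \<theta> x y \<noteq> 0} \<subseteq> off_diagonal \<longrightarrow> I1 \<theta> = pairing \<mu> (singular_kernel n \<phi>1 (\<beta>s 0) G1) \<theta>"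
    using osc_integral_off_diagonal[OF n assms(21,23) sp(1) ph(1)] by (elim exE conjE) (rule that)
  obtain F where F: "smooth2 c F" "\<And>\<theta>. test_fun2 c \<theta> \<Longrightarrow> I2 \<theta> - I1 \<theta> = pairing \<mu> F \<theta>"
    using assms(24) by (auto simp: equiv_mod_smooth_def)
  define K2 where "K2 = singular_kernel n \<phi>2 (\<alpha>s 0) G2"
  define K1 where "K1 = singular_kernel n \<phi>1 (\<beta>s 0) G1"
  have VD: "off_diagonal \<subseteq> cdom c \<times> cdom c" by auto
  have cV: "continuous_on off_diagonal (\<lambda>z. \<psi> (fst z) (snd z))" if "continuous_on (cdom c \<times> cdom c) (\<lambda>(x, y). \<psi> x y)" for \<psi> :: "'x \<Rightarrow> 'x \<Rightarrow> complex"
    using continuous_on_subset[OF that VD] by (simp add: case_prod_unfold)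
  have K2c: "continuous_on off_diagonal (\<lambda>(p, q). K2 p q)" unfolding K2_def singular_kernel_def case_prod_unfold
    by (intro continuous_intros cV smooth2_continuous sp s0 G2(1)) (use zero in auto)
  have K1c: "continuous_on off_diagonal (\<lambda>(p, q). K1 p q)" unfolding K1_def singular_kernel_def case_prod_unfold
    by (intro continuous_intros cV smooth2_continuous sp s0 G1(1)) (use zero in auto)
  have Fc: "continuous_on off_diagonal (\<lambda>(p, q). F p q)"
    by (rule continuous_on_subset[OF smooth2_continuous[OF F(1)] VD])
  have kernel_eq: "K2 p q - K1 p q = F p q" if pq: "p \<in> cdom c" "q \<in> cdom c" "p \<noteq> q" for p q
  proof -
    have "K2 p q - K1 p q - F p q = 0"
    proof (rule pairing_eq_0_imp[OF open_off_diagonal VD])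
      show "continuous_on off_diagonal (\<lambda>(p, q). K2 p q - K1 p q - F p q)"
        using K2c K1c Fc unfolding case_prod_unfold by (intro continuous_intros)
      show "(p, q) \<in> off_diagonal" using pq by auto
      fix \<theta> assume \<theta>: "test_fun2 c \<theta>" "closure {(x, y). \<theta> x y \<noteq> 0} \<subseteq> off_diagonal"
      note int = pairing_integrable[OF open_off_diagonal VD _ \<theta>]
      have "pairing \<mu> (\<lambda>p q. K2 p q - K1 p q - F p q) \<theta> = pairing \<mu> K2 \<theta> - pairing \<mu> K1 \<theta> - pairing \<mu> F \<theta>"
        unfolding pairing_def left_diff_distrib
        using int[OF K2c] int[OF K1c] int[OF Fc] by simp
      also have "\<dots> = I2 \<theta> - I1 \<theta> - pairing \<mu> F \<theta>"
        using G2(3)[rule_format, OF \<theta>] G1(3)[rule_format, OF \<theta>] by (simp only: K2_def K1_def)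
      finally show "pairing \<mu> (\<lambda>p q. K2 p q - K1 p q - F p q) \<theta> = 0" using F(2)[OF \<theta>(1)] by simp
    qed
    then show ?thesis by simp
  qed
  have TCT: "T x \<in> CT A x" by (rule T_CT)
  \<comment> \<open>the coordinates of \<open>T\<close> at \<open>x\<close>, real because \<open>T\<close> is a real field\<close>
  define \<tau> where "\<tau> = (\<chi> k. Re (comps c (T x) $ k))"
  have real: "comps c (T x) $ k = of_real (\<tau> $ k)" for k
  proof -
    have "vconj (T x) = T x" using assms(8) by (simp add: reeb_field_def)
    then have "comps c (T x) = (\<chi> k. cnj (comps c (T x) $ k))" using comps_vconj[OF c x TCT] by simp
    then have "comps c (T x) $ k = cnj (comps c (T x) $ k)" by (metis vec_lambda_beta)
    then show ?thesis by (simp add: \<tau>_def complex_eq_iff)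
  qed
  have slice: "smooth_fun A (cdom c) (\<lambda>x'. \<psi> x' x)" if "smooth2 c \<psi>" for \<psi> by (rule smooth_slice[OF c x that])
  have diff: "v (\<lambda>x'. \<phi>1 x' x) = - \<omega> x v" "v (\<lambda>x'. \<phi>2 x' x) = - \<omega> x v" if v: "v \<in> CT A x" for v
  proof -
    have d: "differential A (\<lambda>x'. \<psi> x' x) x v = - \<omega> x v" if "phase_function A \<omega> c \<psi>" for \<psi>
    proof -
      have "\<forall>x\<in>cdom c. \<forall>v\<in>CT A x. differential A (\<lambda>x'. \<psi> x' x) x v = - \<omega> x v \<and> differential A (\<lambda>y'. \<psi> x y') x v = \<omega> x v"
        using that unfolding phase_function_def by (elim conjE)
      from conjunct1[OF bspec[OF bspec[OF this x] v]] show ?thesis .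
    qed
    show "v (\<lambda>x'. \<phi>1 x' x) = - \<omega> x v" "v (\<lambda>x'. \<phi>2 x' x) = - \<omega> x v"
      using d[OF ph1] d[OF ph2] v by (simp_all add: differential_def)
  qed
  have T\<phi>: "T x (\<lambda>x'. \<phi>1 x' x) = 1" "T x (\<lambda>x'. \<phi>2 x' x) = 1"
    using diff[OF TCT] assms(8) by (simp_all add: reeb_field_def)
  have pd_eq: "pd c k (\<lambda>x'. \<phi>1 x' x) (cmap c x) = pd c k (\<lambda>x'. \<phi>2 x' x) (cmap c x)" for k
  proof -
    let ?v = "coord_vec A c x (axis k 1)"
    have v: "?v \<in> CT A x" using CT_coord[OF c x] by auto
    have "?v u = pd c k u (cmap c x)" if "smooth_fun A (cdom c) u" for u
      using coord_vec_apply[OF smooth_near_smooth_fun[OF that x], of c "axis k 1"]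
      by (simp add: axis_def if_distrib[of "\<lambda>a. a * _"] sum.delta cong: if_cong)
    then show ?thesis using diff[OF v] slice[OF sp(1)] slice[OF sp(2)] by metis
  qed
  \<comment> \<open>the curve in the first variable, with the second variable kept at \<open>x\<close>\<close>
  define X where "X t = cinv c (cmap c x + t *\<^sub>R \<tau>)" for t
  have xx: "\<phi>1 x x = 0" "\<phi>2 x x = 0" using zero[OF x x] by auto
  have q: "((\<lambda>t. (\<psi> (X t) x - \<psi> x x) / of_real t) \<longlongrightarrow> T x (\<lambda>x'. \<psi> x' x)) (at_right 0)" if "smooth2 c \<psi>" for \<psi>
    unfolding X_def by (rule line_quotient[OF c x TCT real slice[OF that]])
  obtain r where r: "r > 0" "\<And>t. \<bar>t\<bar> < r \<Longrightarrow> cmap c x + t *\<^sub>R \<tau> \<in> cimg c" using chart_line[OF c x, of \<tau>] by blast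
  have \<tau>0: "\<tau> \<noteq> 0"
  proof
    assume "\<tau> = 0"
    then have "T x (\<lambda>x'. \<phi>1 x' x) = 0"
      using CT_apply[OF c x TCT smooth_near_smooth_fun[OF slice[OF sp(1)] x]] by (simp add: real)
    then show False using T\<phi> by simp
  qed
  have XD: "X t \<in> cdom c" if "\<bar>t\<bar> < r" for t unfolding X_def using r(2)[OF that] by (rule cinv_in[OF ch])
  have Xne: "X t \<noteq> x" if "0 < t" "t < r" for t
  proof
    assume "X t = x"
    then have "cmap c x + t *\<^sub>R \<tau> = cmap c x" using cmap_cinv[OF ch r(2)[of t]] that by (simp add: X_def)
    then show False using \<tau>0 that by simp
  qed
  have Xlim: "(X \<longlongrightarrow> x) (at_right 0)"
  proof -
    have "((\<lambda>t. cmap c x + t *\<^sub>R \<tau>) \<longlongrightarrow> cmap c x + 0 *\<^sub>R \<tau>) (at_right 0)" by (intro tendsto_intros)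
    then have l: "((\<lambda>t. cmap c x + t *\<^sub>R \<tau>) \<longlongrightarrow> cmap c x) (at_right 0)" by simp
    have "((\<lambda>t. cinv c (cmap c x + t *\<^sub>R \<tau>)) \<longlongrightarrow> cinv c (cmap c x)) (at_right 0)"
      by (rule continuous_on_tendsto_compose[OF continuous_cinv[OF ch] l cmap_in[OF ch x]])
        (use r in \<open>auto simp: eventually_at_right_field intro!: exI[of _ r]\<close>)
    then show ?thesis by (simp add: X_def[abs_def] cinv_cmap[OF ch x])
  qed
  have near: "\<forall>\<^sub>F t in at_right 0. 0 < t \<and> t < r" using r(1) by (auto simp: eventually_at_right_field intro!: exI[of _ r])
  have clim: "((\<lambda>t. \<psi> (X t) x) \<longlongrightarrow> \<psi> x x) (at_right 0)"
    if "continuous_on (cdom c \<times> cdom c) (\<lambda>(p, q). \<psi> p q)" for \<psi> :: "'x \<Rightarrow> 'x \<Rightarrow> complex"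
  proof -
    have "((\<lambda>t. (X t, x)) \<longlongrightarrow> (x, x)) (at_right 0)" by (intro tendsto_Pair Xlim tendsto_const)
    moreover have "\<forall>\<^sub>F t in at_right 0. (X t, x) \<in> cdom c \<times> cdom c"
      using near by eventually_elim (use XD x in auto)
    ultimately show ?thesis using continuous_on_tendsto_compose[OF that, of "\<lambda>t. (X t, x)" "(x, x)"] x by simp
  qed
  have "fact (n - 1) * \<beta>s 1 x x = fact (n - 1) * \<alpha>s 1 x x"
  proof (rule subleading_coefficients_agree[OF n])
    show "((\<lambda>t. \<phi>1 (X t) x / of_real t) \<longlongrightarrow> 1) (at_right 0)" using q[OF sp(1)] by (simp add: xx T\<phi>)
    show "((\<lambda>t. \<phi>2 (X t) x / of_real t) \<longlongrightarrow> 1) (at_right 0)" using q[OF sp(2)] by (simp add: xx T\<phi>)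
    show "((\<lambda>t. (\<phi>2 (X t) x - \<phi>1 (X t) x) / (of_real t)\<^sup>2) \<longlongrightarrow> 0) (at_right 0)"
      unfolding X_def
      by (rule second_order_line_quotient[OF c x T_smooth real slice[OF sp(1)] slice[OF sp(2)] _ pd_eq])
        (use assms(16,17) x xx in \<open>auto simp: act1_def\<close>)
    have "((\<lambda>t. (\<alpha>s 0 (X t) x - \<alpha>s 0 x x) / of_real t - (\<beta>s 0 (X t) x - \<beta>s 0 x x) / of_real t) \<longlongrightarrow> 0 - 0) (at_right 0)"
      using q[OF s0(1)] q[OF s0(2)] assms(26) x by (intro tendsto_diff) (auto simp: act1_def)
    then show "((\<lambda>t. (\<alpha>s 0 (X t) x - \<beta>s 0 (X t) x) / of_real t) \<longlongrightarrow> 0) (at_right 0)"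
      using assms(25) x by (simp add: diff_divide_distrib)
    show "((\<lambda>t. \<beta>s 0 (X t) x) \<longlongrightarrow> \<beta>s 0 x x) (at_right 0)" by (rule clim[OF smooth2_continuous[OF s0(2)]])
    show "((\<lambda>t. G1 (X t) x) \<longlongrightarrow> fact (n - 1) * \<beta>s 1 x x) (at_right 0)" using clim[OF G1(1)] G1(2) x by simp
    show "((\<lambda>t. G2 (X t) x) \<longlongrightarrow> fact (n - 1) * \<alpha>s 1 x x) (at_right 0)" using clim[OF G2(1)] G2(2) x by simp
    show "((\<lambda>t. F (X t) x) \<longlongrightarrow> F x x) (at_right 0)" by (rule clim[OF smooth2_continuous[OF F(1)]])
    show "\<forall>\<^sub>F t in at_right 0. \<phi>1 (X t) x \<noteq> 0 \<and> \<phi>2 (X t) x \<noteq> 0 \<and>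
      ((\<i> / \<phi>2 (X t) x) ^ Suc n * (fact n * \<alpha>s 0 (X t) x) + (\<i> / \<phi>2 (X t) x) ^ n * G2 (X t) x)
      - ((\<i> / \<phi>1 (X t) x) ^ Suc n * (fact n * \<beta>s 0 (X t) x) + (\<i> / \<phi>1 (X t) x) ^ n * G1 (X t) x) = F (X t) x"
      using near
    proof eventually_elim
      case (elim t)
      then have t: "\<bar>t\<bar> < r" by auto
      show ?case
        using zero[OF XD[OF t] x] Xne[of t] elim kernel_eq[OF XD[OF t] x] by (auto simp: K2_def K1_def singular_kernel_def)
    qed
  qed
  then show "\<alpha>s 1 x x = \<beta>s 1 x x" by simp
qed

end
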